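(* Consider a logarithmic rank 2 $(TE)$-structure $(H\to\mathbb C,\nabla)$ over a point. Let $\lambda_1,\lambda_2$ be the eigenvalues of its monodromy $M^{\mathrm{mon}}$ ($\lambda_1=\lambda_2$ is allowed). (a) The case $N^{\mathrm{mon}}=0$: There exist unique (up to renumbering if $\lambda_1=\lambda_2$) numbers $\alpha_1,\alpha_2\in\mathbb C$ with $e^{-2\pi i\alpha_j}=\lambda_j$ and the following property: there exist elementary sections $s_1\in C^{\alpha_1}\setminus\{0\}$ and $s_2\in C^{\alpha_2}\setminus\{0\}$ such that $$\mathcal O(H)_0=\mathbb C\{z\}\,s_1\oplus\mathbb C\{z\}\,s_2.$$ The isomorphism class of the $(TE)$-structure is uniquely determined by the information $N^{\mathrm{mon}}=0$ and the set $\{\alpha_1,\alpha_2\}$. The numbers $\alpha_1$ and $\alpha_2$ are called leading exponents. (b) The case $N^{\mathrm{mon}}\ne0$ (thus $\lambda_1=\lambda_2$): There exist unique numbers $\alpha_1,\alpha_2\in\mathbb C$ with $e^{-2\pi i\alpha_j}=\lambda_1$ and $\alpha_1-\alpha_2\in\mathbb N_0$ and the following properties: Choose any elementary section $s_1\in C^{\alpha_1}\setminus\ker(\nabla_{z\partial_z}-\alpha_1:C^{\alpha_1}\to C^{\alpha_1})$. The elementary section $s_2\in C^{\alpha_2}$ with $(\nabla_{z\partial_z}-\alpha_1)(s_1)=z^{\alpha_1-\alpha_2}s_2$ is a generator of $\ker(\nabla_{z\partial_z}-\alpha_2:C^{\alpha_2}\to C^{\alpha_2})$. Then $$\mathcal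 O(H)_0=\mathbb C\{z\}\,s_1\oplus\mathbb C\{z\}\,s_2.$$ The isomorphism class of the $(TE)$-structure is uniquely determined by the information $N^{\mathrm{mon}}\neq0$ and the set $\{\alpha_1,\alpha_2\}$. The numbers $\alpha_1$ and $\alpha_2$ are called leading exponents.
   Context: A $(TE)$-structure over a point is a holomorphic vector bundle $H\to\mathbb C$ ($z$ the coordinate) with a holomorphic connection $\nabla$ on $H':=H|_{\mathbb C^*}$ such that $z^2\nabla_{\partial_z}$ maps $\mathcal O(H)$ to $\mathcal O(H)$. $\mathcal O(H)_0$ is the germ at $z=0$ of the sheaf of sections. Isomorphisms are holomorphic bundle isomorphisms respecting the connections. It is logarithmic if $z\nabla_{\partial_z}\mathcal O(H)_0\subset\mathcal O(H)_0$. $M^{\mathrm{mon}}$ is the monodromy ($z\mapsto ze^{2\pi i}$) on the space of global flat multivalued sections of $H'$, and $N^{\mathrm{mon}}$ is the logarithm of its unipotent part (so $N^{\mathrm{mon}}=0$ iff $M^{\mathrm{mon}}$ is semisimple). For $\alpha\in\mathbb C$, $C^\alpha:=\{\sigma\in\mathcal O(H')(\mathbb C^* )\mid(\nabla_{z\partial_z}-\alpha)^2\sigma=0\}$; its elements are called elementary sections; $C^\alpha\ne\{0\}$ iff $e^{-2\pi i\alpha}$ is an eigenvalue of $M^{\mathrm{mon}}$, and $z^kC^\alpha=C^{\alpha+k}$ for $k\in\mathbb Z$. $\mathbb N_0=\{0,1,2,\dots\}$. *)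

theory Defs
  imports
    "HOL-Complex_Analysis.Complex_Analysis"
    "HOL-Library.Function_Algebras"
    "HOL-Library.Multiset"
begin

section \<open>Holomorphic vector bundles over the complex plane\<close>

text \<open>The fibres of a bundle are subspaces of one ambient complex vector space on the type
  \<open>'v\<close>, with scalar multiplication \<open>scl\<close>.  The ambient space has no topology and plays no role
  beyond hosting the fibres, so this is no restriction: it may be the direct sum of all fibres.
  The holomorphic structure is an atlas of local frames \<open>(U, e)\<close> with
  \<open>e 0, \<dots>, e (rk - 1)\<close> defined on the open set \<open>U\<close>.\<close>

record 'v hbundle =
  scl :: "complex \<Rightarrow> 'v \<Rightarrow> 'v"
  rk :: nat
  fib :: "complex \<Rightarrow> 'v set"
  frames :: "(complex set \<times> (nat \<Rightarrow> complex \<Rightarrow> 'v)) set"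

text \<open>The space of holomorphic sections over an open set \<open>W\<close>; values outside \<open>W\<close> are irrelevant.\<close>

definition hsections :: "('v::ab_group_add, 'm) hbundle_scheme \<Rightarrow> complex set \<Rightarrow> (complex \<Rightarrow> 'v) set"
  where "hsections H W =
    {s. (\<forall>z\<in>W. s z \<in> fib H z) \<and>
        (\<forall>(U, e)\<in>frames H. \<exists>f. (\<forall>i<rk H. f i holomorphic_on U \<inter> W) \<and>
           (\<forall>z\<in>U \<inter> W. s z = (\<Sum>i<rk H. scl H (f i z) (e i z))))}"

definition holomorphic_bundle :: "('v::ab_group_add, 'm) hbundle_scheme \<Rightarrow> bool"
  where "holomorphic_bundle H \<longleftrightarrow>
    vector_space (scl H) \<and>
    (\<Union>(U, e)\<in>frames H. U) = UNIV \<and>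
    (\<forall>(U, e)\<in>frames H. open U \<and>
       (\<forall>z\<in>U. inj_on (\<lambda>i. e i z) {..<rk H} \<and>
              \<not> module.dependent (scl H) ((\<lambda>i. e i z) ` {..<rk H}) \<and>
              module.span (scl H) ((\<lambda>i. e i z) ` {..<rk H}) = fib H z)) \<and>
    (\<forall>(U, e)\<in>frames H. \<forall>i<rk H. e i \<in> hsections H U)"


section \<open>(TE)-structures over a point\<close>

text \<open>\<open>nabla\<close> is the covariant derivative along the coordinate vector field of \<open>z\<close>; as the
  cotangent bundle of the punctured plane is trivialised by \<open>dz\<close>, this is the whole connection.
  It is a sheaf morphism, so its value at \<open>z\<close> is determined by the germ of the section at \<open>z\<close>
  (locality, second condition below); it is unspecified where the argument is not holomorphic.\<close>

record 'v te = "'v hbundle" +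
  nabla :: "(complex \<Rightarrow> 'v) \<Rightarrow> complex \<Rightarrow> 'v"

definition holomorphic_connection :: "('v::ab_group_add) te \<Rightarrow> bool"
  where "holomorphic_connection T \<longleftrightarrow>
    (\<forall>U. open U \<and> 0 \<notin> U \<longrightarrow>
      (\<forall>s\<in>hsections T U. nabla T s \<in> hsections T U) \<and>
      (\<forall>s\<in>hsections T U. \<forall>t. (\<forall>z\<in>U. s z = t z) \<longrightarrow> (\<forall>z\<in>U. nabla T s z = nabla T t z)) \<and>
      (\<forall>s\<in>hsections T U. \<forall>t\<in>hsections T U. \<forall>z\<in>U.
         nabla T (\<lambda>x. s x + t x) z = nabla T s z + nabla T t z) \<and>
      (\<forall>s\<in>hsections T U. \<forall>f. f holomorphic_on U \<longrightarrow> (\<forall>z\<in>U.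
         nabla T (\<lambda>x. scl T (f x) (s x)) z
           = scl T (deriv f z) (s z) + scl T (f z) (nabla T s z))))"

definition TE_structure :: "('v::ab_group_add) te \<Rightarrow> bool"
  where "TE_structure T \<longleftrightarrow>
    holomorphic_bundle T \<and> holomorphic_connection T \<and>
    (\<forall>U. open U \<longrightarrow> (\<forall>s\<in>hsections T U. \<exists>t\<in>hsections T U.
       \<forall>z\<in>U - {0}. t z = scl T (z\<^sup>2) (nabla T s z)))"

definition te_isomorphic :: "('v::ab_group_add) te \<Rightarrow> ('w::ab_group_add) te \<Rightarrow> bool"
  where "te_isomorphic T T' \<longleftrightarrow> (\<exists>\<phi>.
    (\<forall>z. bij_betw (\<phi> z) (fib T z) (fib T' z) \<and>
         (\<forall>x\<in>fib T z. \<forall>y\<in>fib T z. \<phi> z (x + y) = \<phi> z x + \<phi> z y) \<and>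
         (\<forall>c. \<forall>x\<in>fib T z. \<phi> z (scl T c x) = scl T' c (\<phi> z x))) \<and>
    (\<forall>U s. open U \<and> (\<forall>z\<in>U. s z \<in> fib T z) \<longrightarrow>
       (s \<in> hsections T U \<longleftrightarrow> (\<lambda>z. \<phi> z (s z)) \<in> hsections T' U)) \<and>
    (\<forall>U. open U \<and> 0 \<notin> U \<longrightarrow> (\<forall>s\<in>hsections T U. \<forall>z\<in>U.
       nabla T' (\<lambda>x. \<phi> x (s x)) z = \<phi> z (nabla T s z))))"

text \<open>The germs of sections at 0, as the set of their representatives on punctured neighbourhoods
  of 0: functions agreeing near 0, but possibly not at 0, with a holomorphic section of the
  bundle.  A germ is determined by its restriction to the punctured neighbourhood; this is what
  allows a comparison with elementary sections, which live on the punctured plane only.\<close>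

definition germs0 :: "('v::ab_group_add) te \<Rightarrow> (complex \<Rightarrow> 'v) set"
  where "germs0 T =
    {t. \<exists>U. open U \<and> 0 \<in> U \<and> (\<exists>s\<in>hsections T U. \<forall>z\<in>U - {0}. t z = s z)}"

definition logarithmic :: "('v::ab_group_add) te \<Rightarrow> bool"
  where "logarithmic T \<longleftrightarrow> (\<forall>t\<in>germs0 T. (\<lambda>z. scl T z (nabla T t z)) \<in> germs0 T)"

text \<open>The submodule generated by \<open>s\<close> over the ring of convergent power series, inside the germs
  of functions on punctured neighbourhoods of 0, and internal direct sums of such submodules.\<close>

definition conv_span :: "('v::ab_group_add) te \<Rightarrow> (complex \<Rightarrow> 'v) \<Rightarrow> (complex \<Rightarrow> 'v) set"
  where "conv_span T s =
    {t. \<exists>f. f analytic_on {0} \<and> (\<forall>\<^sub>F z in at 0. t z = scl T (f z) (s z))}"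

definition is_direct_sum0 ::
    "(complex \<Rightarrow> 'v::ab_group_add) set \<Rightarrow> (complex \<Rightarrow> 'v) set \<Rightarrow> (complex \<Rightarrow> 'v) set \<Rightarrow> bool"
  where "is_direct_sum0 G A B \<longleftrightarrow>
    G = {a + b |a b. a \<in> A \<and> b \<in> B} \<and> (\<forall>t\<in>A \<inter> B. \<forall>\<^sub>F z in at 0. t z = 0)"


section \<open>Monodromy\<close>

definition fscl :: "('v, 'm) hbundle_scheme \<Rightarrow> complex \<Rightarrow> (complex \<Rightarrow> 'v) \<Rightarrow> complex \<Rightarrow> 'v"
  where "fscl T c s = (\<lambda>z. scl T c (s z))"

text \<open>Multivalued sections on the punctured plane are sections on its universal cover, the plane
  with coordinate \<open>w\<close> and covering map \<open>z = exp w\<close>; there \<open>z \<mapsto> z exp (2 \<pi> \<i>)\<close> is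
  \<open>w \<mapsto> w + 2 \<pi> \<i>\<close>.\<close>

definition flat_mv :: "('v::ab_group_add) te \<Rightarrow> (complex \<Rightarrow> 'v) set"
  where "flat_mv T =
    {A. \<forall>w0. \<exists>W t. open W \<and> w0 \<in> W \<and> t \<in> hsections T (exp ` W) \<and>
          (\<forall>z\<in>exp ` W. nabla T t z = 0) \<and> (\<forall>w\<in>W. A w = t (exp w))}"

definition Mmon :: "(complex \<Rightarrow> 'v) \<Rightarrow> complex \<Rightarrow> 'v"
  where "Mmon A = (\<lambda>w. A (w + 2 * of_real pi * \<i>))"

text \<open>The multiset \<open>L\<close> of eigenvalues of \<open>f\<close> on \<open>V\<close>, counted with algebraic multiplicity.\<close>

definition eigenvalues_are ::
    "(complex \<Rightarrow> 'a \<Rightarrow> 'a::ab_group_add) \<Rightarrow> 'a set \<Rightarrow> ('a \<Rightarrow> 'a) \<Rightarrow> complex multiset \<Rightarrow> bool"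
  where "eigenvalues_are sc V f L \<longleftrightarrow>
    (\<forall>l. vector_space.dim sc {v\<in>V. \<exists>n. ((\<lambda>u. f u - sc l u) ^^ n) v = 0} = count L l)"

definition endo_on :: "(complex \<Rightarrow> 'a \<Rightarrow> 'a::ab_group_add) \<Rightarrow> 'a set \<Rightarrow> ('a \<Rightarrow> 'a) \<Rightarrow> bool"
  where "endo_on sc V f \<longleftrightarrow>
    f ` V \<subseteq> V \<and> (\<forall>x\<in>V. \<forall>y\<in>V. f (x + y) = f x + f y) \<and> (\<forall>c. \<forall>x\<in>V. f (sc c x) = sc c (f x))"

definition semisimple_on :: "(complex \<Rightarrow> 'a \<Rightarrow> 'a::ab_group_add) \<Rightarrow> 'a set \<Rightarrow> ('a \<Rightarrow> 'a) \<Rightarrow> bool"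
  where "semisimple_on sc V f \<longleftrightarrow> endo_on sc V f \<and> module.span sc {v\<in>V. \<exists>c. f v = sc c v} = V"

definition unipotent_on :: "(complex \<Rightarrow> 'a \<Rightarrow> 'a::ab_group_add) \<Rightarrow> 'a set \<Rightarrow> ('a \<Rightarrow> 'a) \<Rightarrow> bool"
  where "unipotent_on sc V f \<longleftrightarrow> endo_on sc V f \<and> (\<exists>n. \<forall>v\<in>V. ((\<lambda>u. f u - u) ^^ n) v = 0)"

text \<open>The unipotent factor of the multiplicative Jordan decomposition of \<open>f\<close> on \<open>V\<close>.  Only its
  restriction to \<open>V\<close> is meaningful, and that restriction is unique.\<close>

definition unipotent_part ::
    "(complex \<Rightarrow> 'a \<Rightarrow> 'a::ab_group_add) \<Rightarrow> 'a set \<Rightarrow> ('a \<Rightarrow> 'a) \<Rightarrow> 'a \<Rightarrow> 'a"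
  where "unipotent_part sc V f =
    (SOME u. unipotent_on sc V u \<and>
       (\<exists>s. semisimple_on sc V s \<and> (\<forall>v\<in>V. f v = s (u v) \<and> s (u v) = u (s v))))"

text \<open>The logarithm series of a unipotent \<open>u\<close>; its terms of index at least \<open>dim V\<close> vanish.\<close>

definition log_unipotent ::
    "(complex \<Rightarrow> 'a \<Rightarrow> 'a::ab_group_add) \<Rightarrow> 'a set \<Rightarrow> ('a \<Rightarrow> 'a) \<Rightarrow> 'a \<Rightarrow> 'a"
  where "log_unipotent sc V u v =
    (\<Sum>k = 1..vector_space.dim sc V. sc ((-1) ^ (k + 1) / of_nat k) (((\<lambda>x. u x - x) ^^ k) v))"

definition Nmon :: "('v::ab_group_add) te \<Rightarrow> (complex \<Rightarrow> 'v) \<Rightarrow> complex \<Rightarrow> 'v"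
  where "Nmon T =
    log_unipotent (fscl T) (flat_mv T) (unipotent_part (fscl T) (flat_mv T) Mmon)"

definition Nmon_zero :: "('v::ab_group_add) te \<Rightarrow> bool"
  where "Nmon_zero T \<longleftrightarrow> (\<forall>A\<in>flat_mv T. Nmon T A = 0)"


section \<open>Elementary sections and leading exponents\<close>

text \<open>Sections over the punctured plane are encoded as functions with value 0 at 0, so that equality
  of sections is equality of functions.\<close>

definition euler_shift :: "('v::ab_group_add) te \<Rightarrow> complex \<Rightarrow> (complex \<Rightarrow> 'v) \<Rightarrow> complex \<Rightarrow> 'v"
  where "euler_shift T \<alpha> \<sigma> =
    (\<lambda>z. if z = 0 then 0 else scl T z (nabla T \<sigma> z) - scl T \<alpha> (\<sigma> z))"

definition elementary :: "('v::ab_group_add) te \<Rightarrow> complex \<Rightarrow> (complex \<Rightarrow> 'v) set"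
  where "elementary T \<alpha> =
    {\<sigma>\<in>hsections T (-{0}). \<sigma> 0 = 0 \<and> (euler_shift T \<alpha> ^^ 2) \<sigma> = 0}"

definition elementary_ker :: "('v::ab_group_add) te \<Rightarrow> complex \<Rightarrow> (complex \<Rightarrow> 'v) set"
  where "elementary_ker T \<alpha> = {\<sigma>\<in>elementary T \<alpha>. euler_shift T \<alpha> \<sigma> = 0}"

definition leading_exponents_ss ::
    "('v::ab_group_add) te \<Rightarrow> complex \<Rightarrow> complex \<Rightarrow> complex \<Rightarrow> complex \<Rightarrow> bool"
  where "leading_exponents_ss T l1 l2 \<alpha>1 \<alpha>2 \<longleftrightarrow>
    exp (- 2 * of_real pi * \<i> * \<alpha>1) = l1 \<and> exp (- 2 * of_real pi * \<i> * \<alpha>2) = l2 \<and>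
    (\<exists>s1\<in>elementary T \<alpha>1 - {0}. \<exists>s2\<in>elementary T \<alpha>2 - {0}.
       is_direct_sum0 (germs0 T) (conv_span T s1) (conv_span T s2))"

text \<open>The quantifier over \<open>s1\<close> cannot be vacuous when the exponents are unique: otherwise
  \<open>\<alpha>1 + 1\<close> and \<open>\<alpha>2\<close> would qualify as well, because multiplication by \<open>z\<close> maps
  \<open>elementary T \<alpha>1\<close> onto \<open>elementary T (\<alpha>1 + 1)\<close>, and kernel onto kernel.\<close>

definition leading_exponents_nss ::
    "('v::ab_group_add) te \<Rightarrow> complex \<Rightarrow> complex \<Rightarrow> complex \<Rightarrow> bool"
  where "leading_exponents_nss T l \<alpha>1 \<alpha>2 \<longleftrightarrow>
    exp (- 2 * of_real pi * \<i> * \<alpha>1) = l \<and> exp (- 2 * of_real pi * \<i> * \<alpha>2) = l \<and>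
    (\<exists>n::nat. \<alpha>1 - \<alpha>2 = of_nat n \<and>
      (\<forall>s1\<in>elementary T \<alpha>1 - elementary_ker T \<alpha>1.
        (\<exists>!s2. s2 \<in> elementary T \<alpha>2 \<and> euler_shift T \<alpha>1 s1 = (\<lambda>z. scl T (z ^ n) (s2 z))) \<and>
        (\<forall>s2\<in>elementary T \<alpha>2. euler_shift T \<alpha>1 s1 = (\<lambda>z. scl T (z ^ n) (s2 z)) \<longrightarrow>
           elementary_ker T \<alpha>2 = module.span (fscl T) {s2} \<and>
           is_direct_sum0 (germs0 T) (conv_span T s1) (conv_span T s2))))"

end

theory Submission
  imports Defs
begin

text \<open>
The idea is to study the lattice of germs inside the space of all sections over the punctured plane,
graded by the eigenvalues of the Euler derivative \<open>theta\<close>, that is, \<open>\<nabla>\<^sub>z\<^sub>\<partial>\<^sub>z\<close>.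

The eigenvalue hypothesis yields two independent flat multivalued sections in which the monodromy is
in Jordan form (\<open>two_dim_jordan_basis\<close>).  Twisting them by \<open>z\<^sup>\<alpha>\<close>, and by a logarithm in the
presence of a Jordan block, makes them single-valued: they become a frame \<open>\<sigma>\<^sub>1, \<sigma>\<^sub>2\<close> of elementary
sections over the punctured plane (\<open>elementary_frame_exists\<close>).  All elementary sections have the
form \<open>z\<^sup>k (x \<sigma>\<^sub>1 + y \<sigma>\<^sub>2)\<close>, because the Euler equation has no other
single-valued solutions on the punctured plane.

Since the structure is logarithmic, the transition between \<open>\<sigma>\<^sub>1, \<sigma>\<^sub>2\<close> and a holomorphic frame at 0
solves a linear system with a regular singularity, so it has moderate growth, and a power of \<open>z\<close>
carries each of the two lattices into the other (\<open>lattice_bounds\<close>).  The lattice of germs is also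
stable under \<open>theta\<close>, hence under every polynomial in \<open>theta\<close>.  Hermite interpolation polynomials
act as the projections to the generalised eigenspaces, so a germ has all its homogeneous components
\<open>z\<^sup>k (x \<sigma>\<^sub>1 + y \<sigma>\<^sub>2)\<close> in the lattice (\<open>lattice_structure\<close>).

The lattice is thereby described by a filtration of a plane: the vectors \<open>(x, y)\<close> that occur in
degree \<open>k\<close>.  It is zero for small \<open>k\<close>, increasing, and everything for large \<open>k\<close>; it is compatible
with the splitting into eigenlines for different exponents, and stable under the nilpotent part of
\<open>theta\<close>.  Its jumps are the degrees of the generators and give the leading exponents; in the Jordan
case stability forces the first nonzero step to contain the kernel of the nilpotent part
(\<open>adapted_generators_semisimple\<close>, \<open>adapted_generators_nilpotent\<close>).

Uniqueness in the semisimple case compares two pairs of generators: the transition coefficients are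
analytic solutions of Euler equations, so differences of exponents are natural numbers in both
directions (\<open>exponents_compare\<close>, \<open>exponent_pairs_eq\<close>).  In the Jordan case the exponents are given by the
least degrees in which \<open>\<sigma>\<^sub>2\<close> and \<open>\<sigma>\<^sub>1\<close> occur.  Finally, the generators extend to a
global holomorphic frame whose connection matrix depends on the exponents only (\<open>global_frame\<close>), and
two structures with the same matrix are isomorphic (\<open>te_isomorphic_of_frames\<close>).
\<close>

section \<open>Linear systems and Euler equations\<close>

text \<open>On a small disc the mean value inequality bounds the maximum of \<open>\<bar>f\<bar> + \<bar>g\<bar>\<close> by half of
itself.\<close>

lemma linear_system_unique_zero:
  fixes f g :: "complex \<Rightarrow> complex"
  assumes U: "open U" "z0 \<in> U"
    and hol: "f holomorphic_on U" "g holomorphic_on U"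
    and coeff: "continuous_on U a" "continuous_on U b" "continuous_on U c" "continuous_on U d"
    and ode: "\<And>z. z \<in> U \<Longrightarrow> deriv f z = a z * f z + b z * g z"
      "\<And>z. z \<in> U \<Longrightarrow> deriv g z = c z * f z + d z * g z"
    and init: "f z0 = 0" "g z0 = 0"
  shows "\<forall>\<^sub>F z in nhds z0. f z = 0 \<and> g z = 0"
proof -
  obtain r1 where r1: "r1 > 0" "cball z0 r1 \<subseteq> U"
    using U open_contains_cball by blast
  have bnd: "\<exists>K. \<forall>z\<in>cball z0 r1. norm (h z) \<le> K" if "continuous_on U h" for h :: "complex \<Rightarrow> complex"
  proof -
    have "compact (h ` cball z0 r1)"
      using that r1 by (intro compact_continuous_image) (auto intro: continuous_on_subset)
    then show ?thesis using compact_imp_bounded bounded_iff by (metis imageI)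
  qed
  obtain Ka Kb Kc Kd where Ks: "\<And>z. z \<in> cball z0 r1 \<Longrightarrow> norm (a z) \<le> Ka"
      "\<And>z. z \<in> cball z0 r1 \<Longrightarrow> norm (b z) \<le> Kb"
      "\<And>z. z \<in> cball z0 r1 \<Longrightarrow> norm (c z) \<le> Kc"
      "\<And>z. z \<in> cball z0 r1 \<Longrightarrow> norm (d z) \<le> Kd"
    using bnd[OF coeff(1)] bnd[OF coeff(2)] bnd[OF coeff(3)] bnd[OF coeff(4)] by metis
  define K where "K = \<bar>Ka\<bar> + \<bar>Kb\<bar> + \<bar>Kc\<bar> + \<bar>Kd\<bar> + 1"
  have K: "K > 0" and KK: "Ka \<le> K" "Kb \<le> K" "Kc \<le> K" "Kd \<le> K"
    unfolding K_def by linarith+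
  \<comment> \<open>With \<open>r K \<le> 1/4\<close> the two mean value estimates, each with factor \<open>r K\<close>, add up to 1/2.\<close>
  define r where "r = min r1 (1 / (4 * K))"
  have r: "r > 0" "r \<le> r1" "r * K \<le> 1 / 4"
    using r1 K by (auto simp: r_def min_def field_simps)
  define S where "S = cball z0 r"
  have S: "S \<subseteq> U" "z0 \<in> S" "convex S" "compact S"
    using r r1 by (auto simp: S_def)
  have cont: "continuous_on S (\<lambda>z. norm (f z) + norm (g z))"
    using hol S by (intro continuous_intros holomorphic_on_imp_continuous_on)
      (auto intro: holomorphic_on_subset)
  obtain z1 where z1: "z1 \<in> S" "\<And>z. z \<in> S \<Longrightarrow> norm (f z) + norm (g z) \<le> norm (f z1) + norm (g z1)"
    using continuous_attains_sup[OF S(4) _ cont] S(2) by blast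
  define m where "m = norm (f z1) + norm (g z1)"
  have m0: "m \<ge> 0" by (simp add: m_def)
  have drv: "norm (p z * f z + q z * g z) \<le> K * m"
    if "z \<in> S" "norm (p z) \<le> K" "norm (q z) \<le> K" for p q z
  proof -
    have "norm (p z * f z + q z * g z) \<le> norm (p z) * norm (f z) + norm (q z) * norm (g z)"
      by (metis norm_mult norm_triangle_ineq)
    also have "\<dots> \<le> K * norm (f z) + K * norm (g z)"
      using that by (intro add_mono mult_right_mono) auto
    also have "\<dots> = K * (norm (f z) + norm (g z))" by (simp add: algebra_simps)
    also have "\<dots> \<le> K * m" using z1 that K by (simp add: m_def)
    finally show ?thesis .
  qed
  have SK: "norm (a z) \<le> K" "norm (b z) \<le> K" "norm (c z) \<le> K" "norm (d z) \<le> K" if "z \<in> S" for z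
    using Ks[of z] KK that r unfolding S_def by (force intro: order_trans)+
  have der: "(h has_field_derivative deriv h z) (at z within S)"
    if "h holomorphic_on U" "z \<in> S" for h z
    using that S U(1) by (meson has_field_derivative_at_within holomorphic_derivI subsetD)
  have "norm (f z1 - f z0) \<le> K * m * norm (z1 - z0)"
    using S z1 ode drv SK
    by (intro field_differentiable_bound[where f' = "deriv f" and S = S] der hol) auto
  moreover have "norm (g z1 - g z0) \<le> K * m * norm (z1 - z0)"
    using S z1 ode drv SK
    by (intro field_differentiable_bound[where f' = "deriv g" and S = S] der hol) auto
  moreover have "K * m * norm (z1 - z0) \<le> K * m * r"
    using z1 K m0 by (intro mult_left_mono) (auto simp: S_def dist_norm norm_minus_commute)
  ultimately have "m \<le> 2 * (r * K) * m"
    using init by (simp add: m_def algebra_simps)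
  also have "\<dots> \<le> (1/2) * m" using r m0 by (intro mult_right_mono) auto
  finally have "m = 0" using m0 by linarith
  then have "f z = 0 \<and> g z = 0" if "z \<in> ball z0 r" for z
    using z1(2)[of z] that unfolding S_def m_def
    by (smt (verit) ball_subset_cball norm_eq_zero norm_ge_zero subsetD)
  then show ?thesis
    unfolding eventually_nhds using r(1) by (intro exI[of _ "ball z0 r"]) auto
qed

text \<open>Multiplication by the integrating factor \<open>exp (- \<kappa> w)\<close> turns the equation into a constant
derivative.  The inhomogeneous term is the one that a second-order Euler equation produces.\<close>

lemma linear_ode_exp_solution:
  fixes F G :: "complex \<Rightarrow> complex"
  assumes "\<And>w. (F has_field_derivative \<kappa> * F w + G0 * exp (\<kappa> * w)) (at w)"
  shows "F w = (F 0 + G0 * w) * exp (\<kappa> * w)"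
proof -
  define H where "H = (\<lambda>w. F w * exp (- \<kappa> * w) - G0 * w)"
  have "(H has_field_derivative 0) (at w)" for w
  proof -
    have e: "exp (\<kappa> * w) * exp (- \<kappa> * w) = 1" by (simp add: exp_minus)
    have "(H has_field_derivative ((\<kappa> * F w + G0 * exp (\<kappa> * w)) * exp (- \<kappa> * w)
       + F w * (exp (- \<kappa> * w) * (- \<kappa>)) - G0)) (at w)"
      unfolding H_def by (auto intro!: derivative_eq_intros assms)
    also have "(\<kappa> * F w + G0 * exp (\<kappa> * w)) * exp (- \<kappa> * w)
       + F w * (exp (- \<kappa> * w) * (- \<kappa>)) - G0 = G0 * (exp (\<kappa> * w) * exp (- \<kappa> * w)) - G0"
      by (simp add: algebra_simps)
    finally show ?thesis by (simp only: e) simp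
  qed
  then have "H constant_on UNIV"
    by (intro has_field_derivative_0_imp_constant_on) auto
  then have "H w = H 0" by (auto simp: constant_on_def)
  then have "F w * exp (- \<kappa> * w) = F 0 + G0 * w" by (simp add: H_def algebra_simps)
  then have "F w * (exp (- \<kappa> * w) * exp (\<kappa> * w)) = (F 0 + G0 * w) * exp (\<kappa> * w)" by (metis mult.assoc)
  moreover have "exp (- \<kappa> * w) * exp (\<kappa> * w) = 1" by (simp add: exp_minus)
  ultimately show ?thesis by (metis mult.right_neutral)
qed

text \<open>The substitution \<open>z = exp w\<close> turns \<open>z d/dz\<close> into \<open>d/dw\<close>.\<close>

lemma euler_eq_exp:
  assumes hol: "f holomorphic_on - {0}"
    and ode: "\<And>z. z \<noteq> 0 \<Longrightarrow> z * deriv f z = \<kappa> * f z"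
  shows "f (exp w) = f 1 * exp (\<kappa> * w)"
proof -
  have "((\<lambda>w. f (exp w)) has_field_derivative \<kappa> * f (exp w) + 0 * exp (\<kappa> * w)) (at w)" for w
  proof -
    have "(f has_field_derivative deriv f (exp w)) (at (exp w))"
      by (rule holomorphic_derivI[OF hol]) auto
    then have "((\<lambda>w. f (exp w)) has_field_derivative deriv f (exp w) * exp w) (at w)"
      by (rule DERIV_chain2) simp
    then show ?thesis using ode[of "exp w"] by (simp add: mult.commute)
  qed
  from linear_ode_exp_solution[OF this] show ?thesis by simp
qed

text \<open>A solution on the punctured plane is single-valued, so \<open>exp (\<kappa> w)\<close> must have period \<open>2 \<pi> \<i>\<close>.\<close>

lemma euler_eq_powi:
  assumes hol: "f holomorphic_on - {0}"
    and ode: "\<And>z. z \<noteq> 0 \<Longrightarrow> z * deriv f z = \<kappa> * f z"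
    and nz: "f 1 \<noteq> 0"
  obtains k :: int where "\<kappa> = of_int k" "\<And>z. z \<noteq> 0 \<Longrightarrow> f z = f 1 * z powi k"
proof -
  have "f 1 = f 1 * exp (\<kappa> * (2 * of_real pi * \<i>))"
    using euler_eq_exp[OF hol ode, of "2 * of_real pi * \<i>"] by simp
  then have "exp (2 * of_real pi * \<i> * \<kappa>) = 1" using nz by (simp add: mult_ac)
  then obtain k :: int where "Im \<kappa> = 0" "Re \<kappa> = of_int k"
    by (auto simp: exp_eq_1)
  then have k: "\<kappa> = of_int k" by (simp add: complex_eq_iff)
  show ?thesis
  proof (rule that[OF k])
    fix z :: complex assume "z \<noteq> 0"
    then show "f z = f 1 * z powi k"
      using euler_eq_exp[OF hol ode, of "Ln z"] k exp_power_int[of "Ln z" k] by simp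
  qed
qed

text \<open>A solution of the squared Euler equation that does not solve the Euler equation itself would contain
a logarithm, that is, a term \<open>w exp (\<kappa> w)\<close> in \<open>w = log z\<close>.  If that term is present, \<open>\<kappa>\<close> is
an integer, and then the term is not periodic.\<close>

lemma euler_square_eq:
  assumes hol: "f holomorphic_on - {0}"
    and ode: "\<And>z. z \<noteq> 0 \<Longrightarrow> z * deriv (\<lambda>z. z * deriv f z - \<kappa> * f z) z
        = \<kappa> * (z * deriv f z - \<kappa> * f z)"
    and z: "z \<noteq> 0"
  shows "z * deriv f z = \<kappa> * f z"
proof (rule ccontr)
  assume ne: "z * deriv f z \<noteq> \<kappa> * f z"
  define g where "g = (\<lambda>z. z * deriv f z - \<kappa> * f z)"
  have gh: "g holomorphic_on - {0}"
    unfolding g_def using hol by (intro holomorphic_intros) auto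
  have gode: "\<And>z. z \<noteq> 0 \<Longrightarrow> z * deriv g z = \<kappa> * g z" using ode by (simp add: g_def)
  note ge = euler_eq_exp[OF gh gode]
  have g1: "g 1 \<noteq> 0" using ne ge[of "Ln z"] z by (auto simp: g_def)
  obtain k :: int where k: "\<kappa> = of_int k" using euler_eq_powi[OF gh gode g1] by metis
  have "((\<lambda>w. f (exp w)) has_field_derivative \<kappa> * f (exp w) + g 1 * exp (\<kappa> * w)) (at w)" for w
  proof -
    have "(f has_field_derivative deriv f (exp w)) (at (exp w))"
      by (rule holomorphic_derivI[OF hol]) auto
    then have "((\<lambda>w. f (exp w)) has_field_derivative deriv f (exp w) * exp w) (at w)"
      by (rule DERIV_chain2) simp
    moreover have "deriv f (exp w) * exp w = \<kappa> * f (exp w) + g 1 * exp (\<kappa> * w)"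
      using ge[of w] by (simp add: g_def algebra_simps)
    ultimately show ?thesis by simp
  qed
  from linear_ode_exp_solution[OF this, of "2 * of_real pi * \<i>"]
  have "f 1 = (f 1 + g 1 * (2 * of_real pi * \<i>)) * exp (\<kappa> * (2 * of_real pi * \<i>))" by simp
  moreover have "exp (\<kappa> * (2 * of_real pi * \<i>)) = 1"
    unfolding exp_eq_1 k by (auto simp: intro!: exI[of _ k])
  ultimately show False using g1 by simp
qed

text \<open>Writing \<open>F = z\<^sup>n g\<close> with \<open>g 0 \<noteq> 0\<close>, the Euler equation for \<open>g\<close> has exponent \<open>\<kappa> - n\<close>, and
evaluating it at 0 gives \<open>\<kappa> = n\<close>.  This is where the natural numbers in the comparison of
exponents come from.\<close>

lemma euler_eq_analytic_exponent:
  assumes an: "F analytic_on {0}"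
    and ode: "\<forall>\<^sub>F z in at 0. z * deriv F z = \<kappa> * F z"
    and nz: "\<not> (\<forall>\<^sub>F z in at 0. F z = 0)"
  shows "\<kappa> \<in> \<nat>"
proof -
  obtain r1 where r1: "r1 > 0" "F holomorphic_on ball 0 r1"
    using an by (auto simp: analytic_on_def)
  obtain r2 where r2: "r2 > 0" "\<And>z. z \<noteq> 0 \<Longrightarrow> dist z 0 < r2 \<Longrightarrow> z * deriv F z = \<kappa> * F z"
    using ode by (auto simp: eventually_at)
  define r where "r = min r1 r2"
  have r: "r > 0" "F holomorphic_on ball 0 r"
    using r1 r2 by (auto simp: r_def intro: holomorphic_on_subset)
  \<comment> \<open>The zero order at 0 is finite only because \<open>F\<close> is not identically zero near 0.\<close>
  have nc: "\<exists>z\<in>ball 0 r. F z \<noteq> 0"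
    using nz r(1) unfolding eventually_at by (auto simp: dist_norm) (metis mem_ball_0)
  then obtain z1 where z1: "z1 \<in> ball 0 r" "F z1 \<noteq> 0" by blast
  show ?thesis
  proof (cases "F 0 = 0")
    case False
    have "isCont F 0" using r
      by (intro continuous_on_interior[of "ball 0 r"] holomorphic_on_imp_continuous_on) auto
    have "isCont (deriv F) 0" using r
      by (intro continuous_on_interior[of "ball 0 r"] holomorphic_on_imp_continuous_on holomorphic_deriv) auto
    have "((\<lambda>z. z * deriv F z) \<longlongrightarrow> 0 * deriv F 0) (at 0)"
      using \<open>isCont (deriv F) 0\<close> by (intro tendsto_intros) (simp add: isCont_def)
    moreover have "((\<lambda>z. \<kappa> * F z) \<longlongrightarrow> \<kappa> * F 0) (at 0)"
      using \<open>isCont F 0\<close> by (intro tendsto_intros) (simp add: isCont_def)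
    then have "((\<lambda>z. z * deriv F z) \<longlongrightarrow> \<kappa> * F 0) (at 0)"
      using ode by (simp add: filterlim_cong)
    ultimately have "\<kappa> * F 0 = 0" using tendsto_unique trivial_limit_at by fastforce
    then show ?thesis using False by auto
  next
    case True
    have nconst: "\<not> F constant_on ball 0 r" using True z1 r(1) unfolding constant_on_def
      by (metis centre_in_ball)
    obtain g s n where gs: "0 < n" "0 < s" "ball (0::complex) s \<subseteq> ball 0 r" "g holomorphic_on ball 0 s"
       "\<And>w. w \<in> ball 0 s \<Longrightarrow> F w = (w - 0) ^ n * g w" "\<And>w. w \<in> ball 0 s \<Longrightarrow> g w \<noteq> 0"
      using holomorphic_factor_zero_nonconstant[OF r(2) open_ball connected_ball _ True nconst] r(1)
      by (metis centre_in_ball)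
    have dF: "z * deriv F z = of_nat n * F z + z ^ n * (z * deriv g z)" if z: "z \<in> ball 0 s" for z
    proof -
      have "(g has_field_derivative deriv g z) (at z)"
        by (rule holomorphic_derivI[OF gs(4)]) (use z in auto)
      then have "((\<lambda>w. w ^ n * g w) has_field_derivative
           (of_nat n * z ^ (n - 1) * g z + z ^ n * deriv g z)) (at z)"
        by (auto intro!: derivative_eq_intros)
      then have "(F has_field_derivative (of_nat n * z ^ (n - 1) * g z + z ^ n * deriv g z)) (at z)"
        using gs(5) z by (subst DERIV_cong_ev[where g = "\<lambda>w. w ^ n * g w"])
          (auto simp: eventually_nhds intro!: exI[of _ "ball 0 s"])
      then have "deriv F z = of_nat n * z ^ (n - 1) * g z + z ^ n * deriv g z"
        by (rule DERIV_imp_deriv)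
      moreover have "z * z ^ (n - 1) = z ^ n" using gs(1) by (metis power_eq_if gr_implies_not0)
      ultimately have "z * deriv F z = of_nat n * (z * z ^ (n - 1)) * g z + z ^ n * (z * deriv g z)"
        by (simp add: algebra_simps)
      then show ?thesis using gs(5)[OF z] \<open>z * z ^ (n - 1) = z ^ n\<close> by simp
    qed
    have ev: "\<forall>\<^sub>F z in at 0. z * deriv g z = (\<kappa> - of_nat n) * g z"
    proof -
      have "\<forall>\<^sub>F z in at 0. z \<in> ball 0 s - {0}"
        using gs(2) by (auto simp: eventually_at dist_commute intro!: exI[of _ s])
      then show ?thesis using ode
      proof eventually_elim
        case (elim z)
        then have "z ^ n * (z * deriv g z) = z ^ n * ((\<kappa> - of_nat n) * g z)"
          using dF[of z] gs(5)[of z] by (simp add: algebra_simps)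
        then show ?case using elim by simp
      qed
    qed
    have "isCont g 0" "isCont (deriv g) 0" using gs
      by (auto intro!: continuous_on_interior[of "ball 0 s"] holomorphic_on_imp_continuous_on holomorphic_deriv)
    have "((\<lambda>z. z * deriv g z) \<longlongrightarrow> 0 * deriv g 0) (at 0)"
      using \<open>isCont (deriv g) 0\<close> by (intro tendsto_intros) (simp add: isCont_def)
    moreover have "((\<lambda>z. (\<kappa> - of_nat n) * g z) \<longlongrightarrow> (\<kappa> - of_nat n) * g 0) (at 0)"
      using \<open>isCont g 0\<close> by (intro tendsto_intros) (simp add: isCont_def)
    then have "((\<lambda>z. z * deriv g z) \<longlongrightarrow> (\<kappa> - of_nat n) * g 0) (at 0)"
      using ev by (simp add: filterlim_cong)
    ultimately have "(\<kappa> - of_nat n) * g 0 = 0" using tendsto_unique trivial_limit_at by fastforce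
    then have "\<kappa> = of_nat n" using gs(2,6) by auto
    then show ?thesis by simp
  qed
qed

text \<open>Along a ray, the logarithmic derivative of \<open>\<Sum>\<bar>y\<^sub>i\<bar>\<^sup>2\<close> in the radius \<open>\<rho>\<close> is at least \<open>- 2 N / \<rho>\<close> for
\<open>N \<ge> K card I\<close>.  Hence \<open>\<rho>\<^sup>2\<^sup>N \<Sum>\<bar>y\<^sub>i\<bar>\<^sup>2\<close> is increasing, and it is bounded by its maximum on a
circle.\<close>

lemma regular_singular_moderate_growth:
  fixes y :: "'i \<Rightarrow> complex \<Rightarrow> complex"
  assumes fin: "finite I" and r: "r > 0"
    and hol: "\<And>i. i \<in> I \<Longrightarrow> y i holomorphic_on ball 0 r - {0}"
    and bound: "\<And>i z. i \<in> I \<Longrightarrow> z \<in> ball 0 r - {0} \<Longrightarrow>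
        norm (z * deriv (y i) z) \<le> K * (\<Sum>j\<in>I. norm (y j z))"
  obtains N :: nat where
    "\<And>i. i \<in> I \<Longrightarrow> \<exists>B. \<forall>\<^sub>F z in at 0. norm (z ^ N * y i z) \<le> B"
proof -
  define N where "N = nat \<lceil>\<bar>K\<bar> * card I\<rceil>"
  have N: "\<bar>K\<bar> * card I \<le> N" unfolding N_def by linarith
  define \<phi> where "\<phi> u \<rho> = \<rho> ^ (2 * N) * (\<Sum>i\<in>I. (norm (y i (of_real \<rho> * u)))\<^sup>2)" for u \<rho>
  have mono: "\<phi> u \<rho>1 \<le> \<phi> u \<rho>2"
    if u: "norm u = 1" and \<rho>: "0 < \<rho>1" "\<rho>1 \<le> \<rho>2" "\<rho>2 < r" for u \<rho>1 \<rho>2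
  proof (rule DERIV_nonneg_imp_nondecreasing[OF \<rho>(2)])
    fix \<rho> assume "\<rho>1 \<le> \<rho>" "\<rho> \<le> \<rho>2"
    then have \<rho>: "0 < \<rho>" "\<rho> < r" using \<rho> by auto
    define z where "z = of_real \<rho> * u"
    have z: "z \<in> ball 0 r - {0}" using u \<rho> by (auto simp: z_def norm_mult)
    have yd: "((\<lambda>\<rho>. (norm (y i (of_real \<rho> * u)))\<^sup>2) has_real_derivative
        2 * (y i z \<bullet> (deriv (y i) z * u))) (at \<rho>)" if "i \<in> I" for i
    proof -
      have "(y i has_field_derivative deriv (y i) z) (at z)"
        by (rule holomorphic_derivI[OF hol[OF that] _ z]) auto
      then have "((y i \<circ> (\<lambda>\<rho>. of_real \<rho> * u)) has_vector_derivative (u * deriv (y i) z)) (at \<rho>)"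
        unfolding z_def by (intro field_vector_diff_chain_at) (auto intro!: derivative_eq_intros)
      then have h: "((\<lambda>\<rho>. y i (of_real \<rho> * u)) has_derivative (\<lambda>x. x *\<^sub>R (u * deriv (y i) z))) (at \<rho>)"
        by (simp add: has_vector_derivative_def o_def)
      have "((\<lambda>\<rho>. y i (of_real \<rho> * u) \<bullet> y i (of_real \<rho> * u)) has_derivative
          (\<lambda>x. y i (of_real \<rho> * u) \<bullet> (x *\<^sub>R (u * deriv (y i) z)) + (x *\<^sub>R (u * deriv (y i) z)) \<bullet> y i (of_real \<rho> * u))) (at \<rho>)"
        by (rule has_derivative_inner[OF h h])
      then show ?thesis
        unfolding has_field_derivative_def power2_norm_eq_inner
        by (rule has_derivative_eq_rhs) (auto simp: z_def inner_commute algebra_simps)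
    qed
    define S where "S = (\<Sum>i\<in>I. (norm (y i z))\<^sup>2)"
    define D where "D = (\<Sum>i\<in>I. 2 * (y i z \<bullet> (deriv (y i) z * u)))"
    have der: "(\<phi> u has_real_derivative (2 * N) * \<rho> ^ (2 * N - 1) * S + \<rho> ^ (2 * N) * D) (at \<rho>)"
      unfolding \<phi>_def S_def D_def z_def
      by (rule derivative_eq_intros refl yd[unfolded z_def] | assumption)+ (auto simp: algebra_simps z_def)
    have "\<rho> * \<bar>D\<bar> \<le> \<bar>\<Sum>i\<in>I. 2 * (y i z \<bullet> (z * deriv (y i) z))\<bar>"
    proof -
      have "\<rho> * D = (\<Sum>i\<in>I. 2 * (y i z \<bullet> (z * deriv (y i) z)))"
        unfolding D_def sum_distrib_left
        by (intro sum.cong refl) (simp add: z_def inner_complex_def algebra_simps)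
      then show ?thesis using \<rho> by (metis abs_mult abs_of_pos order_refl)
    qed
    also have "\<dots> \<le> (\<Sum>i\<in>I. 2 * (norm (y i z) * (\<bar>K\<bar> * (\<Sum>j\<in>I. norm (y j z)))))"
    proof (rule order_trans[OF sum_abs], rule sum_mono)
      fix i assume i: "i \<in> I"
      have "\<bar>y i z \<bullet> (z * deriv (y i) z)\<bar> \<le> norm (y i z) * norm (z * deriv (y i) z)"
        by (rule Cauchy_Schwarz_ineq2)
      also have "\<dots> \<le> norm (y i z) * (\<bar>K\<bar> * (\<Sum>j\<in>I. norm (y j z)))"
        using bound[OF i z] by (intro mult_left_mono order_trans[OF bound[OF i z]] mult_right_mono sum_nonneg) auto
      finally show "\<bar>2 * (y i z \<bullet> (z * deriv (y i) z))\<bar> \<le> 2 * (norm (y i z) * (\<bar>K\<bar> * (\<Sum>j\<in>I. norm (y j z))))"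
        by simp
    qed
    also have "\<dots> = 2 * \<bar>K\<bar> * (\<Sum>i\<in>I. norm (y i z))\<^sup>2"
      by (simp add: power2_eq_square sum_distrib_left sum_distrib_right mult_ac)
    also have "\<dots> \<le> 2 * \<bar>K\<bar> * (S * card I)"
      unfolding S_def by (intro mult_left_mono sum_squared_le_sum_of_squares) (auto simp: fin)
    also have "\<dots> = 2 * (\<bar>K\<bar> * card I) * S" by simp
    also have "\<dots> \<le> 2 * N * S" using N by (intro mult_right_mono mult_left_mono) (auto simp: S_def sum_nonneg)
    finally have "0 \<le> 2 * N * S + \<rho> * D" using \<rho> by (cases "D \<ge> 0") (auto simp: S_def sum_nonneg)
    then have "0 \<le> \<rho> ^ (2 * N) * (2 * N * S + \<rho> * D) / \<rho>" using \<rho> by auto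
    also have "\<dots> = (2 * N) * (\<rho> ^ (2 * N) / \<rho>) * S + \<rho> ^ (2 * N) * D"
      using \<rho> by (simp add: field_simps)
    also have "(2 * N) * (\<rho> ^ (2 * N) / \<rho>) = (2 * N) * \<rho> ^ (2 * N - 1)"
      using \<rho> by (cases "N = 0") (auto simp: power_diff)
    finally show "\<exists>d. (\<phi> u has_real_derivative d) (at \<rho>) \<and> 0 \<le> d" using der by auto
  qed
  have "\<exists>B. \<forall>z\<in>sphere 0 (r/2). (\<Sum>i\<in>I. (norm (y i z))\<^sup>2) \<le> B"
  proof -
    have "continuous_on (sphere 0 (r/2)) (\<lambda>z. \<Sum>i\<in>I. (norm (y i z))\<^sup>2)"
      using hol r by (intro continuous_intros) (auto intro!: continuous_on_subset[OF holomorphic_on_imp_continuous_on[OF hol]])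
    then have "compact ((\<lambda>z. \<Sum>i\<in>I. (norm (y i z))\<^sup>2) ` sphere 0 (r/2))"
      by (intro compact_continuous_image) auto
    then have "bounded ((\<lambda>z. \<Sum>i\<in>I. (norm (y i z))\<^sup>2) ` sphere 0 (r/2))" by (rule compact_imp_bounded)
    then show ?thesis unfolding bounded_iff by (metis abs_le_D1 imageI real_norm_def)
  qed
  then obtain B where B: "\<And>z. z \<in> sphere 0 (r/2) \<Longrightarrow> (\<Sum>i\<in>I. (norm (y i z))\<^sup>2) \<le> B" by blast
  define C where "C = (r/2) ^ (2 * N) * B"
  have fin_bound: "norm (z ^ N * y i z) \<le> sqrt C" if i: "i \<in> I" and z: "z \<noteq> 0" "norm z < r/2" for i z
  proof -
    define u where "u = z / of_real (norm z)"
    have u: "norm u = 1" "z = of_real (norm z) * u" using z by (auto simp: u_def norm_divide)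
    have "(norm (z ^ N * y i z))\<^sup>2 = norm z ^ (2 * N) * (norm (y i z))\<^sup>2"
      by (simp add: norm_mult norm_power power_mult_distrib power_even_eq power_mult mult.commute)
    also have "\<dots> \<le> norm z ^ (2 * N) * (\<Sum>i\<in>I. (norm (y i z))\<^sup>2)"
      using fin i by (intro mult_left_mono member_le_sum) auto
    also have "\<dots> = \<phi> u (norm z)" unfolding \<phi>_def using u(2) by simp
    also have "\<dots> \<le> \<phi> u (r/2)" using mono[OF u(1)] z r by auto
    also have "\<dots> \<le> C" unfolding \<phi>_def C_def
      using B u(1) r by (intro mult_left_mono) (auto simp: norm_mult)
    finally show ?thesis using real_le_rsqrt by blast
  qed
  show ?thesis
  proof (rule that[of N])
    fix i assume "i \<in> I"
    then have "\<forall>\<^sub>F z in at 0. norm (z ^ N * y i z) \<le> sqrt C"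
      using fin_bound r by (auto simp: eventually_at dist_norm intro!: exI[of _ "r/2"])
    then show "\<exists>B. \<forall>\<^sub>F z in at 0. norm (z ^ N * y i z) \<le> B" by blast
  qed
qed

lemma taylor_remainder_holomorphic:
  fixes g :: "complex \<Rightarrow> complex"
  assumes "r > 0" "g holomorphic_on ball 0 r"
  shows "\<exists>a h. h holomorphic_on ball 0 r \<and> (\<forall>z\<in>ball 0 r. g z = (\<Sum>k<M. a k * z ^ k) + z ^ M * h z)"
proof (induction M)
  case 0
  then show ?case using assms by auto
next
  case (Suc M)
  then obtain a h where h: "h holomorphic_on ball 0 r"
    "\<And>z. z \<in> ball 0 r \<Longrightarrow> g z = (\<Sum>k<M. a k * z ^ k) + z ^ M * h z" by blast
  define h' where "h' = (\<lambda>z. if z = 0 then deriv h 0 else (h z - h 0) / (z - 0))"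
  have "h' holomorphic_on ball 0 r"
    unfolding h'_def using assms(1) by (intro pole_lemma_open[OF h(1)]) auto
  moreover have hz: "h z = h 0 + z * h' z" for z by (auto simp: h'_def)
  have "g z = (\<Sum>k<Suc M. (a(M := h 0)) k * z ^ k) + z ^ Suc M * h' z" if "z \<in> ball 0 r" for z
  proof -
    have "g z = (\<Sum>k<M. a k * z ^ k) + z ^ M * (h 0 + z * h' z)" using h(2)[OF that] hz[of z] by metis
    then show ?thesis by (simp add: distrib_left mult_ac)
  qed
  ultimately show ?case by blast
qed

text \<open>These polynomials, evaluated at an operator whose generalised eigenvectors have height at most two,
are the projections to the generalised eigenspace of \<open>b\<close> along those of the elements of \<open>K\<close>.\<close>

lemma hermite_cutoff_polynomial:
  fixes b :: complex
  assumes "finite K" "b \<notin> K"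
  shows "\<exists>p. poly p b = 1 \<and> poly (pderiv p) b = 0 \<and> (\<forall>x\<in>K. poly p x = 0 \<and> poly (pderiv p) x = 0)"
  using assms
proof (induction K)
  case empty
  show ?case by (rule exI[of _ 1]) simp
next
  case (insert x K)
  then obtain p where p: "poly p b = 1" "poly (pderiv p) b = 0"
    "\<And>x. x \<in> K \<Longrightarrow> poly p x = 0 \<and> poly (pderiv p) x = 0" by auto
  define \<gamma> where "\<gamma> = b - x"
  have \<gamma>: "\<gamma> \<noteq> 0" using insert by (auto simp: \<gamma>_def)
  \<comment> \<open>The double root at \<open>x\<close> kills value and derivative there; the linear factor is the one
    for which \<open>q\<close> has value 1 and derivative 0 at \<open>b\<close>.\<close>
  define q where "q = [:1/\<gamma>^2 + 2 * b / \<gamma>^3, - 2 / \<gamma>^3:] * ([:-x, 1:] * [:-x, 1:])"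
  have "poly q b = 1" "poly (pderiv q) b = 0" "poly q x = 0" "poly (pderiv q) x = 0"
    unfolding q_def using \<gamma>
    by (simp_all add: pderiv_mult pderiv_pCons power3_eq_cube power2_eq_square divide_simps \<gamma>_def)
       (algebra | simp add: algebra_simps)+
  then show ?case using p by (intro exI[of _ "q * p"]) (auto simp: pderiv_mult)
qed

section \<open>Jordan decomposition in dimension two\<close>

locale complex_vector_space = vs: vector_space sc
  for sc :: "complex \<Rightarrow> 'b::ab_group_add \<Rightarrow> 'b" (infixr "*c" 75)
begin

definition indep2 :: "'b \<Rightarrow> 'b \<Rightarrow> bool" where
  "indep2 x y \<longleftrightarrow> (\<forall>c d. c *c x + d *c y = 0 \<longrightarrow> c = 0 \<and> d = 0)"

lemma indep2D:
  assumes "indep2 x y" "c *c x + d *c y = c' *c x + d' *c y"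
  shows "c = c'" "d = d'"
proof -
  have "(c - c') *c x + (d - d') *c y = 0"
    using assms(2) by (simp add: vs.scale_left_diff_distrib algebra_simps)
  then show "c = c'" "d = d'" using assms(1) unfolding indep2_def by (metis right_minus_eq)+
qed

lemma indep2_commute: "indep2 x y \<longleftrightarrow> indep2 y x"
  unfolding indep2_def by (metis add.commute)

lemma comb_comb:
  "c *c (p1 *c u + q1 *c v) + d *c (p2 *c u + q2 *c v) = (c * p1 + d * p2) *c u + (c * q1 + d * q2) *c v"
  by (simp add: vs.scale_right_distrib vs.scale_left_distrib add_ac)

lemma indep2_det:
  assumes "indep2 (p1 *c u + q1 *c v) (p2 *c u + q2 *c v)"
  shows "p1 * q2 - p2 * q1 \<noteq> 0"
proof
  assume 0: "p1 * q2 - p2 * q1 = 0"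
  have "q2 *c (p1 *c u + q1 *c v) + (- q1) *c (p2 *c u + q2 *c v) = 0"
    unfolding comb_comb using 0 by (simp add: algebra_simps)
  moreover have "(- p2) *c (p1 *c u + q1 *c v) + p1 *c (p2 *c u + q2 *c v) = 0"
    unfolding comb_comb using 0 by (simp add: algebra_simps)
  ultimately have "q1 = 0" "q2 = 0" "p1 = 0" "p2 = 0"
    using assms unfolding indep2_def by (metis neg_equal_0_iff_equal)+
  then have "1 *c (p1 *c u + q1 *c v) + 0 *c (p2 *c u + q2 *c v) = 0" by simp
  then show False using assms unfolding indep2_def by (metis zero_neq_one)
qed

lemma indep2_det_iff:
  assumes "indep2 u v"
  shows "indep2 (p1 *c u + q1 *c v) (p2 *c u + q2 *c v) \<longleftrightarrow> p1 * q2 - p2 * q1 \<noteq> 0"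
proof
  assume det: "p1 * q2 - p2 * q1 \<noteq> 0"
  show "indep2 (p1 *c u + q1 *c v) (p2 *c u + q2 *c v)"
    unfolding indep2_def comb_comb
  proof (intro allI impI)
    fix c d assume "(c * p1 + d * p2) *c u + (c * q1 + d * q2) *c v = 0"
    then have 0: "c * p1 + d * p2 = 0" "c * q1 + d * q2 = 0" using assms by (auto simp: indep2_def)
    have "c * (p1 * q2 - p2 * q1) = (c * p1 + d * p2) * q2 - (c * q1 + d * q2) * p2"
      "d * (p1 * q2 - p2 * q1) = (c * q1 + d * q2) * p1 - (c * p1 + d * p2) * q1"
      by (auto simp: algebra_simps)
    then show "c = 0 \<and> d = 0" using 0 det by auto
  qed
qed (rule indep2_det)

text \<open>Cramer's rule for coordinates with respect to the pair that has coordinate matrix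
\<open>((p1, p2), (q1, q2))\<close>; it makes coordinates depend holomorphically on the data.\<close>

lemma cramer:
  assumes "p1 * q2 - p2 * q1 \<noteq> 0"
  shows "p3 *c u + q3 *c v =
     ((p3 * q2 - p2 * q3) / (p1 * q2 - p2 * q1)) *c (p1 *c u + q1 *c v)
   + ((p1 * q3 - p3 * q1) / (p1 * q2 - p2 * q1)) *c (p2 *c u + q2 *c v)"
proof -
  have 1: "(p3 * q2 - p2 * q3) / (p1 * q2 - p2 * q1) * p1 + (p1 * q3 - p3 * q1) / (p1 * q2 - p2 * q1) * p2 = p3"
    and 2: "(p3 * q2 - p2 * q3) / (p1 * q2 - p2 * q1) * q1 + (p1 * q3 - p3 * q1) / (p1 * q2 - p2 * q1) * q2 = q3"
    using assms by (auto simp: divide_simps) (auto simp: algebra_simps)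
  show ?thesis unfolding comb_comb 1 2 ..
qed

text \<open>Two vectors that generate two independent ones are independent: the square coefficient
matrix is invertible.\<close>

lemma indep2_generators:
  assumes ind: "indep2 x y" and x: "x = p1 *c u + q1 *c v" and y: "y = p2 *c u + q2 *c v"
  shows "indep2 u v"
proof -
  have ne: "p1 * q2 - p2 * q1 \<noteq> 0" using ind x y indep2_det by blast
  show ?thesis unfolding indep2_def
  proof (intro allI impI)
    fix c d assume 0: "c *c u + d *c v = 0"
    define X where "X = c * q2 - d * p2"
    define Y where "Y = d * p1 - c * q1"
    have "c *c u + d *c v = (X / (p1 * q2 - p2 * q1)) *c x + (Y / (p1 * q2 - p2 * q1)) *c y"
      using cramer[OF ne, of c u d v] by (simp add: x y X_def Y_def mult.commute)
    then have "X = 0" "Y = 0" using 0 ind ne unfolding indep2_def by (metis divide_eq_0_iff)+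
    moreover have "c * (p1 * q2 - p2 * q1) = p1 * X + p2 * Y" "d * (p1 * q2 - p2 * q1) = q1 * X + q2 * Y"
      by (auto simp: X_def Y_def algebra_simps)
    ultimately show "c = 0 \<and> d = 0" using ne by auto
  qed
qed

lemma independent_pair_iff:
  "indep2 a b \<longleftrightarrow> a \<noteq> b \<and> vs.independent {a, b}"
proof
  assume l: "indep2 a b"
  have ab: "a \<noteq> b"
  proof
    assume "a = b"
    then have "1 *c a + (- 1) *c b = 0" by simp
    then show False using l unfolding indep2_def by (metis zero_neq_one)
  qed
  have b0: "b \<noteq> 0"
  proof
    assume "b = 0"
    then have "0 *c a + 1 *c b = 0" by simp
    then show False using l unfolding indep2_def by (metis zero_neq_one)
  qed
  have "a \<notin> vs.span {b}"
  proof
    assume "a \<in> vs.span {b}"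
    then obtain k where "a = k *c b" by (auto simp: vs.span_singleton)
    then have "1 *c a + (- k) *c b = 0" by simp
    then show False using l unfolding indep2_def by (metis zero_neq_one)
  qed
  then show "a \<noteq> b \<and> vs.independent {a, b}"
    using ab b0 by (simp add: vs.independent_insert)
next
  assume i: "a \<noteq> b \<and> vs.independent {a, b}"
  show "indep2 a b" unfolding indep2_def
  proof (intro allI impI)
    fix c d assume 0: "c *c a + d *c b = 0"
    define u where "u = (\<lambda>x. if x = a then c else d)"
    have "b \<noteq> a" using i by blast
    then have "(\<Sum>x\<in>{a, b}. u x *c x) = 0" using 0 by (simp add: u_def)
    then have "u x = 0" if "x \<in> {a, b}" for x
      using i vs.dependent_finite[of "{a, b}"] that by blast
    from this[of a] this[of b] show "c = 0 \<and> d = 0" using i by (auto simp: u_def)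
  qed
qed

lemma dim_pos_nonzero:
  assumes "vs.dim S > 0" obtains v where "v \<in> S" "v \<noteq> 0"
proof -
  obtain B where B: "B \<subseteq> S" "vs.independent B" "card B = vs.dim S" by (metis vs.basis_exists)
  then obtain v where "v \<in> B" using assms by fastforce
  moreover have "v \<noteq> 0" using B(2) \<open>v \<in> B\<close> vs.dependent_zero by blast
  ultimately show ?thesis using B that by blast
qed

lemma dim_2_pair:
  assumes "vs.dim S = 2" obtains a b where "a \<in> S" "b \<in> S" "indep2 a b"
proof -
  obtain B where B: "B \<subseteq> S" "vs.independent B" "card B = vs.dim S" by (metis vs.basis_exists)
  then obtain a b where "B = {a, b}" "a \<noteq> b" using assms by (metis card_2_iff)
  then show ?thesis using B that independent_pair_iff by auto
qed

lemma endo_on_in: "endo_on sc W g \<Longrightarrow> x \<in> W \<Longrightarrow> g x \<in> W"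
  by (auto simp: endo_on_def)

lemma endo_on_funpow: "endo_on sc W g \<Longrightarrow> endo_on sc W (g ^^ n)"
  by (induction n) (auto simp: endo_on_def image_subset_iff)

lemma endo_on_zero:
  assumes "endo_on sc W g" "vs.subspace W" shows "g 0 = 0"
proof -
  have "0 \<in> W" using assms(2) vs.subspace_0 by blast
  then have "g (0 *c 0) = 0 *c g 0" using assms(1) unfolding endo_on_def by blast
  then show ?thesis by simp
qed

lemma endo_on_shift:
  assumes f: "endo_on sc W f" and W: "vs.subspace W"
  shows "endo_on sc W (\<lambda>u. f u - l *c u)"
proof -
  have "f x - l *c x \<in> W" if "x \<in> W" for x
    using assms that by (intro vs.subspace_diff vs.subspace_scale) (auto simp: endo_on_def)
  then show ?thesis
    using f unfolding endo_on_def
    by (simp add: image_subset_iff vs.scale_right_distrib vs.scale_right_diff_distrib mult.commute)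
qed

lemma nilpotent_last_nonzero:
  assumes g: "endo_on sc W g" and v: "v \<in> W" "v \<noteq> 0" "(g ^^ n) v = 0"
  obtains j where "(g ^^ j) v \<noteq> 0" "g ((g ^^ j) v) = 0" "(g ^^ j) v \<in> W"
proof -
  define m where "m = (LEAST n. (g ^^ n) v = 0)"
  have m: "(g ^^ m) v = 0" "\<And>k. k < m \<Longrightarrow> (g ^^ k) v \<noteq> 0"
    unfolding m_def using LeastI[of "\<lambda>n. (g ^^ n) v = 0" n, OF v(3)]
      not_less_Least[of _ "\<lambda>n. (g ^^ n) v = 0"] by auto
  then obtain j where j: "m = Suc j" using v by (cases m) auto
  have "(g ^^ j) v \<in> W" by (rule endo_on_in[OF endo_on_funpow[OF g] v(1)])
  then show ?thesis using that[of j] m j by auto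
qed

text \<open>Any two independent vectors generate: the dimension is at most two.  In this form the property is
checked for flat sections by evaluating them at one point.\<close>

definition two_dim :: "'b set \<Rightarrow> bool" where
  "two_dim W \<longleftrightarrow> vs.subspace W \<and>
     (\<forall>a\<in>W. \<forall>b\<in>W. indep2 a b \<longrightarrow> (\<forall>v\<in>W. \<exists>c d. v = c *c a + d *c b))"

lemma eigenvectors_independent:
  assumes "a \<noteq> 0" "b \<noteq> 0" "f a = l1 *c a" "f b = l2 *c b" "l1 \<noteq> l2"
    "endo_on sc W f" "a \<in> W" "b \<in> W" "vs.subspace W"
  shows "indep2 a b"
  unfolding indep2_def
proof (intro allI impI)
  fix c d assume 0: "c *c a + d *c b = 0"
  have "f (c *c a + d *c b) = f (c *c a) + f (d *c b)"
    using assms(6-9) by (auto simp: endo_on_def vs.subspace_scale)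
  also have "\<dots> = c *c f a + d *c f b" using assms(6-8) by (auto simp: endo_on_def)
  finally have "c *c (l1 *c a) + d *c (l2 *c b) = 0"
    using 0 endo_on_zero[OF assms(6,9)] assms(3,4) by simp
  then have "(c *c (l1 *c a) + d *c (l2 *c b)) - l2 *c (c *c a + d *c b) = 0" using 0 by simp
  then have "(c * (l1 - l2)) *c a = 0"
    by (simp add: algebra_simps vs.scale_left_diff_distrib)
  then have "c = 0" using assms by auto
  then show "c = 0 \<and> d = 0" using 0 assms by auto
qed

lemma log_unipotent_eq_0:
  assumes "u v = v" "u 0 = 0"
  shows "log_unipotent sc W u v = 0"
proof -
  have "((\<lambda>x. u x - x) ^^ k) v = 0" if k: "k \<ge> 1" for k
  proof -
    have "((\<lambda>x. u x - x) ^^ Suc j) v = 0" for j by (induction j) (auto simp: assms)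
    then show ?thesis using k by (cases k) auto
  qed
  then show ?thesis unfolding log_unipotent_def by (intro sum.neutral) auto
qed

text \<open>Both factors of a Jordan decomposition commute with \<open>f\<close>, hence preserve the two eigenlines;
  on a line a unipotent map is the identity.\<close>

lemma log_unipotent_part_distinct:
  assumes W: "two_dim W" and f: "endo_on sc W f"
    and ab: "a \<in> W" "b \<in> W" "a \<noteq> 0" "b \<noteq> 0" "f a = l1 *c a" "f b = l2 *c b" and l: "l1 \<noteq> l2"
    and v: "v \<in> W"
  shows "log_unipotent sc W (unipotent_part sc W f) v = 0"
proof -
  have sub: "vs.subspace W" using W by (simp add: two_dim_def)
  note ind = eigenvectors_independent[OF ab(3-6) l f ab(1,2) sub]
  have gen: "\<exists>c d. v = c *c a + d *c b" if "v \<in> W" for v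
    using W ab ind that unfolding two_dim_def by blast
  define u where "u = unipotent_part sc W f"
  define P where "P u \<longleftrightarrow> unipotent_on sc W u \<and>
       (\<exists>s. semisimple_on sc W s \<and> (\<forall>v\<in>W. f v = s (u v) \<and> s (u v) = u (s v)))" for u
  have "semisimple_on sc W f" unfolding semisimple_on_def
  proof (intro conjI f equalityI)
    show "vs.span {v \<in> W. \<exists>c. f v = c *c v} \<subseteq> W" using sub by (intro vs.span_minimal) auto
    show "W \<subseteq> vs.span {v \<in> W. \<exists>c. f v = c *c v}"
    proof
      fix v assume "v \<in> W"
      then obtain c d where "v = c *c a + d *c b" using gen by blast
      moreover have "a \<in> vs.span {v \<in> W. \<exists>c. f v = c *c v}" "b \<in> vs.span {v \<in> W. \<exists>c. f v = c *c v}"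
        using ab by (auto intro!: vs.span_base)
      ultimately show "v \<in> vs.span {v \<in> W. \<exists>c. f v = c *c v}" by (simp add: vs.span_add vs.span_scale)
    qed
  qed
  moreover have "unipotent_on sc W (\<lambda>v. v)"
    unfolding unipotent_on_def by (auto simp: endo_on_def intro!: exI[of _ 1])
  ultimately have "P (\<lambda>v. v)" unfolding P_def by blast
  then have "P u" unfolding u_def unipotent_part_def P_def[symmetric] by (rule someI[where P = P])
  then obtain s n where u: "endo_on sc W u" "\<And>v. v \<in> W \<Longrightarrow> ((\<lambda>x. u x - x) ^^ n) v = 0"
    and s: "semisimple_on sc W s" "\<And>v. v \<in> W \<Longrightarrow> f v = s (u v)" "\<And>v. v \<in> W \<Longrightarrow> s (u v) = u (s v)"
    unfolding P_def unipotent_on_def by blast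
  have uW: "u v \<in> W" if "v \<in> W" for v using u(1) that by (auto simp: endo_on_def)
  have comm: "f (u v) = u (f v)" if "v \<in> W" for v
    using s(2)[OF uW[OF that]] s(2)[OF that] s(3)[OF uW[OF that]] by simp
  have line: "u x = x" if x: "x \<in> W" "x \<noteq> 0" "f x = l *c x"
    and y: "y \<in> W" "y \<noteq> 0" "f y = m *c y" "l \<noteq> m" for x y l m
  proof -
    note ind' = eigenvectors_independent[OF x(2) y(2) x(3) y(3) y(4) f x(1) y(1) sub]
    obtain c d where cd: "u x = c *c x + d *c y"
      using W x y ind' uW[OF x(1)] unfolding two_dim_def by blast
    have "f (u x) = l *c u x" using comm[OF x(1)] x u(1) by (auto simp: endo_on_def)
    moreover have "f (u x) = c *c f x + d *c f y"
      unfolding cd using f x(1) y(1) sub by (auto simp: endo_on_def vs.subspace_scale)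
    ultimately have "(c * l) *c x + (d * m) *c y = (c * l) *c x + (d * l) *c y"
      using x y cd by (simp add: vs.scale_right_distrib mult.commute)
    then have "d * m = d * l" by (rule indep2D[OF ind'])
    then have "d = 0" using y(4) by simp
    then have c: "u x = c *c x" using cd by simp
    have "((\<lambda>x. u x - x) ^^ k) x = (c - 1) ^ k *c x" for k
    proof (induction k)
      case (Suc k)
      have "u ((c - 1) ^ k *c x) = (c - 1) ^ k *c u x" using u(1) x(1) by (auto simp: endo_on_def)
      then show ?case using Suc c by (simp add: vs.scale_left_diff_distrib algebra_simps)
    qed simp
    then have "(c - 1) ^ n *c x = 0" using u(2)[OF x(1)] by metis
    then have "c = 1" using x(2) by auto
    then show ?thesis using c by simp
  qed
  have "u a = a" "u b = b" using line[of a l1 b l2] line[of b l2 a l1] ab l by auto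
  then have "u v = v" if "v \<in> W" for v
    using gen[OF that] u(1) ab sub by (auto simp: endo_on_def vs.subspace_scale)
  moreover have "u 0 = 0" by (rule endo_on_zero[OF u(1) sub])
  ultimately show ?thesis using v log_unipotent_eq_0 u_def by blast
qed

text \<open>If \<open>g\<^sup>2 \<noteq> 0\<close>, there is \<open>w\<close> with \<open>g\<^sup>2 w \<noteq> 0 = g\<^sup>3 w\<close>, and \<open>g w, g\<^sup>2 w\<close> are independent,
hence generate \<open>w\<close>; applying \<open>g\<close> twice to that relation gives \<open>g\<^sup>2 w = 0\<close>.\<close>

lemma nilpotent_two_dim:
  assumes W: "two_dim W" and g: "endo_on sc W g"
    and nil: "\<And>v. v \<in> W \<Longrightarrow> \<exists>n. (g ^^ n) v = 0" and v: "v \<in> W"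
  shows "g (g v) = 0"
proof (rule ccontr)
  assume ne: "g (g v) \<noteq> 0"
  have sub: "vs.subspace W" using W by (simp add: two_dim_def)
  note g0 = endo_on_zero[OF g sub]
  have gW: "g x \<in> W" if "x \<in> W" for x using g that by (auto simp: endo_on_def)
  obtain n where n: "(g ^^ n) (g (g v)) = 0" using nil gW v by blast
  obtain j where j: "(g ^^ j) (g (g v)) \<noteq> 0" "g ((g ^^ j) (g (g v))) = 0"
    using nilpotent_last_nonzero[OF g gW[OF gW[OF v]] ne n] by metis
  define w where "w = (g ^^ j) v"
  have w: "w \<in> W" "g (g w) \<noteq> 0" "g (g (g w)) = 0"
    using endo_on_in[OF endo_on_funpow[OF g, of j] v] j by (auto simp: w_def funpow_swap1)
  have lin: "g (c *c x + d *c y) = c *c g x + d *c g y" if "x \<in> W" "y \<in> W" for c d x y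
    using g sub that by (auto simp: endo_on_def vs.subspace_scale)
  have ind: "indep2 (g w) (g (g w))" unfolding indep2_def
  proof (intro allI impI)
    fix c d assume 0: "c *c g w + d *c g (g w) = 0"
    then have "c *c g (g w) + d *c g (g (g w)) = 0"
      using lin[of "g w" "g (g w)" c d] gW w(1) g0 by simp
    then have "c = 0" using w by auto
    then show "c = 0 \<and> d = 0" using 0 w by auto
  qed
  obtain c d where "w = c *c g w + d *c g (g w)"
    using W w(1) gW ind unfolding two_dim_def by blast
  then have 1: "g w = c *c g (g w)" using lin[of "g w" "g (g w)" c d] gW w(1,3) by simp
  then have "g (g w) = c *c g (g (g w))" using lin[of "g (g w)" 0 c 0] gW w(1) vs.subspace_0[OF sub] g0 by simp
  then show False using w by simp
qed

text \<open>If \<open>f - l\<close> is nilpotent, then the only semisimple factor possible is multiplication by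
  \<open>l\<close>, so the unipotent factor is \<open>f / l\<close>.\<close>

lemma log_unipotent_part_equal:
  assumes W: "two_dim W" and f: "endo_on sc W f" and l: "l \<noteq> 0"
    and nil: "\<And>v. v \<in> W \<Longrightarrow> \<exists>n. ((\<lambda>u. f u - l *c u) ^^ n) v = 0"
    and dim: "vs.dim W > 0" and v: "v \<in> W"
  shows "log_unipotent sc W (unipotent_part sc W f) v = (1 / l) *c (f v - l *c v)"
proof -
  have sub: "vs.subspace W" using W by (simp add: two_dim_def)
  define g where "g = (\<lambda>u. f u - l *c u)"
  have g: "endo_on sc W g" unfolding g_def by (rule endo_on_shift[OF f sub])
  have gg: "g (g v) = 0" if "v \<in> W" for v
    using nilpotent_two_dim[OF W g _ that] nil by (simp add: g_def)
  have g0: "g 0 = 0" by (rule endo_on_zero[OF g sub])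
  have gs: "g (c *c x) = c *c g x" if "x \<in> W" for c x using g that by (auto simp: endo_on_def)
  have fg: "f x = l *c x + g x" for x by (simp add: g_def)
  define u where "u = unipotent_part sc W f"
  define P where "P u \<longleftrightarrow> unipotent_on sc W u \<and>
       (\<exists>s. semisimple_on sc W s \<and> (\<forall>v\<in>W. f v = s (u v) \<and> s (u v) = u (s v)))" for u
  have "P (\<lambda>v. (1 / l) *c f v)" unfolding P_def
  proof (intro conjI exI[of _ "\<lambda>v. l *c v"] ballI)
    have end1: "endo_on sc W (\<lambda>v. (1 / l) *c f v)"
      using f sub by (auto simp: endo_on_def vs.subspace_scale vs.scale_right_distrib)
    have "((\<lambda>v. (1 / l) *c f v - v) ^^ 2) x = 0" if "x \<in> W" for x
    proof -
      have "(1 / l) *c f y - y = (1 / l) *c g y" for y using l by (simp add: fg vs.scale_right_distrib)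
      moreover have "g x \<in> W" using g that by (auto simp: endo_on_def)
      ultimately show ?thesis using gg[OF that] gs by (simp add: numeral_2_eq_2)
    qed
    then show "unipotent_on sc W (\<lambda>v. (1 / l) *c f v)"
      unfolding unipotent_on_def using end1 by blast
    have "{v \<in> W. \<exists>c. l *c v = c *c v} = W" by auto
    then show "semisimple_on sc W (\<lambda>v. l *c v)"
      unfolding semisimple_on_def using sub vs.span_eq_iff
      by (auto simp: endo_on_def vs.subspace_scale vs.scale_right_distrib mult.commute)
    fix v assume "v \<in> W"
    then show "f v = l *c (1 / l) *c f v" "l *c (1 / l) *c f v = (1 / l) *c f (l *c v)"
      using l f by (auto simp: endo_on_def)
  qed
  then have "P u" unfolding u_def unipotent_part_def P_def[symmetric] by (rule someI[where P = P])
  then obtain s n where u: "endo_on sc W u" "\<And>v. v \<in> W \<Longrightarrow> ((\<lambda>x. u x - x) ^^ n) v = 0"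
    and s: "semisimple_on sc W s" "\<And>v. v \<in> W \<Longrightarrow> f v = s (u v)" "\<And>v. v \<in> W \<Longrightarrow> s (u v) = u (s v)"
    unfolding P_def unipotent_on_def by blast
  have uW: "u v \<in> W" if "v \<in> W" for v using u(1) that by (auto simp: endo_on_def)
  have sW: "endo_on sc W s" using s(1) by (simp add: semisimple_on_def)
  have u1: "endo_on sc W (\<lambda>x. u x - x)" using endo_on_shift[OF u(1) sub, of 1] by simp
  have eig: "c = l" if x: "x \<in> W" "x \<noteq> 0" "s x = c *c x" for x c
  proof -
    obtain j where j: "((\<lambda>x. u x - x) ^^ j) x \<noteq> 0" "u (((\<lambda>x. u x - x) ^^ j) x) = ((\<lambda>x. u x - x) ^^ j) x"
       "((\<lambda>x. u x - x) ^^ j) x \<in> W"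
      by (rule nilpotent_last_nonzero[OF u1 x(1,2) u(2)[OF x(1)]]) simp
    have sc: "((\<lambda>x. u x - x) ^^ k) x \<in> W \<and> s (((\<lambda>x. u x - x) ^^ k) x) = c *c ((\<lambda>x. u x - x) ^^ k) x" for k
    proof (induction k)
      case (Suc k)
      define y where "y = ((\<lambda>x. u x - x) ^^ k) x"
      have y: "y \<in> W" "s y = c *c y" using Suc y_def by auto
      have "s (u y + (- 1) *c y) = s (u y) + (- 1) *c s y"
        using sW y(1) uW[OF y(1)] vs.subspace_scale[OF sub y(1), of "-1"] unfolding endo_on_def by metis
      also have "\<dots> = c *c (u y) + (- 1) *c (c *c y)"
        using s(3)[OF y(1)] y u(1) by (auto simp: endo_on_def)
      finally have "s (u y - y) = c *c (u y - y)" by (simp add: vs.scale_right_diff_distrib)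
      moreover have "u y - y \<in> W" using u1 y(1) by (auto simp: endo_on_def)
      ultimately show ?case by (simp add: y_def)
    qed (use x in auto)
    define w where "w = ((\<lambda>x. u x - x) ^^ j) x"
    have w: "w \<in> W" "w \<noteq> 0" "f w = c *c w" using sc[of j] j s(2)[OF j(3)] by (auto simp: w_def)
    have "g w = (c - l) *c w" using w by (simp add: g_def vs.scale_left_diff_distrib)
    then have "g (g w) = (c - l) *c (c - l) *c w" using gs[OF w(1)] by simp
    then show "c = l" using gg[OF w(1)] w(2) by auto
  qed
  have "W \<subseteq> {v \<in> W. s v = l *c v}"
  proof -
    have "vs.subspace {v \<in> W. s v = l *c v}"
      using sub sW endo_on_zero[OF sW sub]
      by (auto simp: vs.subspace_def endo_on_def vs.scale_right_distrib mult.commute)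
    moreover have "{v \<in> W. \<exists>c. s v = c *c v} \<subseteq> {v \<in> W. s v = l *c v}"
      using eig endo_on_zero[OF sW sub] by fastforce
    ultimately have "vs.span {v \<in> W. \<exists>c. s v = c *c v} \<subseteq> {v \<in> W. s v = l *c v}" by (rule vs.span_minimal[rotated])
    then show ?thesis using s(1) by (simp add: semisimple_on_def)
  qed
  then have ug: "u x - x = (1 / l) *c g x" if "x \<in> W" for x
    using s(2)[OF that] uW[OF that] fg[of x] l
    by (auto simp: vs.scale_right_distrib subset_iff) (metis (no_types, lifting) add_diff_cancel_left' divide_self_if
      eq_diff_eq mult.commute vs.scale_one vs.scale_right_diff_distrib vs.scale_scale times_divide_eq_right mult_1)
  have gW: "g v \<in> W" using g v by (auto simp: endo_on_def)
  define h where "h = (\<lambda>x. u x - x)"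
  have h1: "h v = (1 / l) *c g v" using ug[OF v] by (simp add: h_def)
  have h2: "h (h v) = 0"
  proof -
    have "h v \<in> W" using h1 gW sub by (simp add: vs.subspace_scale)
    then have "h (h v) = (1 / l) *c g (h v)" using ug by (simp add: h_def)
    then show ?thesis unfolding h1 using gs[OF gW] gg[OF v] by simp
  qed
  have h0: "h 0 = 0" using endo_on_zero[OF u(1) sub] by (simp add: h_def)
  \<comment> \<open>Hence the logarithm series stops after its linear term.\<close>
  have hk: "(h ^^ k) v = 0" if "k \<ge> 2" for k
  proof -
    have "(h ^^ Suc (Suc m)) v = 0" for m by (induction m) (auto simp: h2 h0)
    then show ?thesis using that by (metis add_2_eq_Suc le_Suc_ex)
  qed
  have "log_unipotent sc W u v = (\<Sum>k = 1..vs.dim W. ((-1) ^ (k + 1) / of_nat k) *c (h ^^ k) v)"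
    by (simp add: log_unipotent_def h_def)
  also have "\<dots> = (\<Sum>k\<in>{1}. ((-1) ^ (k + 1) / of_nat k) *c (h ^^ k) v)"
    using dim by (intro sum.mono_neutral_right) (auto simp: hk)
  also have "\<dots> = (1 / l) *c g v" by (simp add: h1)
  finally show ?thesis by (simp add: u_def g_def)
qed

text \<open>Distinct eigenvalues give two eigenlines and a trivial unipotent part.  For a double eigenvalue \<open>l\<close>
the logarithm is \<open>(f - l) / l\<close>, whose square is zero, so it vanishes exactly if \<open>f\<close> is
multiplication by \<open>l\<close>, and otherwise any \<open>b\<close> outside its kernel starts a Jordan chain.\<close>

theorem two_dim_jordan_basis:
  assumes W: "two_dim W" and f: "endo_on sc W f"
    and inj: "\<And>v. v \<in> W \<Longrightarrow> f v = 0 \<Longrightarrow> v = 0"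
    and ev: "eigenvalues_are sc W f {#l1, l2#}"
  defines "N \<equiv> log_unipotent sc W (unipotent_part sc W f)"
  shows "l1 \<noteq> 0" "l2 \<noteq> 0"
    and "\<forall>v\<in>W. N v = 0 \<Longrightarrow> \<exists>a\<in>W. \<exists>b\<in>W. indep2 a b \<and> f a = l1 *c a \<and> f b = l2 *c b"
    and "\<not> (\<forall>v\<in>W. N v = 0) \<Longrightarrow> l1 = l2 \<and>
      (\<exists>a\<in>W. \<exists>b\<in>W. indep2 a b \<and> f a = l1 *c a \<and> f b = l1 *c b + a)"
proof -
  have sub: "vs.subspace W" using W by (simp add: two_dim_def)
  define G where "G l = {v\<in>W. \<exists>n. ((\<lambda>u. f u - l *c u) ^^ n) v = 0}" for l
  have dG: "vs.dim (G l) = count {#l1, l2#} l" for l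
    using ev unfolding eigenvalues_are_def G_def by blast
  have eig: "\<exists>w\<in>W. w \<noteq> 0 \<and> f w = l *c w" if l: "l \<in> {l1, l2}" for l
  proof -
    have "vs.dim (G l) > 0" using dG[of l] l by auto
    then obtain v where v: "v \<in> G l" "v \<noteq> 0" by (rule dim_pos_nonzero)
    then obtain n where vn: "v \<in> W" "((\<lambda>u. f u - l *c u) ^^ n) v = 0" by (auto simp: G_def)
    obtain j where j: "((\<lambda>u. f u - l *c u) ^^ j) v \<noteq> 0"
        "f (((\<lambda>u. f u - l *c u) ^^ j) v) - l *c ((\<lambda>u. f u - l *c u) ^^ j) v = 0"
        "((\<lambda>u. f u - l *c u) ^^ j) v \<in> W"
      by (rule nilpotent_last_nonzero[OF endo_on_shift[OF f sub] vn(1) v(2) vn(2)])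
    then show ?thesis by (intro bexI[OF _ j(3)]) simp
  qed
  show l10: "l1 \<noteq> 0" and l20: "l2 \<noteq> 0" using eig[of l1] eig[of l2] inj by fastforce+
  have distinct: "\<forall>v\<in>W. N v = 0" "\<exists>a\<in>W. \<exists>b\<in>W. indep2 a b \<and> f a = l1 *c a \<and> f b = l2 *c b"
    if ne: "l1 \<noteq> l2"
  proof -
    obtain a b where ab: "a \<in> W" "b \<in> W" "a \<noteq> 0" "b \<noteq> 0" "f a = l1 *c a" "f b = l2 *c b"
      using eig[of l1] eig[of l2] by auto
    show "\<forall>v\<in>W. N v = 0" using log_unipotent_part_distinct[OF W f ab ne] by (simp add: N_def)
    show "\<exists>a\<in>W. \<exists>b\<in>W. indep2 a b \<and> f a = l1 *c a \<and> f b = l2 *c b"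
      using eigenvectors_independent[OF ab(3-6) ne f ab(1,2) sub] ab by blast
  qed
  have equal: "\<exists>a\<in>W. \<exists>b\<in>W. indep2 a b" "\<And>v. v \<in> W \<Longrightarrow> N v = (1 / l1) *c (f v - l1 *c v)"
    "\<And>v. v \<in> W \<Longrightarrow> (\<lambda>u. f u - l1 *c u) (f v - l1 *c v) = 0"
    if eq: "l1 = l2"
  proof -
    have "vs.dim (G l1) = 2" using dG[of l1] eq by simp
    then obtain a b where ab: "a \<in> G l1" "b \<in> G l1" "indep2 a b" by (rule dim_2_pair)
    then have abW: "a \<in> W" "b \<in> W" by (auto simp: G_def)
    then show "\<exists>a\<in>W. \<exists>b\<in>W. indep2 a b" using ab by blast
    define g where "g = (\<lambda>u. f u - l1 *c u)"
    have g: "endo_on sc W g" unfolding g_def by (rule endo_on_shift[OF f sub])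
    have up: "(g ^^ m) x = 0" if "(g ^^ n) x = 0" "n \<le> m" for n m x
    proof -
      have "(g ^^ (k + n)) x = 0" for k
        by (induction k) (use that endo_on_zero[OF g sub] in auto)
      then show ?thesis using that by (metis le_add_diff_inverse2)
    qed
    have nil: "\<exists>n. (g ^^ n) v = 0" if v: "v \<in> W" for v
    proof -
      obtain c d where cd: "v = c *c a + d *c b" using W abW ab v unfolding two_dim_def by blast
      obtain n m where nm: "(g ^^ n) a = 0" "(g ^^ m) b = 0" using ab by (auto simp: G_def g_def)
      have "(g ^^ (max n m)) v = c *c (g ^^ (max n m)) a + d *c (g ^^ (max n m)) b"
        unfolding cd using endo_on_funpow[OF g, of "max n m"] abW sub by (auto simp: endo_on_def vs.subspace_scale)
      then have "(g ^^ (max n m)) v = 0" using up[OF nm(1)] up[OF nm(2)] by simp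
      then show ?thesis by blast
    qed
    show "(\<lambda>u. f u - l1 *c u) (f v - l1 *c v) = 0" if "v \<in> W" for v
      using nilpotent_two_dim[OF W g nil that] by (simp add: g_def)
    have "vs.dim W = card {a, b}"
    proof (rule vs.dim_eq_card)
      have "W \<subseteq> vs.span {a, b}"
      proof
        fix v assume "v \<in> W"
        then obtain c d where "v = c *c a + d *c b" using W abW ab unfolding two_dim_def by blast
        then show "v \<in> vs.span {a, b}" by (simp add: vs.span_add vs.span_scale vs.span_base)
      qed
      then show "vs.span {a, b} = vs.span W" using abW by (metis bot.extremum insert_subset vs.span_mono vs.span_span subset_antisym)
      show "vs.independent {a, b}" using ab independent_pair_iff by blast
    qed
    then have "vs.dim W > 0" by (simp add: card_gt_0_iff)
    then show "N v = (1 / l1) *c (f v - l1 *c v)" if "v \<in> W" for v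
      unfolding N_def using log_unipotent_part_equal[OF W f l10 _ _ that] nil by (simp add: g_def)
  qed
  show "\<exists>a\<in>W. \<exists>b\<in>W. indep2 a b \<and> f a = l1 *c a \<and> f b = l2 *c b" if N0: "\<forall>v\<in>W. N v = 0"
  proof (cases "l1 = l2")
    case True
    have "f v = l1 *c v" if "v \<in> W" for v
      using equal(2)[OF True that] N0 that l10 by auto
    then show ?thesis using equal(1)[OF True] True by metis
  qed (rule distinct)
  show "l1 = l2 \<and> (\<exists>a\<in>W. \<exists>b\<in>W. indep2 a b \<and> f a = l1 *c a \<and> f b = l1 *c b + a)"
    if N0: "\<not> (\<forall>v\<in>W. N v = 0)"
  proof -
    have eq: "l1 = l2" using distinct N0 by blast
    obtain b where b: "b \<in> W" "f b - l1 *c b \<noteq> 0" using N0 equal(2)[OF eq] by auto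
    define a where "a = f b - l1 *c b"
    have aW: "a \<in> W" using endo_on_shift[OF f sub, of l1] b by (auto simp: a_def endo_on_def)
    have fa: "f a = l1 *c a" using equal(3)[OF eq b(1)] by (simp add: a_def)
    have fb: "f b = l1 *c b + a" by (simp add: a_def)
    have "indep2 a b" unfolding indep2_def
    proof (intro allI impI)
      fix c d assume 0: "c *c a + d *c b = 0"
      have "f (c *c a + d *c b) = c *c f a + d *c f b"
        using f aW b sub by (auto simp: endo_on_def vs.subspace_scale)
      then have "c *c (l1 *c a) + d *c (l1 *c b + a) = 0" using fa fb 0 endo_on_zero[OF f sub] by simp
      moreover have "c *c (l1 *c a) + d *c (l1 *c b + a) = l1 *c (c *c a + d *c b) + d *c a"
        by (simp add: vs.scale_right_distrib mult.commute)
      ultimately have "d *c a = 0" using 0 by simp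
      then have "d = 0" using b by (simp add: a_def)
      then show "c = 0 \<and> d = 0" using 0 b by (simp add: a_def)
    qed
    then show ?thesis using eq aW b fa fb by blast
  qed
qed

end

section \<open>Sections and frames\<close>

lemma holomorphic_on_locally:
  assumes "\<And>z. z \<in> U \<Longrightarrow> \<exists>V f'. open V \<and> z \<in> V \<and> f' holomorphic_on V \<and> (\<forall>x\<in>V. f x = f' x)"
  shows "f holomorphic_on U"
  unfolding holomorphic_on_def
proof
  fix z assume "z \<in> U"
  then obtain V f' where V: "open V" "z \<in> V" "f' holomorphic_on V" "\<forall>x\<in>V. f x = f' x"
    using assms by blast
  then have "f' field_differentiable (at z)"
    by (simp add: holomorphic_on_imp_differentiable_at)
  then have "f field_differentiable (at z)"
    using V unfolding field_differentiable_def
    by (metis has_field_derivative_transform_within_open)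
  then show "f field_differentiable (at z within U)"
    by (rule field_differentiable_at_within)
qed

locale te_rank2 =
  fixes T :: "('v::ab_group_add) te"
  assumes TE: "TE_structure T" and rk2: "rk T = 2"
begin

abbreviation smul (infixr "\<odot>" 75) where "smul \<equiv> scl T"
abbreviation "hs \<equiv> hsections T"

lemma is_bundle: "holomorphic_bundle T" and is_connection: "holomorphic_connection T"
  using TE by (auto simp: TE_structure_def)

sublocale V: complex_vector_space "scl T"
  using is_bundle by (intro complex_vector_space.intro) (simp add: holomorphic_bundle_def)

definition frame2 :: "complex set \<Rightarrow> (complex \<Rightarrow> 'v) \<Rightarrow> (complex \<Rightarrow> 'v) \<Rightarrow> bool" where
  "frame2 U a b \<longleftrightarrow> open U \<and> a \<in> hs U \<and> b \<in> hs U \<and> (\<forall>z\<in>U. V.indep2 (a z) (b z))"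

lemma frame2D:
  assumes "frame2 U a b"
  shows "open U" "a \<in> hs U" "b \<in> hs U" "\<And>z. z \<in> U \<Longrightarrow> V.indep2 (a z) (b z)"
  using assms by (auto simp: frame2_def)

lemma hs_fib: "s \<in> hs W \<Longrightarrow> z \<in> W \<Longrightarrow> s z \<in> fib T z"
  by (auto simp: hsections_def)

lemma sum_rk2: "(\<Sum>i<rk T. h i) = h 0 + h 1" for h :: "nat \<Rightarrow> 'a::comm_monoid_add"
  by (simp add: rk2 numeral_2_eq_2)

lemma all_rk2: "(\<forall>i<rk T. P i) \<longleftrightarrow> P 0 \<and> P 1"
  by (auto simp: rk2 numeral_2_eq_2 less_Suc_eq)

lemma hs_chart:
  assumes "s \<in> hs W" "(U, e) \<in> frames T"
  obtains f g where "f holomorphic_on U \<inter> W" "g holomorphic_on U \<inter> W"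
    "\<And>z. z \<in> U \<inter> W \<Longrightarrow> s z = f z \<odot> e 0 z + g z \<odot> e 1 z"
proof -
  have "\<exists>f. (\<forall>i<rk T. f i holomorphic_on U \<inter> W) \<and> (\<forall>z\<in>U \<inter> W. s z = (\<Sum>i<rk T. f i z \<odot> e i z))"
    using assms unfolding hsections_def by auto
  then show ?thesis using that unfolding sum_rk2 all_rk2 by blast
qed

lemma hsI:
  assumes "\<And>z. z \<in> W \<Longrightarrow> s z \<in> fib T z"
    and "\<And>U e. (U, e) \<in> frames T \<Longrightarrow> \<exists>f g. f holomorphic_on U \<inter> W \<and> g holomorphic_on U \<inter> W \<and>
       (\<forall>z\<in>U \<inter> W. s z = f z \<odot> e 0 z + g z \<odot> e 1 z)"
  shows "s \<in> hs W"
proof -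
  have "\<exists>f. (\<forall>i<rk T. f i holomorphic_on U \<inter> W) \<and> (\<forall>z\<in>U \<inter> W. s z = (\<Sum>i<rk T. f i z \<odot> e i z))"
    if Ue: "(U, e) \<in> frames T" for U e
  proof -
    obtain f g where "f holomorphic_on U \<inter> W" "g holomorphic_on U \<inter> W"
       "\<forall>z\<in>U \<inter> W. s z = f z \<odot> e 0 z + g z \<odot> e 1 z" using assms(2)[OF Ue] by blast
    then show ?thesis unfolding sum_rk2 all_rk2
      by (intro exI[of _ "\<lambda>i. if i = 0 then f else g"]) simp
  qed
  then show ?thesis unfolding hsections_def using assms(1) by auto
qed

lemma hs_mono:
  assumes s: "s \<in> hs W" and sub: "W' \<subseteq> W"
  shows "s \<in> hs W'"
proof (rule hsI)
  show "s z \<in> fib T z" if "z \<in> W'" for z using hs_fib[OF s] sub that by auto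
  fix U e assume U: "(U, e) \<in> frames T"
  obtain f g where fg: "f holomorphic_on U \<inter> W" "g holomorphic_on U \<inter> W"
    "\<And>z. z \<in> U \<inter> W \<Longrightarrow> s z = f z \<odot> e 0 z + g z \<odot> e 1 z" using hs_chart[OF s U] by metis
  have "f holomorphic_on U \<inter> W'" "g holomorphic_on U \<inter> W'"
    using fg(1,2) sub by (auto intro: holomorphic_on_subset)
  then show "\<exists>f g. f holomorphic_on U \<inter> W' \<and> g holomorphic_on U \<inter> W' \<and>
       (\<forall>z\<in>U \<inter> W'. s z = f z \<odot> e 0 z + g z \<odot> e 1 z)"
    using fg(3) sub by (intro exI[of _ f] exI[of _ g]) auto
qed

lemma frame2_mono: "frame2 U a b \<Longrightarrow> W \<subseteq> U \<Longrightarrow> open W \<Longrightarrow> frame2 W a b"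
  by (auto simp: frame2_def intro: hs_mono)

lemma hs_cong:
  assumes s: "s \<in> hs W" and eq: "\<And>z. z \<in> W \<Longrightarrow> s z = t z"
  shows "t \<in> hs W"
proof (rule hsI)
  show "t z \<in> fib T z" if "z \<in> W" for z using hs_fib[OF s] eq that by metis
  fix U e assume U: "(U, e) \<in> frames T"
  obtain f g where fg: "f holomorphic_on U \<inter> W" "g holomorphic_on U \<inter> W"
    "\<And>z. z \<in> U \<inter> W \<Longrightarrow> s z = f z \<odot> e 0 z + g z \<odot> e 1 z" using hs_chart[OF s U] by metis
  then show "\<exists>f g. f holomorphic_on U \<inter> W \<and> g holomorphic_on U \<inter> W \<and>
       (\<forall>z\<in>U \<inter> W. t z = f z \<odot> e 0 z + g z \<odot> e 1 z)"
    using eq by (intro exI[of _ f] exI[of _ g]) auto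
qed

lemma chart_frame:
  assumes "(U, e) \<in> frames T"
  shows "frame2 U (e 0) (e 1)" "z \<in> U \<Longrightarrow> fib T z = {c \<odot> e 0 z + d \<odot> e 1 z | c d. True}"
proof -
  have U: "open U" "e 0 \<in> hs U" "e 1 \<in> hs U"
    using is_bundle assms unfolding holomorphic_bundle_def all_rk2 by blast+
  have img: "(\<lambda>i. e i z) ` {..<rk T} = {e 0 z, e 1 z}" for z by (auto simp: rk2 numeral_2_eq_2 lessThan_Suc)
  have b: "inj_on (\<lambda>i. e i z) {..<rk T} \<and> \<not> V.vs.dependent {e 0 z, e 1 z} \<and> V.vs.span {e 0 z, e 1 z} = fib T z"
    if "z \<in> U" for z
    using is_bundle assms that unfolding holomorphic_bundle_def img[symmetric] by blast
  have "V.indep2 (e 0 z) (e 1 z)" if "z \<in> U" for z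
  proof -
    have "e 0 z \<noteq> e 1 z" using b[OF that] unfolding inj_on_def rk2
      by (metis lessThan_iff pos2 one_less_numeral_iff semiring_norm(76) zero_neq_one)
    then show ?thesis using b[OF that] V.independent_pair_iff by blast
  qed
  then show "frame2 U (e 0) (e 1)" using U by (auto simp: frame2_def)
  show "fib T z = {c \<odot> e 0 z + d \<odot> e 1 z | c d. True}" if "z \<in> U"
  proof -
    have "V.vs.span {e 0 z, e 1 z} = {c \<odot> e 0 z + d \<odot> e 1 z | c d. True}"
      unfolding V.vs.span_insert V.vs.span_singleton by (auto simp: algebra_simps; metis add.commute diff_add_cancel)
    then show ?thesis using b[OF that] by simp
  qed
qed

lemma chart_exists: obtains U e where "(U, e) \<in> frames T" "z \<in> U"
proof -
  have "z \<in> (\<Union>(U, e)\<in>frames T. U)" using is_bundle unfolding holomorphic_bundle_def by blast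
  then show ?thesis using that by auto
qed

lemma fib_comb:
  assumes "x \<in> fib T z" "y \<in> fib T z" shows "c \<odot> x + d \<odot> y \<in> fib T z"
proof -
  obtain U e where U: "(U, e) \<in> frames T" "z \<in> U" by (rule chart_exists)
  then show ?thesis using assms unfolding chart_frame(2)[OF U] using V.comb_comb by blast
qed

lemma fib_basis:
  assumes "x \<in> fib T z" "y \<in> fib T z" "v \<in> fib T z" "V.indep2 x y"
  obtains c d where "v = c \<odot> x + d \<odot> y"
proof -
  obtain U e where U: "(U, e) \<in> frames T" "z \<in> U" by (rule chart_exists)
  obtain p1 q1 p2 q2 p3 q3 where "x = p1 \<odot> e 0 z + q1 \<odot> e 1 z" "y = p2 \<odot> e 0 z + q2 \<odot> e 1 z"
     "v = p3 \<odot> e 0 z + q3 \<odot> e 1 z"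
    using assms(1-3) unfolding chart_frame(2)[OF U] by blast
  then show ?thesis using V.cramer V.indep2_det assms(4) that by metis
qed

lemma hs_comb:
  assumes s: "s \<in> hs W" and t: "t \<in> hs W" and f: "f holomorphic_on W" and g: "g holomorphic_on W"
  shows "(\<lambda>z. f z \<odot> s z + g z \<odot> t z) \<in> hs W"
proof (rule hsI)
  fix z assume "z \<in> W"
  then show "f z \<odot> s z + g z \<odot> t z \<in> fib T z" using s t by (intro fib_comb hs_fib)
next
  fix U e assume U: "(U, e) \<in> frames T"
  obtain p1 q1 where 1: "p1 holomorphic_on U \<inter> W" "q1 holomorphic_on U \<inter> W"
    "\<And>z. z \<in> U \<inter> W \<Longrightarrow> s z = p1 z \<odot> e 0 z + q1 z \<odot> e 1 z" using hs_chart[OF s U] by metis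
  obtain p2 q2 where 2: "p2 holomorphic_on U \<inter> W" "q2 holomorphic_on U \<inter> W"
    "\<And>z. z \<in> U \<inter> W \<Longrightarrow> t z = p2 z \<odot> e 0 z + q2 z \<odot> e 1 z" using hs_chart[OF t U] by metis
  have fg: "f holomorphic_on U \<inter> W" "g holomorphic_on U \<inter> W"
    using f g by (auto intro: holomorphic_on_subset)
  show "\<exists>fa ga. fa holomorphic_on U \<inter> W \<and> ga holomorphic_on U \<inter> W \<and>
       (\<forall>z\<in>U \<inter> W. f z \<odot> s z + g z \<odot> t z = fa z \<odot> e 0 z + ga z \<odot> e 1 z)"
    by (rule exI[of _ "\<lambda>z. f z * p1 z + g z * p2 z"], rule exI[of _ "\<lambda>z. f z * q1 z + g z * q2 z"])
       (use 1 2 fg V.comb_comb in \<open>auto intro!: holomorphic_intros\<close>)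
qed

lemma hs_scale: "s \<in> hs W \<Longrightarrow> f holomorphic_on W \<Longrightarrow> (\<lambda>z. f z \<odot> s z) \<in> hs W"
  using hs_comb[of s W s f "\<lambda>_. 0"] by simp

text \<open>Coordinates with respect to a frame are holomorphic because they are given by Cramer's rule
  in every chart.\<close>

lemma frame2_coords:
  assumes fr: "frame2 U a b" and s: "s \<in> hs U"
  obtains f g where "f holomorphic_on U" "g holomorphic_on U"
    "\<And>z. z \<in> U \<Longrightarrow> s z = f z \<odot> a z + g z \<odot> b z"
proof -
  note fr' = frame2D[OF fr]
  have "\<exists>c d. s z = c \<odot> a z + d \<odot> b z" if "z \<in> U" for z
    using fib_basis[of "a z" z "b z" "s z"] hs_fib fr' s that by metis
  then obtain f g where fg: "\<And>z. z \<in> U \<Longrightarrow> s z = f z \<odot> a z + g z \<odot> b z" by metis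
  have loc: "\<exists>V f' g'. open V \<and> z \<in> V \<and> f' holomorphic_on V \<and> g' holomorphic_on V \<and>
      (\<forall>x\<in>V. f x = f' x \<and> g x = g' x)" if z: "z \<in> U" for z
  proof -
    obtain W e where W: "(W, e) \<in> frames T" "z \<in> W" by (rule chart_exists)
    obtain p1 q1 where 1: "p1 holomorphic_on W \<inter> U" "q1 holomorphic_on W \<inter> U"
      "\<And>z. z \<in> W \<inter> U \<Longrightarrow> a z = p1 z \<odot> e 0 z + q1 z \<odot> e 1 z" using hs_chart[OF fr'(2) W(1)] by metis
    obtain p2 q2 where 2: "p2 holomorphic_on W \<inter> U" "q2 holomorphic_on W \<inter> U"
      "\<And>z. z \<in> W \<inter> U \<Longrightarrow> b z = p2 z \<odot> e 0 z + q2 z \<odot> e 1 z" using hs_chart[OF fr'(3) W(1)] by metis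
    obtain p3 q3 where 3: "p3 holomorphic_on W \<inter> U" "q3 holomorphic_on W \<inter> U"
      "\<And>z. z \<in> W \<inter> U \<Longrightarrow> s z = p3 z \<odot> e 0 z + q3 z \<odot> e 1 z" using hs_chart[OF s W(1)] by metis
    define \<delta> where "\<delta> = (\<lambda>z. p1 z * q2 z - p2 z * q1 z)"
    have \<delta>: "\<delta> x \<noteq> 0" if "x \<in> W \<inter> U" for x
      using V.indep2_det fr'(4)[of x] 1(3)[OF that] 2(3)[OF that] that unfolding \<delta>_def by auto
    define f' g' where "f' = (\<lambda>z. (p3 z * q2 z - p2 z * q3 z) / \<delta> z)"
      and "g' = (\<lambda>z. (p1 z * q3 z - p3 z * q1 z) / \<delta> z)"
    have "f' holomorphic_on W \<inter> U" "g' holomorphic_on W \<inter> U"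
      unfolding f'_def g'_def using 1 2 3 \<delta> by (auto intro!: holomorphic_intros simp: \<delta>_def)
    moreover have "f x = f' x \<and> g x = g' x" if x: "x \<in> W \<inter> U" for x
    proof -
      have "s x = f' x \<odot> a x + g' x \<odot> b x"
        using 1(3)[OF x] 2(3)[OF x] 3(3)[OF x] V.cramer[OF \<delta>[OF x, unfolded \<delta>_def]]
        by (simp add: f'_def g'_def \<delta>_def)
      then show ?thesis using fg[of x] V.indep2D[OF fr'(4)[of x]] x by (metis IntD2)
    qed
    moreover have "open (W \<inter> U)" using chart_frame(1)[OF W(1)] fr'(1) by (auto simp: frame2_def)
    ultimately show ?thesis using z W(2) by blast
  qed
  have "f holomorphic_on U" "g holomorphic_on U"
    by (rule holomorphic_on_locally, meson loc)+
  then show ?thesis using fg that by blast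
qed

text \<open>Local coordinates in a chart are unique, so they fit together.\<close>

lemma hs_local:
  assumes W: "open W" and loc: "\<And>z. z \<in> W \<Longrightarrow> \<exists>V. open V \<and> z \<in> V \<and> s \<in> hs V"
  shows "s \<in> hs W"
proof (rule hsI)
  show "s z \<in> fib T z" if "z \<in> W" for z using loc[OF that] hs_fib by blast
next
  fix U e assume U: "(U, e) \<in> frames T"
  note fr = chart_frame[OF U]
  have "\<exists>c d. s z = c \<odot> e 0 z + d \<odot> e 1 z" if "z \<in> U \<inter> W" for z
    using loc[of z] hs_fib fr(2)[of z] that by blast
  then obtain f g where fg: "\<And>z. z \<in> U \<inter> W \<Longrightarrow> s z = f z \<odot> e 0 z + g z \<odot> e 1 z" by metis
  have loc': "\<exists>V f' g'. open V \<and> z \<in> V \<and> f' holomorphic_on V \<and> g' holomorphic_on V \<and>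
      (\<forall>x\<in>V. f x = f' x \<and> g x = g' x)" if z: "z \<in> U \<inter> W" for z
  proof -
    obtain V where V: "open V" "z \<in> V" "s \<in> hs V" using loc z by blast
    obtain f' g' where f': "f' holomorphic_on U \<inter> V" "g' holomorphic_on U \<inter> V"
      "\<And>z. z \<in> U \<inter> V \<Longrightarrow> s z = f' z \<odot> e 0 z + g' z \<odot> e 1 z" using hs_chart[OF V(3) U] by metis
    have "f x = f' x \<and> g x = g' x" if x: "x \<in> U \<inter> V \<inter> W" for x
    proof -
      have "f x \<odot> e 0 x + g x \<odot> e 1 x = f' x \<odot> e 0 x + g' x \<odot> e 1 x"
        using f'(3)[of x] fg[of x] x by auto
      then show ?thesis using V.indep2D frame2D(4)[OF fr(1), of x] x by blast
    qed
    moreover have "f' holomorphic_on U \<inter> V \<inter> W" "g' holomorphic_on U \<inter> V \<inter> W"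
      using f' by (auto intro: holomorphic_on_subset)
    ultimately show ?thesis using V z frame2D(1)[OF fr(1)] W
      by (intro exI[of _ "U \<inter> V \<inter> W"] exI[of _ f'] exI[of _ g']) auto
  qed
  have "f holomorphic_on U \<inter> W" "g holomorphic_on U \<inter> W"
    by (rule holomorphic_on_locally, meson loc')+
  then show "\<exists>f g. f holomorphic_on U \<inter> W \<and> g holomorphic_on U \<inter> W \<and>
       (\<forall>z\<in>U \<inter> W. s z = f z \<odot> e 0 z + g z \<odot> e 1 z)" using fg by blast
qed

section \<open>The connection\<close>

text \<open>The Euler derivative \<open>\<nabla>\<^sub>z\<^sub>\<partial>\<^sub>z\<close>; the operator of elementary sections and of the logarithmic
condition.\<close>

definition theta :: "(complex \<Rightarrow> 'v) \<Rightarrow> complex \<Rightarrow> 'v" where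
  "theta s z = z \<odot> nabla T s z"

context
  fixes U :: "complex set"
  assumes U: "open U" "0 \<notin> U"
begin

lemma connection_on:
  shows nabla_hs: "s \<in> hs U \<Longrightarrow> nabla T s \<in> hs U"
    and nabla_cong_all: "s \<in> hs U \<Longrightarrow> \<forall>z\<in>U. s z = t z \<Longrightarrow> \<forall>z\<in>U. nabla T s z = nabla T t z"
    and nabla_add: "s \<in> hs U \<Longrightarrow> t \<in> hs U \<Longrightarrow> z \<in> U \<Longrightarrow>
      nabla T (\<lambda>x. s x + t x) z = nabla T s z + nabla T t z"
    and nabla_scale: "s \<in> hs U \<Longrightarrow> f holomorphic_on U \<Longrightarrow> z \<in> U \<Longrightarrow>
      nabla T (\<lambda>x. f x \<odot> s x) z = deriv f z \<odot> s z + f z \<odot> nabla T s z"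
proof -
  note c = is_connection[unfolded holomorphic_connection_def, rule_format, OF conjI, OF U]
  show "s \<in> hs U \<Longrightarrow> nabla T s \<in> hs U" using conjunct1[OF c] by (rule bspec)
  note c = conjunct2[OF c]
  show "s \<in> hs U \<Longrightarrow> \<forall>z\<in>U. s z = t z \<Longrightarrow> \<forall>z\<in>U. nabla T s z = nabla T t z"
    using bspec[OF conjunct1[OF c], of s] by simp
  note c = conjunct2[OF c]
  show "s \<in> hs U \<Longrightarrow> t \<in> hs U \<Longrightarrow> z \<in> U \<Longrightarrow>
      nabla T (\<lambda>x. s x + t x) z = nabla T s z + nabla T t z"
    using bspec[OF conjunct1[OF c], of s] by simp
  note c = conjunct2[OF c]
  show "s \<in> hs U \<Longrightarrow> f holomorphic_on U \<Longrightarrow> z \<in> U \<Longrightarrow>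
      nabla T (\<lambda>x. f x \<odot> s x) z = deriv f z \<odot> s z + f z \<odot> nabla T s z"
    using bspec[OF c, of s] by simp
qed

lemma nabla_cong:
  assumes "s \<in> hs U" "\<And>z. z \<in> U \<Longrightarrow> s z = t z" "z \<in> U"
  shows "nabla T s z = nabla T t z"
  using nabla_cong_all[of s t] assms by simp

lemma nabla_comb:
  assumes s: "s \<in> hs U" and t: "t \<in> hs U"
    and f: "f holomorphic_on U" and g: "g holomorphic_on U" and z: "z \<in> U"
  shows "nabla T (\<lambda>x. f x \<odot> s x + g x \<odot> t x) z =
     deriv f z \<odot> s z + f z \<odot> nabla T s z + (deriv g z \<odot> t z + g z \<odot> nabla T t z)"
  using nabla_add[OF hs_scale[OF s f] hs_scale[OF t g] z] nabla_scale[OF s f z] nabla_scale[OF t g z]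
  by simp

lemma theta_cong:
  assumes "s \<in> hs U" "\<And>z. z \<in> U \<Longrightarrow> s z = t z" "z \<in> U"
  shows "theta s z = theta t z"
  using nabla_cong[OF assms] by (simp add: theta_def)

lemma theta_comb:
  assumes s: "s \<in> hs U" and t: "t \<in> hs U"
    and f: "f holomorphic_on U" and g: "g holomorphic_on U" and z: "z \<in> U"
  shows "theta (\<lambda>x. f x \<odot> s x + g x \<odot> t x) z =
     (z * deriv f z) \<odot> s z + f z \<odot> theta s z + ((z * deriv g z) \<odot> t z + g z \<odot> theta t z)"
  unfolding theta_def nabla_comb[OF assms]
  by (simp add: V.vs.scale_right_distrib mult.commute)

text \<open>The Leibniz rule, written in a frame with connection matrix \<open>((p1, p2), (q1, q2))\<close>.\<close>

lemma theta_comb_in_frame: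
  assumes s: "s \<in> hs U" and t: "t \<in> hs U"
    and f: "f holomorphic_on U" and g: "g holomorphic_on U" and z: "z \<in> U"
    and s': "theta s z = p1 \<odot> s z + q1 \<odot> t z" and t': "theta t z = p2 \<odot> s z + q2 \<odot> t z"
  shows "theta (\<lambda>x. f x \<odot> s x + g x \<odot> t x) z =
     (z * deriv f z + p1 * f z + p2 * g z) \<odot> s z + (z * deriv g z + q1 * f z + q2 * g z) \<odot> t z"
  unfolding theta_comb[OF s t f g z] s' t'
  by (simp add: V.vs.scale_right_distrib V.vs.scale_left_distrib mult_ac add_ac)

end

end

section \<open>Flat multivalued sections\<close>

definition log_branch :: "complex \<Rightarrow> complex \<Rightarrow> complex" where
  "log_branch p z = p + Ln (z / exp p)"

definition log_domain :: "complex \<Rightarrow> complex set" where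
  "log_domain p = {z. z / exp p \<notin> \<real>\<^sub>\<le>\<^sub>0}"

lemma log_branch:
  shows "open (log_domain p)" "exp p \<in> log_domain p" "0 \<notin> log_domain p"
    and "log_branch p holomorphic_on log_domain p" "log_branch p (exp p) = p"
    and "z \<in> log_domain p \<Longrightarrow> exp (log_branch p z) = z"
    and "z \<in> log_domain p \<Longrightarrow> (log_branch p has_field_derivative 1 / z) (at z)"
proof -
  have "log_domain p = (\<lambda>z. z / exp p) -` (- \<real>\<^sub>\<le>\<^sub>0)" by (auto simp: log_domain_def)
  moreover have "open ((\<lambda>z. z / exp p) -` (- \<real>\<^sub>\<le>\<^sub>0))"
    by (rule open_vimage) (auto intro!: continuous_intros)
  ultimately show "open (log_domain p)" by simp
  show "exp p \<in> log_domain p" "0 \<notin> log_domain p" by (auto simp: log_domain_def)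
  show "log_branch p holomorphic_on log_domain p"
    unfolding log_branch_def by (intro holomorphic_intros) (auto simp: log_domain_def)
  show "log_branch p (exp p) = p" by (simp add: log_branch_def)
  show "exp (log_branch p z) = z" if "z \<in> log_domain p"
  proof -
    have "z \<noteq> 0" using that by (auto simp: log_domain_def)
    then show ?thesis by (simp add: log_branch_def exp_add)
  qed
  show "(log_branch p has_field_derivative 1 / z) (at z)" if z: "z \<in> log_domain p"
  proof -
    have "z / exp p \<notin> \<real>\<^sub>\<le>\<^sub>0" using z by (simp add: log_domain_def)
    then show ?thesis unfolding log_branch_def
      by (auto intro!: derivative_eq_intros simp: field_simps)
  qed
qed

lemma open_image_exp: "open W \<Longrightarrow> open (exp ` W)" for W :: "complex set"
proof (rule open_mapping_thm[of exp UNIV])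
  have "exp (0::complex) \<noteq> exp (of_real pi * \<i>)" by simp
  then show "\<not> exp constant_on (UNIV :: complex set)" unfolding constant_on_def by (metis UNIV_I)
qed (auto intro: holomorphic_intros)

context te_rank2
begin

sublocale F: complex_vector_space "fscl T"
  by unfold_locales
    (auto simp: fscl_def fun_eq_iff V.vs.scale_right_distrib V.vs.scale_left_distrib)

lemma zero_hs: "(\<lambda>z. 0) \<in> hs W"
proof (rule hsI)
  fix z
  obtain U e where U: "(U, e) \<in> frames T" "z \<in> U" by (rule chart_exists)
  have "0 = 0 \<odot> e 0 z + 0 \<odot> e 1 z" by simp
  then show "0 \<in> fib T z" unfolding chart_frame(2)[OF U] by blast
next
  fix U e
  show "\<exists>f g. f holomorphic_on U \<inter> W \<and> g holomorphic_on U \<inter> W \<and>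
       (\<forall>z\<in>U \<inter> W. 0 = f z \<odot> e 0 z + g z \<odot> e 1 z)"
    by (intro exI[of _ "\<lambda>_. 0"]) auto
qed

lemma flat_mv_def': "A \<in> flat_mv T \<longleftrightarrow> (\<forall>w0. \<exists>W t. open W \<and> w0 \<in> W \<and> t \<in> hs (exp ` W) \<and>
          (\<forall>z\<in>exp ` W. nabla T t z = 0) \<and> (\<forall>w\<in>W. A w = t (exp w)))"
  by (simp add: flat_mv_def)

lemma flat_mvI:
  assumes "\<And>w0. \<exists>W t. open W \<and> w0 \<in> W \<and> t \<in> hs (exp ` W) \<and>
          (\<forall>z\<in>exp ` W. nabla T t z = 0) \<and> (\<forall>w\<in>W. A w = t (exp w))"
  shows "A \<in> flat_mv T"
  unfolding flat_mv_def' using assms by simp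

lemma flat_mvE:
  assumes "A \<in> flat_mv T"
  obtains W t where "open W" "p \<in> W" "t \<in> hs (exp ` W)"
    "\<And>z. z \<in> exp ` W \<Longrightarrow> nabla T t z = 0" "\<And>w. w \<in> W \<Longrightarrow> A w = t (exp w)"
proof -
  obtain W t where "open W \<and> p \<in> W \<and> t \<in> hs (exp ` W) \<and>
          (\<forall>z\<in>exp ` W. nabla T t z = 0) \<and> (\<forall>w\<in>W. A w = t (exp w))"
    using assms[unfolded flat_mv_def', THEN spec, of p] by (elim exE)
  then show ?thesis using that[of W t] by blast
qed

lemma flat_mv_comb:
  assumes A: "A \<in> flat_mv T" and B: "B \<in> flat_mv T"
  shows "fscl T c A + fscl T d B \<in> flat_mv T"
proof (rule flat_mvI)
  fix w0
  obtain W1 t1 where 1: "open W1" "w0 \<in> W1" "t1 \<in> hs (exp ` W1)"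
    "\<And>z. z \<in> exp ` W1 \<Longrightarrow> nabla T t1 z = 0" "\<And>w. w \<in> W1 \<Longrightarrow> A w = t1 (exp w)"
    using flat_mvE[OF A, where p = w0] by metis
  obtain W2 t2 where 2: "open W2" "w0 \<in> W2" "t2 \<in> hs (exp ` W2)"
    "\<And>z. z \<in> exp ` W2 \<Longrightarrow> nabla T t2 z = 0" "\<And>w. w \<in> W2 \<Longrightarrow> B w = t2 (exp w)"
    using flat_mvE[OF B, where p = w0] by metis
  define W where "W = W1 \<inter> W2"
  have W: "open W" "w0 \<in> W" using 1 2 by (auto simp: W_def)
  have E: "open (exp ` W)" "0 \<notin> exp ` W" by (rule open_image_exp[OF W(1)], simp add: image_iff)
  have t: "t1 \<in> hs (exp ` W)" "t2 \<in> hs (exp ` W)"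
    using 1 2 by (auto simp: W_def intro: hs_mono)
  define t where "t = (\<lambda>z. c \<odot> t1 z + d \<odot> t2 z)"
  have "t \<in> hs (exp ` W)" unfolding t_def by (rule hs_comb[OF t]) auto
  moreover have "nabla T t z = 0" if "z \<in> exp ` W" for z
    unfolding t_def using nabla_comb[OF E t, of "\<lambda>_. c" "\<lambda>_. d" z] that 1(4)[of z] 2(4)[of z]
    by (auto simp: W_def)
  moreover have "(fscl T c A + fscl T d B) w = t (exp w)" if "w \<in> W" for w
    using that 1(5) 2(5) by (auto simp: W_def t_def fscl_def)
  ultimately show "\<exists>W t. open W \<and> w0 \<in> W \<and> t \<in> hs (exp ` W) \<and>
          (\<forall>z\<in>exp ` W. nabla T t z = 0) \<and> (\<forall>w\<in>W. (fscl T c A + fscl T d B) w = t (exp w))"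
    using W by blast
qed

lemma flat_mv_zero: "0 \<in> flat_mv T"
proof (rule flat_mvI)
  fix w0 :: complex
  have "open (exp ` (UNIV::complex set))" "0 \<notin> exp ` (UNIV::complex set)"
    by (rule open_image_exp[OF open_UNIV], simp add: image_iff)
  from nabla_scale[OF this zero_hs, of "\<lambda>_. 0"]
  show "\<exists>W t. open W \<and> w0 \<in> W \<and> t \<in> hs (exp ` W) \<and>
          (\<forall>z\<in>exp ` W. nabla T t z = 0) \<and> (\<forall>w\<in>W. 0 w = t (exp w))"
    by (intro exI[of _ UNIV] exI[of _ "\<lambda>_. 0"]) (auto simp: zero_hs)
qed

lemma flat_mv_subspace: "F.vs.subspace (flat_mv T)"
  unfolding F.vs.subspace_def
proof (intro conjI ballI allI flat_mv_zero)
  fix A B assume AB: "A \<in> flat_mv T" "B \<in> flat_mv T"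
  show "A + B \<in> flat_mv T" using flat_mv_comb[OF AB, of 1 1] by simp
next
  fix c A assume "A \<in> flat_mv T"
  then show "fscl T c A \<in> flat_mv T" using flat_mv_comb[of A A c 0] by simp
qed

lemma Mmon_endo: "endo_on (fscl T) (flat_mv T) Mmon"
proof -
  have "Mmon A \<in> flat_mv T" if A: "A \<in> flat_mv T" for A
  proof (rule flat_mvI)
    fix w0 :: complex
    let ?p = "2 * of_real pi * \<i> :: complex"
    obtain W t where 1: "open W" "w0 + ?p \<in> W" "t \<in> hs (exp ` W)"
      "\<And>z. z \<in> exp ` W \<Longrightarrow> nabla T t z = 0" "\<And>w. w \<in> W \<Longrightarrow> A w = t (exp w)"
      using flat_mvE[OF A, where p = "w0 + ?p"] by metis
    define W' where "W' = (\<lambda>w. w + ?p) -` W"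
    have e: "exp w = exp (w + ?p)" for w by (simp add: exp_add)
    have "exp ` W' \<subseteq> exp ` W" unfolding W'_def using e by auto
    moreover have "open W'" unfolding W'_def
      by (rule open_vimage[OF 1(1)]) (auto intro!: continuous_intros)
    moreover have "Mmon A w = t (exp w)" if "w \<in> W'" for w
      using 1(5)[of "w + ?p"] that e[of w] by (auto simp: W'_def Mmon_def)
    moreover have "w0 \<in> W'" using 1 by (simp add: W'_def)
    ultimately show "\<exists>W t. open W \<and> w0 \<in> W \<and> t \<in> hs (exp ` W) \<and>
          (\<forall>z\<in>exp ` W. nabla T t z = 0) \<and> (\<forall>w\<in>W. Mmon A w = t (exp w))"
      using 1(3,4) hs_mono by (intro exI[of _ W'] exI[of _ t]) blast
  qed
  then show ?thesis unfolding endo_on_def by (auto simp: Mmon_def fscl_def fun_eq_iff)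
qed

lemma Mmon_injective: "Mmon A = 0 \<Longrightarrow> A = (0 :: complex \<Rightarrow> 'v)"
proof
  fix w assume "Mmon A = (0 :: complex \<Rightarrow> 'v)"
  then have "Mmon A (w - 2 * of_real pi * \<i>) = 0" by simp
  then show "A w = 0 w" by (simp add: Mmon_def)
qed

lemma flat_section_zero_near:
  assumes Z: "open Z" "0 \<notin> Z" "z0 \<in> Z" and t: "t \<in> hs Z" "\<And>z. z \<in> Z \<Longrightarrow> nabla T t z = 0"
    and init: "t z0 = 0"
  shows "\<forall>\<^sub>F z in nhds z0. t z = 0"
proof -
  obtain U e where U: "(U, e) \<in> frames T" "z0 \<in> U" by (rule chart_exists)
  define Y where "Y = U \<inter> Z"
  have Y: "open Y" "0 \<notin> Y" "z0 \<in> Y"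
    using Z U frame2D(1)[OF chart_frame(1)[OF U(1)]] by (auto simp: Y_def)
  have fr: "frame2 Y (e 0) (e 1)"
    by (rule frame2_mono[OF chart_frame(1)[OF U(1)] _ Y(1)]) (auto simp: Y_def)
  note fr' = frame2D[OF fr]
  obtain f g where fg: "f holomorphic_on Y" "g holomorphic_on Y"
    "\<And>z. z \<in> Y \<Longrightarrow> t z = f z \<odot> e 0 z + g z \<odot> e 1 z"
    using frame2_coords[OF fr, of t] hs_mono[OF t(1), of Y] by (auto simp: Y_def)
  obtain a c where ac: "a holomorphic_on Y" "c holomorphic_on Y"
    "\<And>z. z \<in> Y \<Longrightarrow> nabla T (e 0) z = a z \<odot> e 0 z + c z \<odot> e 1 z"
    using frame2_coords[OF fr nabla_hs[OF Y(1,2) fr'(2)]] by metis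
  obtain b d where bd: "b holomorphic_on Y" "d holomorphic_on Y"
    "\<And>z. z \<in> Y \<Longrightarrow> nabla T (e 1) z = b z \<odot> e 0 z + d z \<odot> e 1 z"
    using frame2_coords[OF fr nabla_hs[OF Y(1,2) fr'(3)]] by metis
  have ode: "deriv f z = (- a z) * f z + (- b z) * g z \<and> deriv g z = (- c z) * f z + (- d z) * g z"
    if z: "z \<in> Y" for z
  proof -
    have "nabla T t z = nabla T (\<lambda>x. f x \<odot> e 0 x + g x \<odot> e 1 x) z"
      using Y z fg(3) hs_mono[OF t(1), of Y] by (intro nabla_cong) (auto simp: Y_def)
    also have "\<dots> = deriv f z \<odot> e 0 z + f z \<odot> nabla T (e 0) z + (deriv g z \<odot> e 1 z + g z \<odot> nabla T (e 1) z)"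
      by (rule nabla_comb[OF Y(1,2) fr'(2,3) fg(1,2) z])
    also have "\<dots> = (deriv f z + (a z * f z + b z * g z)) \<odot> e 0 z + (deriv g z + (c z * f z + d z * g z)) \<odot> e 1 z"
      unfolding ac(3)[OF z] bd(3)[OF z]
      by (simp add: V.vs.scale_right_distrib V.vs.scale_left_distrib mult_ac add_ac)
    finally have "(deriv f z + (a z * f z + b z * g z)) \<odot> e 0 z + (deriv g z + (c z * f z + d z * g z)) \<odot> e 1 z = 0"
      using t(2) z by (simp add: Y_def)
    then have "deriv f z + (a z * f z + b z * g z) = 0" "deriv g z + (c z * f z + d z * g z) = 0"
      using fr'(4)[OF z] unfolding V.indep2_def by blast+
    then show ?thesis by (simp add: eq_neg_iff_add_eq_0 algebra_simps)
  qed
  have "f z0 = 0 \<and> g z0 = 0"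
    using fg(3)[OF Y(3)] init fr'(4)[OF Y(3)] unfolding V.indep2_def by metis
  moreover have "continuous_on Y h" if "h holomorphic_on Y" for h
    using that by (rule holomorphic_on_imp_continuous_on)
  ultimately have "\<forall>\<^sub>F z in nhds z0. f z = 0 \<and> g z = 0"
    using ode by (intro linear_system_unique_zero[OF Y(1,3) fg(1,2), of "\<lambda>z. - a z" "\<lambda>z. - b z" "\<lambda>z. - c z" "\<lambda>z. - d z"])
      (auto intro!: continuous_intros simp: ac bd)
  moreover have "\<forall>\<^sub>F z in nhds z0. z \<in> Y" using Y by (simp add: eventually_nhds_in_open)
  ultimately show ?thesis by eventually_elim (simp add: fg(3))
qed

lemma section_nonzero_near:
  assumes Z: "open Z" "z0 \<in> Z" and t: "t \<in> hs Z" "t z0 \<noteq> 0"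
  shows "\<forall>\<^sub>F z in nhds z0. t z \<noteq> 0"
proof -
  obtain U e where U: "(U, e) \<in> frames T" "z0 \<in> U" by (rule chart_exists)
  define Y where "Y = U \<inter> Z"
  have fr: "frame2 U (e 0) (e 1)" by (rule chart_frame(1)[OF U(1)])
  have Y: "open Y" "z0 \<in> Y" using Z U frame2D(1)[OF fr] by (auto simp: Y_def)
  obtain f g where fg: "f holomorphic_on Y" "g holomorphic_on Y"
    "\<And>z. z \<in> Y \<Longrightarrow> t z = f z \<odot> e 0 z + g z \<odot> e 1 z"
    using frame2_coords[OF frame2_mono[OF fr, of Y], of t] hs_mono[OF t(1), of Y] Y by (auto simp: Y_def)
  have nz: "t z \<noteq> 0 \<longleftrightarrow> f z \<noteq> 0 \<or> g z \<noteq> 0" if "z \<in> Y" for z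
    using frame2D(4)[OF fr, of z] that fg(3)[OF that] unfolding Y_def V.indep2_def
    by (metis IntD1 V.vs.scale_zero_left add.left_neutral)
  have cont: "isCont f z0" "isCont g z0"
    using fg Y holomorphic_on_imp_continuous_on continuous_on_interior
    by (metis interior_open)+
  have "\<forall>\<^sub>F z in nhds z0. z \<in> Y \<and> (f z \<noteq> 0 \<or> g z \<noteq> 0)"
  proof (cases "f z0 \<noteq> 0")
    case True
    then have "\<forall>\<^sub>F z in nhds z0. f z \<noteq> 0"
      using cont(1) tendsto_imp_eventually_ne[of f "f z0" "nhds z0" 0]
      by (simp add: isCont_def tendsto_at_iff_tendsto_nhds)
    moreover have "\<forall>\<^sub>F z in nhds z0. z \<in> Y" using Y by (simp add: eventually_nhds_in_open)
    ultimately show ?thesis by eventually_elim auto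
  next
    case False
    then have "g z0 \<noteq> 0" using nz Y t by auto
    then have "\<forall>\<^sub>F z in nhds z0. g z \<noteq> 0"
      using cont(2) tendsto_imp_eventually_ne[of g "g z0" "nhds z0" 0]
      by (simp add: isCont_def tendsto_at_iff_tendsto_nhds)
    moreover have "\<forall>\<^sub>F z in nhds z0. z \<in> Y" using Y by (simp add: eventually_nhds_in_open)
    ultimately show ?thesis by eventually_elim auto
  qed
  then show ?thesis by eventually_elim (simp add: nz)
qed

text \<open>The zeros of a flat section form an open set by uniqueness for the linear system, and a
closed set by continuity.\<close>

lemma flat_mv_eq_0:
  assumes A: "A \<in> flat_mv T" and 0: "A w1 = 0"
  shows "A = 0"
proof -
  have loc: "\<exists>W Z t. open W \<and> w0 \<in> W \<and> open Z \<and> 0 \<notin> Z \<and> exp w0 \<in> Z \<and> t \<in> hs Z \<and>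
     (\<forall>z\<in>Z. nabla T t z = 0) \<and> (\<forall>w\<in>W. A w = t (exp w))" for w0
  proof -
    obtain W t where W: "open W" "w0 \<in> W" "t \<in> hs (exp ` W)"
      "\<And>z. z \<in> exp ` W \<Longrightarrow> nabla T t z = 0" "\<And>w. w \<in> W \<Longrightarrow> A w = t (exp w)"
      using flat_mvE[OF A, where p = w0] by metis
    then show ?thesis using open_image_exp[OF W(1)]
      by (intro exI[of _ W] exI[of _ "exp ` W"] exI[of _ t]) auto
  qed
  have ex: "((exp :: complex \<Rightarrow> complex) \<longlongrightarrow> exp w0) (nhds w0)" for w0
    by (rule tendsto_exp) (rule filterlim_ident)
  have op: "\<forall>\<^sub>F w in nhds w0. A w = 0" if Aw: "A w0 = 0" for w0
  proof -
    obtain W Z t where 1: "open W" "w0 \<in> W" "open Z" "0 \<notin> Z" "exp w0 \<in> Z" "t \<in> hs Z"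
     "\<And>z. z \<in> Z \<Longrightarrow> nabla T t z = 0" "\<And>w. w \<in> W \<Longrightarrow> A w = t (exp w)" using loc by metis
    have "\<forall>\<^sub>F z in nhds (exp w0). t z = 0"
      using flat_section_zero_near[OF 1(3,4,5,6,7)] 1(8)[OF 1(2)] Aw by simp
    then have "\<forall>\<^sub>F w in nhds w0. t (exp w) = 0" using ex by (rule eventually_compose_filterlim)
    moreover have "\<forall>\<^sub>F w in nhds w0. w \<in> W" using 1 by (simp add: eventually_nhds_in_open)
    ultimately show ?thesis by eventually_elim (simp add: 1(8))
  qed
  have cl: "\<forall>\<^sub>F w in nhds w0. A w \<noteq> 0" if Aw: "A w0 \<noteq> 0" for w0
  proof -
    obtain W Z t where 1: "open W" "w0 \<in> W" "open Z" "0 \<notin> Z" "exp w0 \<in> Z" "t \<in> hs Z"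
     "\<And>z. z \<in> Z \<Longrightarrow> nabla T t z = 0" "\<And>w. w \<in> W \<Longrightarrow> A w = t (exp w)" using loc by metis
    have "\<forall>\<^sub>F z in nhds (exp w0). t z \<noteq> 0"
      using section_nonzero_near[OF 1(3,5,6)] 1(8)[OF 1(2)] Aw by simp
    then have "\<forall>\<^sub>F w in nhds w0. t (exp w) \<noteq> 0" using ex by (rule eventually_compose_filterlim)
    moreover have "\<forall>\<^sub>F w in nhds w0. w \<in> W" using 1 by (simp add: eventually_nhds_in_open)
    ultimately show ?thesis by eventually_elim (simp add: 1(8))
  qed
  have "open {w. A w = 0}" "open {w. A w \<noteq> 0}"
    using op cl by (subst open_subopen; force simp: eventually_nhds)+
  then have "{w. A w = 0} = {} \<or> {w. A w = 0} = UNIV"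
    by (intro clopen[THEN iffD1]) (auto simp: closed_def Collect_neg_eq)
  then show ?thesis using 0 by (auto simp: fun_eq_iff)
qed

lemma flat_mv_indep:
  assumes A: "A \<in> flat_mv T" and B: "B \<in> flat_mv T" and ind: "F.indep2 A B"
  shows "V.indep2 (A w) (B w)"
  unfolding V.indep2_def
proof (intro allI impI)
  fix c d assume "c \<odot> A w + d \<odot> B w = 0"
  then have "fscl T c A + fscl T d B = 0"
    using flat_mv_eq_0[OF flat_mv_comb[OF A B], of c d w] by (simp add: fscl_def)
  then show "c = 0 \<and> d = 0" using ind unfolding F.indep2_def by blast
qed

lemma flat_mv_fib:
  assumes A: "A \<in> flat_mv T" shows "A w \<in> fib T (exp w)"
proof -
  obtain W t where W: "open W" "w \<in> W" "t \<in> hs (exp ` W)"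
      "\<And>z. z \<in> exp ` W \<Longrightarrow> nabla T t z = 0" "\<And>w. w \<in> W \<Longrightarrow> A w = t (exp w)"
    using flat_mvE[OF A, where p = w] by metis
  then show ?thesis using hs_fib[OF W(3), of "exp w"] by simp
qed

text \<open>Evaluation at a point is injective on flat sections, and the fibre has dimension two.\<close>

lemma flat_mv_two_dim: "F.two_dim (flat_mv T)"
  unfolding F.two_dim_def
proof (intro conjI flat_mv_subspace ballI impI)
  fix A B C assume A: "A \<in> flat_mv T" and B: "B \<in> flat_mv T" and ind: "F.indep2 A B"
    and C: "C \<in> flat_mv T"
  obtain c d where cd: "C 0 = c \<odot> A 0 + d \<odot> B 0"
    using fib_basis flat_mv_indep[OF A B ind] flat_mv_fib A B C by metis
  define D where "D = fscl T c A + fscl T d B"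
  have D: "D \<in> flat_mv T" unfolding D_def by (rule flat_mv_comb[OF A B])
  have "fscl T 1 C + fscl T (-1) D = 0"
    by (rule flat_mv_eq_0[OF flat_mv_comb[OF C D], of _ _ 0]) (simp add: cd D_def fscl_def)
  then have "C = D" by simp
  then show "\<exists>c d. C = fscl T c A + fscl T d B" by (auto simp: D_def)
qed

section \<open>Elementary frames on the punctured plane\<close>

text \<open>A section on the universal cover with period \<open>2 \<pi> \<i>\<close>, as a section on the punctured
plane; the principal branch of the logarithm is as good as any other by periodicity.\<close>

definition descend :: "(complex \<Rightarrow> 'v) \<Rightarrow> complex \<Rightarrow> 'v" where
  "descend B z = (if z = 0 then 0 else B (Ln z))"

lemma descend_exp:
  assumes per: "Mmon B = B" shows "descend B (exp w) = B w"
proof -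
  have p1: "B (w + 2 * of_real pi * \<i>) = B w" for w using fun_cong[OF per, of w] by (simp add: Mmon_def)
  have pn: "B (w + of_nat n * (2 * of_real pi * \<i>)) = B w" for n w
  proof (induction n)
    case (Suc n)
    then show ?case using p1[of "w + of_nat n * (2 * of_real pi * \<i>)"] by (simp add: algebra_simps)
  qed simp
  have pk: "B (w + of_int k * (2 * of_real pi * \<i>)) = B w" for k w
  proof (cases k)
    case (nonneg n)
    then show ?thesis using pn by simp
  next
    case (neg n)
    then have "(of_int k + of_nat (Suc n) :: complex) = 0" by simp
    then have "w + of_int k * (2 * of_real pi * \<i>) + of_nat (Suc n) * (2 * of_real pi * \<i>) = w"
      by (metis add.assoc add.right_neutral distrib_right mult_zero_left)
    then show ?thesis using pn[of "w + of_int k * (2 * of_real pi * \<i>)" "Suc n"] by metis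
  qed
  have "exp (Ln (exp w)) = exp w" by simp
  then obtain k :: int where "Ln (exp w) = w + of_int (2 * k) * pi * \<i>" unfolding exp_eq by blast
  then show ?thesis using pk[of w k] by (simp add: descend_def mult_ac)
qed

lemma flat_mv_branch:
  assumes A: "A \<in> flat_mv T"
  obtains Z where "open Z" "exp w0 \<in> Z" "Z \<subseteq> log_domain w0"
    "(\<lambda>z. A (log_branch w0 z)) \<in> hs Z" "\<And>z. z \<in> Z \<Longrightarrow> nabla T (\<lambda>z. A (log_branch w0 z)) z = 0"
proof -
  obtain W t where W: "open W" "w0 \<in> W" "t \<in> hs (exp ` W)"
      "\<And>z. z \<in> exp ` W \<Longrightarrow> nabla T t z = 0" "\<And>w. w \<in> W \<Longrightarrow> A w = t (exp w)"
    using flat_mvE[OF A, where p = w0] by metis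
  define Z where "Z = log_domain w0 \<inter> log_branch w0 -` W"
  note br = log_branch[where p = w0]
  have Z: "open Z" "exp w0 \<in> Z" "Z \<subseteq> log_domain w0"
    using br W unfolding Z_def
    by (auto intro!: continuous_open_preimage holomorphic_on_imp_continuous_on)
  have sub: "Z \<subseteq> exp ` W"
  proof
    fix z assume "z \<in> Z"
    then have "z = exp (log_branch w0 z)" "log_branch w0 z \<in> W" using br by (auto simp: Z_def)
    then show "z \<in> exp ` W" by blast
  qed
  have eq: "t z = A (log_branch w0 z)" if "z \<in> Z" for z
    using that W(5) br(6) by (auto simp: Z_def)
  have t: "t \<in> hs Z" using hs_mono[OF W(3) sub] .
  have "0 \<notin> Z" using Z br by blast
  show ?thesis
  proof (rule that[OF Z])
    show "(\<lambda>z. A (log_branch w0 z)) \<in> hs Z" by (rule hs_cong[OF t eq])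
    show "nabla T (\<lambda>z. A (log_branch w0 z)) z = 0" if "z \<in> Z" for z
      using nabla_cong[OF Z(1) \<open>0 \<notin> Z\<close> t eq that] W(4) sub that by auto
  qed
qed

text \<open>The twist of a flat section by \<open>exp (\<alpha> w)\<close> is an eigensection of \<open>theta\<close>; the summand with
factor \<open>w\<close> produces the nilpotent part.\<close>

lemma descend_section:
  fixes \<alpha> \<kappa> :: complex
  assumes A: "A \<in> flat_mv T" and A': "A' \<in> flat_mv T"
    and B_def: "B = (\<lambda>w. exp (\<alpha> * w) \<odot> A w + (\<kappa> * w * exp (\<alpha> * w)) \<odot> A' w)"
    and per: "Mmon B = B"
  shows "descend B \<in> hs (- {0})" "theta (descend B) (exp w) = \<alpha> \<odot> B w + \<kappa> \<odot> exp (\<alpha> * w) \<odot> A' w"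
proof -
  have loc: "\<exists>Z. open Z \<and> exp w0 \<in> Z \<and> descend B \<in> hs Z \<and>
      theta (descend B) (exp w0) = \<alpha> \<odot> B w0 + \<kappa> \<odot> exp (\<alpha> * w0) \<odot> A' w0" for w0
  proof -
    note br = log_branch[where p = w0]
    define t t' where "t = (\<lambda>z. A (log_branch w0 z))" and "t' = (\<lambda>z. A' (log_branch w0 z))"
    obtain Z1 where 1: "open Z1" "exp w0 \<in> Z1" "Z1 \<subseteq> log_domain w0"
      "t \<in> hs Z1" "\<And>z. z \<in> Z1 \<Longrightarrow> nabla T t z = 0"
      unfolding t_def using flat_mv_branch[OF A] by metis
    obtain Z2 where 2: "open Z2" "exp w0 \<in> Z2" "Z2 \<subseteq> log_domain w0"
      "t' \<in> hs Z2" "\<And>z. z \<in> Z2 \<Longrightarrow> nabla T t' z = 0"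
      unfolding t'_def using flat_mv_branch[OF A'] by metis
    define Z where "Z = Z1 \<inter> Z2"
    have Z: "open Z" "exp w0 \<in> Z" "Z \<subseteq> log_domain w0" "0 \<notin> Z" using 1 2 br by (auto simp: Z_def)
    have t: "t \<in> hs Z" "t' \<in> hs Z" using 1 2 by (auto simp: Z_def intro: hs_mono)
    have n: "nabla T t z = 0" "nabla T t' z = 0" if "z \<in> Z" for z using 1 2 that by (auto simp: Z_def)
    define f g where "f = (\<lambda>z. exp (\<alpha> * log_branch w0 z))"
      and "g = (\<lambda>z. \<kappa> * log_branch w0 z * exp (\<alpha> * log_branch w0 z))"
    have hol: "f holomorphic_on Z" "g holomorphic_on Z"
      using br Z unfolding f_def g_def by (auto intro!: holomorphic_intros intro: holomorphic_on_subset)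
    have eq: "f z \<odot> t z + g z \<odot> t' z = descend B z" if "z \<in> Z" for z
    proof -
      have "descend B z = descend B (exp (log_branch w0 z))" using br(6)[of z] that Z by auto
      also have "\<dots> = B (log_branch w0 z)" by (rule descend_exp[OF per])
      finally show ?thesis by (simp add: B_def f_def g_def t_def t'_def)
    qed
    have s: "(\<lambda>z. f z \<odot> t z + g z \<odot> t' z) \<in> hs Z" by (rule hs_comb[OF t hol])
    have "theta (descend B) (exp w0) = theta (\<lambda>z. f z \<odot> t z + g z \<odot> t' z) (exp w0)"
      by (rule sym, rule theta_cong[OF Z(1,4) s eq Z(2)])
    also have "\<dots> = (exp w0 * deriv f (exp w0)) \<odot> t (exp w0) + (exp w0 * deriv g (exp w0)) \<odot> t' (exp w0)"
      using n Z(2) by (subst theta_comb[OF Z(1,4) t hol Z(2)]) (simp add: theta_def)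
    also have "exp w0 * deriv f (exp w0) = \<alpha> * exp (\<alpha> * w0)"
    proof -
      have "(f has_field_derivative \<alpha> * (1 / exp w0) * exp (\<alpha> * w0)) (at (exp w0))"
        unfolding f_def using br by (auto intro!: derivative_eq_intros br(7))
      then show ?thesis using DERIV_imp_deriv by fastforce
    qed
    also have "exp w0 * deriv g (exp w0) = \<kappa> * exp (\<alpha> * w0) + \<alpha> * (\<kappa> * w0 * exp (\<alpha> * w0))"
    proof -
      have "(g has_field_derivative \<kappa> * (1 / exp w0) * exp (\<alpha> * w0) + \<kappa> * w0 * (\<alpha> * (1 / exp w0) * exp (\<alpha> * w0)))
          (at (exp w0))"
        unfolding g_def using br by (auto intro!: derivative_eq_intros br(7))
      from DERIV_imp_deriv[OF this] show ?thesis by (simp add: field_simps)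
    qed
    also have "t (exp w0) = A w0" by (simp add: t_def br(5))
    also have "t' (exp w0) = A' w0" by (simp add: t'_def br(5))
    also have "(\<alpha> * exp (\<alpha> * w0)) \<odot> A w0 + (\<kappa> * exp (\<alpha> * w0) + \<alpha> * (\<kappa> * w0 * exp (\<alpha> * w0))) \<odot> A' w0
        = \<alpha> \<odot> B w0 + \<kappa> \<odot> exp (\<alpha> * w0) \<odot> A' w0"
      by (simp add: B_def V.vs.scale_right_distrib V.vs.scale_left_distrib add_ac)
    finally show ?thesis using Z hs_cong[OF s eq] by blast
  qed
  show "theta (descend B) (exp w) = \<alpha> \<odot> B w + \<kappa> \<odot> exp (\<alpha> * w) \<odot> A' w" using loc by blast
  show "descend B \<in> hs (- {0})"
  proof (rule hs_local)
    fix z :: complex assume "z \<in> - {0}"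
    then have "z = exp (Ln z)" by simp
    then show "\<exists>V. open V \<and> z \<in> V \<and> descend B \<in> hs V" using loc[of "Ln z"] by metis
  qed auto
qed

text \<open>A frame over the punctured plane in which \<open>theta\<close> is in Jordan form.  The last two conditions
normalise the exponents: each generalised eigenvalue of \<open>theta\<close> on the sections \<open>z\<^sup>k \<sigma>\<^sub>i\<close> then either
determines the index \<open>i\<close>, or occurs for both indices with the same \<open>k\<close>.\<close>

definition elem_frame :: "(complex \<Rightarrow> 'v) \<Rightarrow> (complex \<Rightarrow> 'v) \<Rightarrow> complex \<Rightarrow> complex \<Rightarrow> complex \<Rightarrow> bool" where
  "elem_frame \<sigma>1 \<sigma>2 \<alpha>1 \<alpha>2 c \<longleftrightarrow> frame2 (- {0}) \<sigma>1 \<sigma>2 \<and> \<sigma>1 0 = 0 \<and> \<sigma>2 0 = 0 \<and>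
     (\<forall>z. z \<noteq> 0 \<longrightarrow> theta \<sigma>1 z = \<alpha>1 \<odot> \<sigma>1 z) \<and>
     (\<forall>z. z \<noteq> 0 \<longrightarrow> theta \<sigma>2 z = \<alpha>2 \<odot> \<sigma>2 z + c \<odot> \<sigma>1 z) \<and>
     (c \<noteq> 0 \<longrightarrow> \<alpha>1 = \<alpha>2) \<and> (\<alpha>1 - \<alpha>2 \<in> \<int> \<longrightarrow> \<alpha>1 = \<alpha>2)"

text \<open>An eigenvector with eigenvalue \<open>l\<close> becomes single-valued after the twist by \<open>exp (\<alpha> w)\<close> with
\<open>exp (2 \<pi> \<i> \<alpha>) l = 1\<close>.  In a Jordan block the remaining summand \<open>\<epsilon> A\<close> is compensated by
\<open>c w A\<close>, whose increment over one period is \<open>2 \<pi> \<i> c A\<close>.\<close>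

lemma elem_frame_from_flat:
  assumes A: "A \<in> flat_mv T" and B: "B \<in> flat_mv T" and ind: "F.indep2 A B"
    and MA: "Mmon A = fscl T l1 A" and MB: "Mmon B = fscl T l2 B + fscl T \<epsilon> A"
    and l: "l1 \<noteq> 0" "l2 \<noteq> 0" and \<epsilon>: "\<epsilon> \<noteq> 0 \<Longrightarrow> l1 = l2"
  obtains \<sigma>1 \<sigma>2 \<alpha>1 \<alpha>2 c where "elem_frame \<sigma>1 \<sigma>2 \<alpha>1 \<alpha>2 c" "c = 0 \<longleftrightarrow> \<epsilon> = 0"
    "exp (- 2 * of_real pi * \<i> * \<alpha>1) = l1" "exp (- 2 * of_real pi * \<i> * \<alpha>2) = l2"
proof -
  \<comment> \<open>Choosing the exponent as a function of the eigenvalue makes equal eigenvalues have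
    equal exponents.\<close>
  define ex where "ex = (\<lambda>l. - (Ln l / (2 * of_real pi * \<i>)))"
  have ex: "exp (- 2 * of_real pi * \<i> * ex l) = l" if "l \<noteq> 0" for l using that by (simp add: ex_def)
  have ex': "exp (ex l * (2 * of_real pi * \<i>)) * l = 1" if "l \<noteq> 0" for l
    using that by (simp add: ex_def exp_minus)
  define \<alpha>1 \<alpha>2 where "\<alpha>1 = ex l1" and "\<alpha>2 = ex l2"
  define c where "c = - \<epsilon> / (2 * of_real pi * \<i> * l2)"
  define B1 B2 where "B1 = (\<lambda>w. exp (\<alpha>1 * w) \<odot> A w + (0 * w * exp (\<alpha>1 * w)) \<odot> A w)"
    and "B2 = (\<lambda>w. exp (\<alpha>2 * w) \<odot> B w + (c * w * exp (\<alpha>2 * w)) \<odot> A w)"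
  have MA': "A (w + 2 * of_real pi * \<i>) = l1 \<odot> A w" for w
    using fun_cong[OF MA, of w] by (simp add: Mmon_def fscl_def)
  have MB': "B (w + 2 * of_real pi * \<i>) = l2 \<odot> B w + \<epsilon> \<odot> A w" for w
    using fun_cong[OF MB, of w] by (simp add: Mmon_def fscl_def)
  have per1: "Mmon B1 = B1"
  proof
    fix w
    have "exp (\<alpha>1 * (w + 2 * of_real pi * \<i>)) * l1 = exp (\<alpha>1 * w) * (exp (\<alpha>1 * (2 * of_real pi * \<i>)) * l1)"
      by (simp add: distrib_left exp_add)
    also have "\<dots> = exp (\<alpha>1 * w)" using ex'[OF l(1)] by (simp add: \<alpha>1_def)
    finally show "Mmon B1 w = B1 w" by (simp add: Mmon_def B1_def MA')
  qed
  have per2: "Mmon B2 = B2"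
  proof
    fix w
    let ?p = "2 * of_real pi * \<i> :: complex"
    define E where "E = exp (\<alpha>2 * (w + ?p))"
    have "E * l2 = exp (\<alpha>2 * w) * (exp (\<alpha>2 * ?p) * l2)"
      by (simp add: E_def distrib_left exp_add)
    also have "\<dots> = exp (\<alpha>2 * w)" using ex'[OF l(2)] by (simp add: \<alpha>2_def)
    finally have E: "E * l2 = exp (\<alpha>2 * w)" .
    have cp: "c * ?p * l2 = - \<epsilon>" using l by (simp add: c_def)
    have cl: "c * l1 = c * l2" using \<epsilon> by (cases "\<epsilon> = 0") (auto simp: c_def)
    have "E * \<epsilon> + c * (w + ?p) * E * l1 = E * \<epsilon> + (w + ?p) * E * (c * l1)" by (simp add: mult_ac)
    also have "\<dots> = E * \<epsilon> + E * (c * ?p * l2) + c * w * (E * l2)"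
      unfolding cl by (simp add: algebra_simps)
    also have "\<dots> = c * w * exp (\<alpha>2 * w)" unfolding cp E by simp
    finally have 1: "E * \<epsilon> + c * (w + ?p) * E * l1 = c * w * exp (\<alpha>2 * w)" .
    have "Mmon B2 w = E \<odot> (l2 \<odot> B w + \<epsilon> \<odot> A w) + (c * (w + ?p) * E) \<odot> l1 \<odot> A w"
      by (simp add: Mmon_def B2_def MA' MB' E_def)
    also have "\<dots> = (E * l2) \<odot> B w + (E * \<epsilon> + c * (w + ?p) * E * l1) \<odot> A w"
      by (simp add: V.vs.scale_right_distrib V.vs.scale_left_distrib add_ac)
    finally show "Mmon B2 w = B2 w" unfolding 1 E by (simp add: B2_def)
  qed
  note d1 = descend_section[OF A A B1_def per1]
  note d2 = descend_section[OF B A B2_def per2]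
  have zexp: "z = exp (Ln z)" if "z \<noteq> 0" for z :: complex using that by simp
  have "V.indep2 (descend B1 z) (descend B2 z)" if "z \<noteq> 0" for z
  proof -
    define w where "w = Ln z"
    have 1: "descend B1 z = exp (\<alpha>1 * w) \<odot> A w + 0 \<odot> B w"
      "descend B2 z = (c * w * exp (\<alpha>2 * w)) \<odot> A w + exp (\<alpha>2 * w) \<odot> B w"
      using that by (auto simp: descend_def B1_def B2_def w_def)
    show ?thesis unfolding 1 using flat_mv_indep[OF A B ind, of w] by (subst V.indep2_det_iff) auto
  qed
  then have fr: "frame2 (- {0}) (descend B1) (descend B2)"
    using d1(1) d2(1) by (auto simp: frame2_def)
  have th1: "theta (descend B1) z = \<alpha>1 \<odot> descend B1 z" if "z \<noteq> 0" for z
    using d1(2)[of "Ln z"] descend_exp[OF per1, of "Ln z"] that by simp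
  have th2: "theta (descend B2) z = \<alpha>2 \<odot> descend B2 z + c \<odot> descend B1 z" if "z \<noteq> 0" for z
  proof -
    have "c \<odot> exp (\<alpha>2 * w) \<odot> A w = c \<odot> B1 w" for w
      using \<epsilon> by (cases "\<epsilon> = 0") (auto simp: c_def B1_def \<alpha>1_def \<alpha>2_def)
    then show ?thesis
      using d2(2)[of "Ln z"] descend_exp[OF per2, of "Ln z"] descend_exp[OF per1, of "Ln z"] that by simp
  qed
  have c0: "c = 0 \<longleftrightarrow> \<epsilon> = 0" using l by (simp add: c_def)
  have "\<alpha>1 = \<alpha>2" if int: "\<alpha>1 - \<alpha>2 \<in> \<int>"
  proof -
    obtain k where "\<alpha>1 - \<alpha>2 = of_int k" using int by (rule Ints_cases)
    then have k: "- 2 * of_real pi * \<i> * \<alpha>1 = - 2 * of_real pi * \<i> * \<alpha>2 + of_int (2 * (- k)) * pi * \<i>"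
      by (simp add: algebra_simps)
    have "exp (- 2 * of_real pi * \<i> * \<alpha>1) = exp (- 2 * of_real pi * \<i> * \<alpha>2)"
      unfolding exp_eq using k by blast
    then have "l1 = l2" using ex[OF l(1)] ex[OF l(2)] by (simp add: \<alpha>1_def \<alpha>2_def)
    then show ?thesis by (simp add: \<alpha>1_def \<alpha>2_def)
  qed
  moreover have "c \<noteq> 0 \<longrightarrow> \<alpha>1 = \<alpha>2" using c0 \<epsilon> by (auto simp: \<alpha>1_def \<alpha>2_def)
  ultimately have "elem_frame (descend B1) (descend B2) \<alpha>1 \<alpha>2 c"
    unfolding elem_frame_def using fr th1 th2 by (simp add: descend_def)
  then show ?thesis using c0 ex[OF l(1)] ex[OF l(2)] 
    by (intro that[of "descend B1" "descend B2" \<alpha>1 \<alpha>2 c]) (auto simp: \<alpha>1_def \<alpha>2_def)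
qed

text \<open>The eigenvalue hypothesis provides two independent global flat sections.\<close>

theorem elementary_frame_exists:
  assumes ev: "eigenvalues_are (fscl T) (flat_mv T) Mmon {#l1, l2#}"
  obtains \<sigma>1 \<sigma>2 \<alpha>1 \<alpha>2 c where "elem_frame \<sigma>1 \<sigma>2 \<alpha>1 \<alpha>2 c" "c = 0 \<longleftrightarrow> Nmon_zero T"
    "exp (- 2 * of_real pi * \<i> * \<alpha>1) = l1" "exp (- 2 * of_real pi * \<i> * \<alpha>2) = l2"
    "\<not> Nmon_zero T \<Longrightarrow> l1 = l2"
proof -
  have N: "Nmon_zero T \<longleftrightarrow> (\<forall>A\<in>flat_mv T.
     log_unipotent (fscl T) (flat_mv T) (unipotent_part (fscl T) (flat_mv T) Mmon) A = 0)"
    by (simp add: Nmon_zero_def Nmon_def)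
  note J = F.two_dim_jordan_basis[OF flat_mv_two_dim Mmon_endo Mmon_injective ev, folded N]
  show ?thesis
  proof (cases "Nmon_zero T")
    case True
    obtain A B where AB: "A \<in> flat_mv T" "B \<in> flat_mv T" "F.indep2 A B"
      "Mmon A = fscl T l1 A" "Mmon B = fscl T l2 B" using J(3)[OF _ True] by blast
    have "Mmon B = fscl T l2 B + fscl T 0 A" using AB by simp
    from elem_frame_from_flat[OF AB(1-4) this] show ?thesis using J(1,2) that True by metis
  next
    case False
    obtain A B where AB: "A \<in> flat_mv T" "B \<in> flat_mv T" "F.indep2 A B"
      "Mmon A = fscl T l1 A" "Mmon B = fscl T l1 B + A" and l: "l1 = l2" using J(4)[OF _ False] by blast
    have "Mmon B = fscl T l2 B + fscl T 1 A" using AB l by simp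
    from elem_frame_from_flat[OF AB(1-4) this] show ?thesis using J(1,2) that False l
      by (metis zero_neq_one)
  qed
qed

end

lemma analytic_at_bounded:
  assumes "f analytic_on {0::complex}"
  obtains C r where "r > 0" "\<And>z. z \<in> ball 0 r \<Longrightarrow> norm (f z) \<le> (C::real)"
proof -
  have "isCont f 0" using assms by (simp add: analytic_at_imp_isCont)
  then obtain r where r: "r > 0" "\<And>z. dist z 0 < r \<Longrightarrow> dist (f z) (f 0) < 1"
    unfolding continuous_at_eps_delta by (metis zero_less_one)
  have "norm (f z) \<le> norm (f 0) + 1" if "z \<in> ball 0 r" for z
  proof -
    have "dist (f z) (f 0) < 1" using r(2)[of z] that by (simp add: dist_commute)
    then show ?thesis using norm_triangle_sub[of "f z" "f 0"] by (simp add: dist_norm)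
  qed
  then show ?thesis using r(1) that by blast
qed

text \<open>Riemann's theorem on removable singularities.\<close>

lemma analytic_at_extension:
  assumes r: "r > 0" and hol: "y holomorphic_on ball 0 r - {0::complex}"
    and bd: "\<forall>\<^sub>F z in at 0. norm (z ^ N * y z) \<le> B"
  obtains h where "h analytic_on {0}" "\<forall>\<^sub>F z in at 0. z ^ N * y z = h z"
proof -
  have "(\<lambda>z. z ^ N * y z) holomorphic_on ball 0 r - {0}"
    using hol by (intro holomorphic_intros)
  moreover have "0 \<in> interior (ball 0 r)" using r by simp
  ultimately have "\<exists>g. g holomorphic_on ball 0 r \<and> (\<forall>z\<in>ball 0 r - {0}. g z = z ^ N * y z)"
    using holomorphic_on_extend_bounded[of "\<lambda>z. z ^ N * y z" "ball 0 r" 0] bd by blast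
  then obtain g where g: "g holomorphic_on ball 0 r" "\<And>z. z \<in> ball 0 r - {0} \<Longrightarrow> g z = z ^ N * y z"
    by blast
  have "g analytic_on {0}" using g(1) r by (auto simp: analytic_at intro!: exI[of _ "ball 0 r"])
  moreover have "\<forall>\<^sub>F z in at 0. z ^ N * y z = g z"
    using g(2) r by (auto simp: eventually_at dist_commute intro!: exI[of _ r])
  ultimately show ?thesis by (rule that)
qed

context te_rank2
begin

section \<open>Germs at the origin\<close>

lemma germs0I:
  assumes "open U" "0 \<in> U" "s \<in> hs U" "\<And>z. z \<in> U - {0} \<Longrightarrow> t z = s z"
  shows "t \<in> germs0 T"
  unfolding germs0_def mem_Collect_eq
  by (rule exI[of _ U], intro conjI bexI[of _ s] ballI assms)

lemma germs0_iff:
  assumes fr: "frame2 U a b" and 0: "0 \<in> U"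
  shows "t \<in> germs0 T \<longleftrightarrow> (\<exists>f g. f analytic_on {0} \<and> g analytic_on {0} \<and>
     (\<forall>\<^sub>F z in at 0. t z = f z \<odot> a z + g z \<odot> b z))"
proof
  assume "t \<in> germs0 T"
  then obtain W s where W: "open W" "0 \<in> W" "s \<in> hs W" "\<And>z. z \<in> W - {0} \<Longrightarrow> t z = s z"
    unfolding germs0_def by blast
  define Y where "Y = U \<inter> W"
  have Y: "open Y" "0 \<in> Y" using W 0 frame2D(1)[OF fr] by (auto simp: Y_def)
  have frY: "frame2 Y a b" by (rule frame2_mono[OF fr _ Y(1)]) (auto simp: Y_def)
  have "s \<in> hs Y" by (rule hs_mono[OF W(3)]) (auto simp: Y_def)
  then obtain f g where fg: "f holomorphic_on Y" "g holomorphic_on Y"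
     "\<And>z. z \<in> Y \<Longrightarrow> s z = f z \<odot> a z + g z \<odot> b z" using frame2_coords[OF frY] by metis
  have "\<forall>\<^sub>F z in at 0. z \<in> Y - {0}"
    using Y by (auto simp: eventually_at_filter eventually_nhds)
  then have "\<forall>\<^sub>F z in at 0. t z = f z \<odot> a z + g z \<odot> b z"
  proof eventually_elim
    case (elim z)
    then show ?case using W(4)[of z] fg(3)[of z] by (simp add: Y_def)
  qed
  moreover have "f analytic_on {0}" "g analytic_on {0}" using fg Y by (auto simp: analytic_at)
  ultimately show "\<exists>f g. f analytic_on {0} \<and> g analytic_on {0} \<and>
     (\<forall>\<^sub>F z in at 0. t z = f z \<odot> a z + g z \<odot> b z)" by blast
next
  assume "\<exists>f g. f analytic_on {0} \<and> g analytic_on {0} \<and>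
     (\<forall>\<^sub>F z in at 0. t z = f z \<odot> a z + g z \<odot> b z)"
  then obtain f g where fg: "f analytic_on {0}" "g analytic_on {0}"
     "\<forall>\<^sub>F z in at 0. t z = f z \<odot> a z + g z \<odot> b z" by blast
  obtain V1 where V1: "open V1" "0 \<in> V1" "f holomorphic_on V1" using fg(1) unfolding analytic_at by blast
  obtain V2 where V2: "open V2" "0 \<in> V2" "g holomorphic_on V2" using fg(2) unfolding analytic_at by blast
  obtain V3 where V3: "open V3" "0 \<in> V3" "\<And>z. z \<in> V3 \<Longrightarrow> z \<noteq> 0 \<Longrightarrow> t z = f z \<odot> a z + g z \<odot> b z"
    using fg(3) unfolding eventually_at_topological by blast
  define W where "W = U \<inter> V1 \<inter> V2 \<inter> V3"
  have W: "open W" "0 \<in> W" using V1 V2 V3 0 frame2D(1)[OF fr] by (auto simp: W_def)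
  have s: "(\<lambda>z. f z \<odot> a z + g z \<odot> b z) \<in> hs W"
    using frame2D(2,3)[OF fr] V1 V2
    by (intro hs_comb) (auto intro: hs_mono holomorphic_on_subset simp: W_def)
  show "t \<in> germs0 T"
    by (rule germs0I[OF W s]) (use V3(3) in \<open>auto simp: W_def\<close>)
qed

lemma frame_at: obtains U a b where "frame2 U a b" "z \<in> U"
  using chart_exists chart_frame(1) by metis

lemma germs0_cong:
  assumes s: "s \<in> germs0 T" and eq: "\<forall>\<^sub>F z in at 0. s z = t z"
  shows "t \<in> germs0 T"
proof -
  obtain U a b where fr: "frame2 U a b" "0 \<in> U" by (rule frame_at)
  obtain f g where fg: "f analytic_on {0}" "g analytic_on {0}"
     "\<forall>\<^sub>F z in at 0. s z = f z \<odot> a z + g z \<odot> b z" using s unfolding germs0_iff[OF fr] by blast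
  have "\<forall>\<^sub>F z in at 0. t z = f z \<odot> a z + g z \<odot> b z"
    using fg(3) eq by eventually_elim simp
  then show ?thesis unfolding germs0_iff[OF fr] using fg by blast
qed

lemma germs0_comb:
  assumes s: "s \<in> germs0 T" and t: "t \<in> germs0 T" and f: "f analytic_on {0}" and g: "g analytic_on {0}"
  shows "(\<lambda>z. f z \<odot> s z + g z \<odot> t z) \<in> germs0 T"
proof -
  obtain U a b where fr: "frame2 U a b" "0 \<in> U" by (rule frame_at)
  obtain p1 q1 where 1: "p1 analytic_on {0}" "q1 analytic_on {0}"
     "\<forall>\<^sub>F z in at 0. s z = p1 z \<odot> a z + q1 z \<odot> b z" using s unfolding germs0_iff[OF fr] by blast
  obtain p2 q2 where 2: "p2 analytic_on {0}" "q2 analytic_on {0}"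
     "\<forall>\<^sub>F z in at 0. t z = p2 z \<odot> a z + q2 z \<odot> b z" using t unfolding germs0_iff[OF fr] by blast
  have "\<forall>\<^sub>F z in at 0. f z \<odot> s z + g z \<odot> t z =
      (f z * p1 z + g z * p2 z) \<odot> a z + (f z * q1 z + g z * q2 z) \<odot> b z"
    using 1(3) 2(3) by eventually_elim (simp add: V.comb_comb)
  moreover have "(\<lambda>z. f z * p1 z + g z * p2 z) analytic_on {0}" "(\<lambda>z. f z * q1 z + g z * q2 z) analytic_on {0}"
    using 1 2 f g by (auto intro!: analytic_intros)
  ultimately show ?thesis unfolding germs0_iff[OF fr] by blast
qed

lemma germs0_scale: "s \<in> germs0 T \<Longrightarrow> f analytic_on {0} \<Longrightarrow> (\<lambda>z. f z \<odot> s z) \<in> germs0 T"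
  using germs0_comb[of s s f "\<lambda>_. 0"] by (simp add: analytic_on_const)

lemma germs0_of_section: "s \<in> hs U \<Longrightarrow> open U \<Longrightarrow> 0 \<in> U \<Longrightarrow> s \<in> germs0 T"
  by (rule germs0I) auto

section \<open>Growth of the transition between logarithmic frames\<close>

text \<open>The transition matrix between two frames with bounded connection matrices satisfies a linear system
with a regular singularity, so a power of \<open>z\<close> makes it bounded, hence holomorphic.\<close>

lemma transition_moderate_growth:
  assumes r: "r > 0" and P: "P = ball 0 r - {0}"
    and a: "frame2 P a1 a2" and b: "frame2 P b1 b2"
    and ta: "\<And>z. z \<in> P \<Longrightarrow> theta a1 z = A11 z \<odot> a1 z + A21 z \<odot> a2 z"
      "\<And>z. z \<in> P \<Longrightarrow> theta a2 z = A12 z \<odot> a1 z + A22 z \<odot> a2 z"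
    and tb: "\<And>z. z \<in> P \<Longrightarrow> theta b1 z = B11 z \<odot> b1 z + B21 z \<odot> b2 z"
      "\<And>z. z \<in> P \<Longrightarrow> theta b2 z = B12 z \<odot> b1 z + B22 z \<odot> b2 z"
    and bd: "\<And>z h. z \<in> P \<Longrightarrow> h \<in> {A11, A12, A21, A22, B11, B12, B21, B22} \<Longrightarrow> norm (h z) \<le> C"
  obtains N g11 g12 g21 g22 where
    "g11 analytic_on {0}" "g12 analytic_on {0}" "g21 analytic_on {0}" "g22 analytic_on {0}"
    "\<forall>\<^sub>F z in at 0. z ^ N \<odot> b1 z = g11 z \<odot> a1 z + g21 z \<odot> a2 z"
    "\<forall>\<^sub>F z in at 0. z ^ N \<odot> b2 z = g12 z \<odot> a1 z + g22 z \<odot> a2 z"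
proof -
  have P': "open P" "0 \<notin> P" by (auto simp: P)
  note a' = frame2D[OF a] and b' = frame2D[OF b]
  obtain g11 g21 where 1: "g11 holomorphic_on P" "g21 holomorphic_on P"
    "\<And>z. z \<in> P \<Longrightarrow> b1 z = g11 z \<odot> a1 z + g21 z \<odot> a2 z" using frame2_coords[OF a b'(2)] by metis
  obtain g12 g22 where 2: "g12 holomorphic_on P" "g22 holomorphic_on P"
    "\<And>z. z \<in> P \<Longrightarrow> b2 z = g12 z \<odot> a1 z + g22 z \<odot> a2 z" using frame2_coords[OF a b'(3)] by metis
  have ode: "z * deriv f z = u - A11 z * f z - A12 z * g z \<and> z * deriv g z = v - A21 z * f z - A22 z * g z"
    if z: "z \<in> P" and f: "f holomorphic_on P" "g holomorphic_on P"
      and s: "s \<in> hs P" "\<And>z. z \<in> P \<Longrightarrow> s z = f z \<odot> a1 z + g z \<odot> a2 z"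
      and th: "theta s z = u \<odot> a1 z + v \<odot> a2 z"
    for z f g s u v
  proof -
    have "theta s z = theta (\<lambda>z. f z \<odot> a1 z + g z \<odot> a2 z) z"
      by (rule theta_cong[OF P' s z])
    also have "\<dots> = (z * deriv f z + A11 z * f z + A12 z * g z) \<odot> a1 z + (z * deriv g z + A21 z * f z + A22 z * g z) \<odot> a2 z"
      by (rule theta_comb_in_frame[OF P' a'(2,3) f z ta(1)[OF z] ta(2)[OF z]])
    finally have "u \<odot> a1 z + v \<odot> a2 z =
       (z * deriv f z + A11 z * f z + A12 z * g z) \<odot> a1 z + (z * deriv g z + A21 z * f z + A22 z * g z) \<odot> a2 z"
      unfolding th .
    from V.indep2D[OF a'(4)[OF z] this] show ?thesis by simp
  qed
  have sb: "theta b1 z = (B11 z * g11 z + B21 z * g12 z) \<odot> a1 z + (B11 z * g21 z + B21 z * g22 z) \<odot> a2 z"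
    "theta b2 z = (B12 z * g11 z + B22 z * g12 z) \<odot> a1 z + (B12 z * g21 z + B22 z * g22 z) \<odot> a2 z" if "z \<in> P" for z
    unfolding tb(1)[OF that] tb(2)[OF that] 1(3)[OF that] 2(3)[OF that] V.comb_comb by (rule refl)+
  note o1 = ode[OF _ 1(1,2) b'(2) 1(3) sb(1)]
  note o2 = ode[OF _ 2(1,2) b'(3) 2(3) sb(2)]
  define y where "y = (\<lambda>i::nat. if i = 0 then g11 else if i = 1 then g12 else if i = 2 then g21 else g22)"
  define S where "S = (\<lambda>z. norm (g11 z) + norm (g12 z) + norm (g21 z) + norm (g22 z))"
  have S: "(\<Sum>j<4. norm (y j z)) = S z" for z
    by (simp add: y_def S_def numeral_eq_Suc)
  have four: "norm (p * u + q * v - p' * u' - q' * v') \<le> (4 * C) * S z"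
    if "norm p \<le> C" "norm q \<le> C" "norm p' \<le> C" "norm q' \<le> C" and uv: "norm u \<le> S z" "norm v \<le> S z" "norm u' \<le> S z" "norm v' \<le> S z"
    for p q p' q' u v u' v' :: complex and z
  proof -
    have C0: "C \<ge> 0" using that(1) norm_ge_zero order_trans by blast
    have "norm (p * u + q * v - p' * u' - q' * v') \<le> norm p * norm u + norm q * norm v + norm p' * norm u' + norm q' * norm v'"
      using norm_triangle_ineq4[of "p * u + q * v - p' * u'" "q' * v'"] norm_triangle_ineq4[of "p * u + q * v" "p' * u'"]
        norm_triangle_ineq[of "p * u" "q * v"] by (simp add: norm_mult)
    also have "\<dots> \<le> C * S z + C * S z + C * S z + C * S z"
      using that C0 by (intro add_mono mult_mono) auto
    finally show ?thesis by simp
  qed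
  have yS: "norm (g11 z) \<le> S z" "norm (g12 z) \<le> S z" "norm (g21 z) \<le> S z" "norm (g22 z) \<le> S z" for z
    by (simp_all add: S_def)
  have bnd: "norm (z * deriv (y i) z) \<le> (4 * C) * (\<Sum>j<4. norm (y j z))" if i: "i \<in> {..<4}" and z: "z \<in> ball 0 r - {0}" for i z
  proof -
    have z': "z \<in> P" using z by (simp add: P)
    have bb: "norm (h z) \<le> C" if "h \<in> {A11, A12, A21, A22, B11, B12, B21, B22}" for h
      by (rule bd[OF z' that])
    consider "i = 0" | "i = 1" | "i = 2" | "i = 3" using i by force
    then show ?thesis
    proof cases
      case 1 then show ?thesis unfolding S using o1[OF z' _ z'] by (simp add: y_def four bb yS)
    next
      case 2 then show ?thesis unfolding S using o2[OF z' _ z'] by (simp add: y_def four bb yS)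
    next
      case 3 then show ?thesis unfolding S using o1[OF z' _ z'] by (simp add: y_def four bb yS)
    next
      case 4 then show ?thesis unfolding S using o2[OF z' _ z'] by (simp add: y_def four bb yS)
    qed
  qed
  have hol: "y i holomorphic_on ball 0 r - {0}" for i
    using 1 2 unfolding y_def P by auto
  obtain N where N: "\<And>i. i \<in> {..<4} \<Longrightarrow> \<exists>B. \<forall>\<^sub>F z in at 0. norm (z ^ N * y i z) \<le> B"
    using regular_singular_moderate_growth[OF finite_lessThan r hol bnd] by blast
  have "\<exists>h. h analytic_on {0} \<and> (\<forall>\<^sub>F z in at 0. z ^ N * y i z = h z)" if i: "i < 4" for i
  proof -
    obtain B where B: "\<forall>\<^sub>F z in at 0. norm (z ^ N * y i z) \<le> B" using N[of i] i by auto
    show ?thesis by (rule analytic_at_extension[OF r hol B]) blast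
  qed
  then obtain h where h: "\<And>i. i < 4 \<Longrightarrow> h i analytic_on {0}" "\<And>i. i < 4 \<Longrightarrow> \<forall>\<^sub>F z in at 0. z ^ N * y i z = h i z"
    by metis
  have evP: "\<forall>\<^sub>F z in at 0. z \<in> P" using r by (auto simp: P eventually_at dist_commute intro!: exI[of _ r])
  have h4: "\<forall>\<^sub>F z in at 0. z ^ N * g11 z = h 0 z" "\<forall>\<^sub>F z in at 0. z ^ N * g12 z = h 1 z"
    "\<forall>\<^sub>F z in at 0. z ^ N * g21 z = h 2 z" "\<forall>\<^sub>F z in at 0. z ^ N * g22 z = h 3 z"
    using h(2)[of 0] h(2)[of 1] h(2)[of 2] h(2)[of 3] by (simp_all add: y_def)
  show ?thesis
  proof (rule that[of "h 0" "h 1" "h 2" "h 3" N])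
    show "\<forall>\<^sub>F z in at 0. z ^ N \<odot> b1 z = h 0 z \<odot> a1 z + h 2 z \<odot> a2 z"
      using evP h4(1) h4(3)
    proof eventually_elim
      case (elim z)
      then show ?case unfolding 1(3)[OF elim(1)] elim(2)[symmetric] elim(3)[symmetric]
        by (simp add: V.vs.scale_right_distrib)
    qed
    show "\<forall>\<^sub>F z in at 0. z ^ N \<odot> b2 z = h 1 z \<odot> a1 z + h 3 z \<odot> a2 z"
      using evP h4(2) h4(4)
    proof eventually_elim
      case (elim z)
      then show ?case unfolding 2(3)[OF elim(1)] elim(2)[symmetric] elim(3)[symmetric]
        by (simp add: V.vs.scale_right_distrib)
    qed
  qed (auto intro!: h)
qed

end

locale te_elementary = te_rank2 T for T :: "('v::ab_group_add) te" +
  fixes \<sigma>1 \<sigma>2 :: "complex \<Rightarrow> 'v" and \<alpha>1 \<alpha>2 c :: complex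
  assumes log: "logarithmic T" and ef: "elem_frame \<sigma>1 \<sigma>2 \<alpha>1 \<alpha>2 c"
begin

lemma sigma:
  shows "frame2 (- {0}) \<sigma>1 \<sigma>2" "\<sigma>1 0 = 0" "\<sigma>2 0 = 0"
    and "z \<noteq> 0 \<Longrightarrow> theta \<sigma>1 z = \<alpha>1 \<odot> \<sigma>1 z" "z \<noteq> 0 \<Longrightarrow> theta \<sigma>2 z = \<alpha>2 \<odot> \<sigma>2 z + c \<odot> \<sigma>1 z"
    and "c \<noteq> 0 \<Longrightarrow> \<alpha>1 = \<alpha>2" "\<alpha>1 - \<alpha>2 \<in> \<int> \<Longrightarrow> \<alpha>1 = \<alpha>2"
  using ef by (auto simp: elem_frame_def)

lemma sigma_indep: "z \<noteq> 0 \<Longrightarrow> V.indep2 (\<sigma>1 z) (\<sigma>2 z)"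
  using frame2D(4)[OF sigma(1)] by simp

lemma theta_germ: "t \<in> germs0 T \<Longrightarrow> theta t \<in> germs0 T"
  using log unfolding logarithmic_def theta_def[abs_def] by blast

text \<open>The lattice of germs and the lattice spanned by \<open>\<sigma>\<^sub>1, \<sigma>\<^sub>2\<close> contain each other up to a power of \<open>z\<close>:
a holomorphic frame at 0 has a holomorphic connection matrix by the logarithmic condition, so both
directions of the transition have moderate growth.\<close>

lemma lattice_bounds:
  obtains N :: nat where
    "(\<lambda>z. z ^ N \<odot> \<sigma>1 z) \<in> germs0 T" "(\<lambda>z. z ^ N \<odot> \<sigma>2 z) \<in> germs0 T"
    "\<And>t. t \<in> germs0 T \<Longrightarrow> \<exists>F G. F analytic_on {0} \<and> G analytic_on {0} \<and>
       (\<forall>\<^sub>F z in at 0. z ^ N \<odot> t z = F z \<odot> \<sigma>1 z + G z \<odot> \<sigma>2 z)"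
proof -
  obtain U e1 e2 where fr: "frame2 U e1 e2" "0 \<in> U" by (rule frame_at)
  note fr' = frame2D[OF fr(1)]
  have e: "e1 \<in> germs0 T" "e2 \<in> germs0 T"
    using germs0_of_section[OF fr'(2,1) fr(2)] germs0_of_section[OF fr'(3,1) fr(2)] .
  obtain B11 B21 where B1: "B11 analytic_on {0}" "B21 analytic_on {0}"
    "\<forall>\<^sub>F z in at 0. theta e1 z = B11 z \<odot> e1 z + B21 z \<odot> e2 z"
    using theta_germ[OF e(1)] unfolding germs0_iff[OF fr] by blast
  obtain B12 B22 where B2: "B12 analytic_on {0}" "B22 analytic_on {0}"
    "\<forall>\<^sub>F z in at 0. theta e2 z = B12 z \<odot> e1 z + B22 z \<odot> e2 z"
    using theta_germ[OF e(2)] unfolding germs0_iff[OF fr] by blast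
  obtain C11 r11 where 11: "r11 > 0" "\<And>z. z \<in> ball 0 r11 \<Longrightarrow> norm (B11 z) \<le> C11" by (rule analytic_at_bounded[OF B1(1)]) blast
  obtain C21 r21 where 21: "r21 > 0" "\<And>z. z \<in> ball 0 r21 \<Longrightarrow> norm (B21 z) \<le> C21" by (rule analytic_at_bounded[OF B1(2)]) blast
  obtain C12 r12 where 12: "r12 > 0" "\<And>z. z \<in> ball 0 r12 \<Longrightarrow> norm (B12 z) \<le> C12" by (rule analytic_at_bounded[OF B2(1)]) blast
  obtain C22 r22 where 22: "r22 > 0" "\<And>z. z \<in> ball 0 r22 \<Longrightarrow> norm (B22 z) \<le> C22" by (rule analytic_at_bounded[OF B2(2)]) blast
  obtain r1 where r1: "r1 > 0" "\<And>z. z \<noteq> 0 \<Longrightarrow> dist z 0 < r1 \<Longrightarrow> theta e1 z = B11 z \<odot> e1 z + B21 z \<odot> e2 z"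
    using B1(3) by (auto simp: eventually_at)
  obtain r2 where r2: "r2 > 0" "\<And>z. z \<noteq> 0 \<Longrightarrow> dist z 0 < r2 \<Longrightarrow> theta e2 z = B12 z \<odot> e1 z + B22 z \<odot> e2 z"
    using B2(3) by (auto simp: eventually_at)
  obtain r0 where r0: "r0 > 0" "ball 0 r0 \<subseteq> U" using fr(2) fr'(1) open_contains_ball by blast
  define r where "r = Min {r0, r1, r2, r11, r12, r21, r22}"
  have r_pos: "r > 0"
    using r0(1) r1(1) r2(1) 11(1) 12(1) 21(1) 22(1) by (simp add: r_def)
  have r: "r \<le> r0" "r \<le> r1" "r \<le> r2" "r \<le> r11" "r \<le> r12" "r \<le> r21" "r \<le> r22"
    unfolding r_def by (rule Min_le; simp)+
  define P where "P = ball 0 r - {0::complex}"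
  define C where "C = \<bar>C11\<bar> + \<bar>C12\<bar> + \<bar>C21\<bar> + \<bar>C22\<bar> + norm \<alpha>1 + norm \<alpha>2 + norm c"
  have frs: "frame2 P \<sigma>1 \<sigma>2" by (rule frame2_mono[OF sigma(1)]) (auto simp: P_def)
  have fre: "frame2 P e1 e2" by (rule frame2_mono[OF fr(1)]) (use r0(2) subset_ball[OF r(1), of 0] in \<open>auto simp: P_def\<close>)
  have te: "theta e1 z = B11 z \<odot> e1 z + B21 z \<odot> e2 z" "theta e2 z = B12 z \<odot> e1 z + B22 z \<odot> e2 z"
    if "z \<in> P" for z
    using r1(2)[of z] r2(2)[of z] r that by (auto simp: P_def)
  have ts: "theta \<sigma>1 z = (\<lambda>_. \<alpha>1) z \<odot> \<sigma>1 z + (\<lambda>_. 0) z \<odot> \<sigma>2 z"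
    "theta \<sigma>2 z = (\<lambda>_. c) z \<odot> \<sigma>1 z + (\<lambda>_. \<alpha>2) z \<odot> \<sigma>2 z" if "z \<in> P" for z
    using sigma(4,5)[of z] that by (auto simp: P_def)
  have Bbd: "norm (B11 z) \<le> C" "norm (B12 z) \<le> C" "norm (B21 z) \<le> C" "norm (B22 z) \<le> C" if "z \<in> P" for z
  proof -
    have z: "z \<in> ball 0 r11" "z \<in> ball 0 r12" "z \<in> ball 0 r21" "z \<in> ball 0 r22"
      using that r by (auto simp: P_def)
    have n: "norm \<alpha>1 \<ge> 0" "norm \<alpha>2 \<ge> 0" "norm c \<ge> 0" by auto
    show "norm (B11 z) \<le> C" using 11(2)[OF z(1)] n unfolding C_def by linarith
    show "norm (B12 z) \<le> C" using 12(2)[OF z(2)] n unfolding C_def by linarith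
    show "norm (B21 z) \<le> C" using 21(2)[OF z(3)] n unfolding C_def by linarith
    show "norm (B22 z) \<le> C" using 22(2)[OF z(4)] n unfolding C_def by linarith
  qed
  have Abd: "norm \<alpha>1 \<le> C" "norm \<alpha>2 \<le> C" "norm c \<le> C" "0 \<le> C" by (simp_all add: C_def)
  obtain N1 g11 g12 g21 g22 where g: "g11 analytic_on {0}" "g12 analytic_on {0}" "g21 analytic_on {0}" "g22 analytic_on {0}"
    "\<forall>\<^sub>F z in at 0. z ^ N1 \<odot> e1 z = g11 z \<odot> \<sigma>1 z + g21 z \<odot> \<sigma>2 z"
    "\<forall>\<^sub>F z in at 0. z ^ N1 \<odot> e2 z = g12 z \<odot> \<sigma>1 z + g22 z \<odot> \<sigma>2 z"
  proof (rule transition_moderate_growth[OF r_pos P_def frs fre ts te])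
    show "norm (h z) \<le> C" if "z \<in> P" "h \<in> {\<lambda>_. \<alpha>1, \<lambda>_. c, \<lambda>_. 0, \<lambda>_. \<alpha>2, B11, B12, B21, B22}" for z h
      using that Bbd[OF that(1)] Abd by auto
  qed
  obtain N2 h11 h12 h21 h22 where h: "h11 analytic_on {0}" "h12 analytic_on {0}" "h21 analytic_on {0}" "h22 analytic_on {0}"
    "\<forall>\<^sub>F z in at 0. z ^ N2 \<odot> \<sigma>1 z = h11 z \<odot> e1 z + h21 z \<odot> e2 z"
    "\<forall>\<^sub>F z in at 0. z ^ N2 \<odot> \<sigma>2 z = h12 z \<odot> e1 z + h22 z \<odot> e2 z"
  proof (rule transition_moderate_growth[OF r_pos P_def fre frs te ts])
    show "norm (h z) \<le> C" if "z \<in> P" "h \<in> {B11, B12, B21, B22, \<lambda>_. \<alpha>1, \<lambda>_. c, \<lambda>_. 0, \<lambda>_. \<alpha>2}" for z h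
      using that Bbd[OF that(1)] Abd by auto
  qed
  define N where "N = N1 + N2"
  have up: "(\<lambda>z. z ^ N \<odot> s z) \<in> germs0 T" if s: "\<forall>\<^sub>F z in at 0. z ^ N2 \<odot> s z = f z \<odot> e1 z + g z \<odot> e2 z"
    and fg: "f analytic_on {0}" "g analytic_on {0}" for s f g
  proof -
    have "(\<lambda>z. z ^ N2 \<odot> s z) \<in> germs0 T" unfolding germs0_iff[OF fr] using s fg by blast
    then have "(\<lambda>z. z ^ N1 \<odot> z ^ N2 \<odot> s z) \<in> germs0 T"
      by (rule germs0_scale) (auto intro!: analytic_intros)
    then show ?thesis by (simp add: N_def power_add)
  qed
  have "\<exists>F G. F analytic_on {0} \<and> G analytic_on {0} \<and>
       (\<forall>\<^sub>F z in at 0. z ^ N \<odot> t z = F z \<odot> \<sigma>1 z + G z \<odot> \<sigma>2 z)" if t: "t \<in> germs0 T" for t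
  proof -
    obtain p q where pq: "p analytic_on {0}" "q analytic_on {0}"
      "\<forall>\<^sub>F z in at 0. t z = p z \<odot> e1 z + q z \<odot> e2 z" using t unfolding germs0_iff[OF fr] by blast
    have "\<forall>\<^sub>F z in at 0. z ^ N \<odot> t z =
       (z ^ N2 * (p z * g11 z + q z * g12 z)) \<odot> \<sigma>1 z + (z ^ N2 * (p z * g21 z + q z * g22 z)) \<odot> \<sigma>2 z"
      using pq(3) g(5,6)
    proof eventually_elim
      case (elim z)
      have "z ^ N \<odot> t z = z ^ N2 \<odot> (p z \<odot> (z ^ N1 \<odot> e1 z) + q z \<odot> (z ^ N1 \<odot> e2 z))"
        unfolding elim(1) by (simp add: N_def power_add V.vs.scale_right_distrib mult_ac)
      also have "\<dots> = z ^ N2 \<odot> ((p z * g11 z + q z * g12 z) \<odot> \<sigma>1 z + (p z * g21 z + q z * g22 z) \<odot> \<sigma>2 z)"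
        unfolding elim(2,3) V.comb_comb ..
      finally show ?case by (simp add: V.vs.scale_right_distrib)
    qed
    moreover have "(\<lambda>z. z ^ N2 * (p z * g11 z + q z * g12 z)) analytic_on {0}" "(\<lambda>z. z ^ N2 * (p z * g21 z + q z * g22 z)) analytic_on {0}"
      using pq g by (auto intro!: analytic_intros)
    ultimately show ?thesis by blast
  qed
  then show ?thesis using that[of N] up[OF h(5) h(1,3)] up[OF h(6) h(2,4)] by blast
qed

end

section \<open>Lattices of germs and direct sums\<close>

lemma int_least:
  fixes P :: "int \<Rightarrow> bool"
  assumes "P k0" and "\<And>k. P k \<Longrightarrow> m \<le> k"
  obtains k where "P k" "\<And>j. P j \<Longrightarrow> k \<le> j"
proof -
  define Q where "Q = (\<lambda>n::nat. P (m + int n))"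
  have "Q (nat (k0 - m))" using assms by (simp add: Q_def)
  then have "Q (LEAST n. Q n)" by (rule LeastI)
  moreover have "m + int (LEAST n. Q n) \<le> j" if "P j" for j
    using Least_le[of Q "nat (j - m)"] assms(2)[OF that] that by (simp add: Q_def)
  ultimately show ?thesis using that[of "m + int (LEAST n. Q n)"] by (simp add: Q_def)
qed

lemma eventually_at_0_nz: "\<forall>\<^sub>F z in at (0::complex). z \<noteq> 0"
  by (rule eventually_neq_at_within)

text \<open>A nonzero constant has no zero at 0.\<close>

lemma power_times_analytic_eq_const:
  fixes H :: "complex \<Rightarrow> complex"
  assumes H: "H analytic_on {0}" and m: "m > 0" and e: "\<forall>\<^sub>F z in at 0. w = z ^ m * H z"
  shows "w = 0"
proof -
  have "isCont H 0" using H by (rule analytic_at_imp_isCont)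
  then have "((\<lambda>z. z ^ m * H z) \<longlongrightarrow> 0 ^ m * H 0) (at 0)"
    by (intro tendsto_intros) (simp add: isCont_def)
  then have "((\<lambda>z. w) \<longlongrightarrow> 0 ^ m * H 0) (at (0::complex))"
    using tendsto_cong[OF e] by blast
  moreover have "0 ^ m * H 0 = 0" using m by (cases m) auto
  ultimately have "((\<lambda>z. w) \<longlongrightarrow> 0) (at (0::complex))" by metis
  then show ?thesis by (metis tendsto_const_iff trivial_limit_at)
qed

context te_rank2
begin

text \<open>\<open>t\<close> lies in the module generated by \<open>s1\<close> and \<open>s2\<close> over the convergent power series.\<close>

definition spanned :: "(complex \<Rightarrow> 'v) \<Rightarrow> (complex \<Rightarrow> 'v) \<Rightarrow> (complex \<Rightarrow> 'v) \<Rightarrow> bool" where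
  "spanned s1 s2 t \<longleftrightarrow> (\<exists>f g. f analytic_on {0} \<and> g analytic_on {0} \<and>
     (\<forall>\<^sub>F z in at 0. t z = f z \<odot> s1 z + g z \<odot> s2 z))"

lemma spanned_comb:
  assumes "spanned s1 s2 s" "spanned s1 s2 t" and f: "f analytic_on {0}" and g: "g analytic_on {0}"
    and eq: "\<forall>\<^sub>F z in at 0. u z = f z \<odot> s z + g z \<odot> t z"
  shows "spanned s1 s2 u"
proof -
  obtain p1 q1 where 1: "p1 analytic_on {0}" "q1 analytic_on {0}"
     "\<forall>\<^sub>F z in at 0. s z = p1 z \<odot> s1 z + q1 z \<odot> s2 z" using assms(1) unfolding spanned_def by blast
  obtain p2 q2 where 2: "p2 analytic_on {0}" "q2 analytic_on {0}"
     "\<forall>\<^sub>F z in at 0. t z = p2 z \<odot> s1 z + q2 z \<odot> s2 z" using assms(2) unfolding spanned_def by blast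
  have "\<forall>\<^sub>F z in at 0. u z = (f z * p1 z + g z * p2 z) \<odot> s1 z + (f z * q1 z + g z * q2 z) \<odot> s2 z"
    using 1(3) 2(3) eq by eventually_elim (simp add: V.comb_comb)
  moreover have "(\<lambda>z. f z * p1 z + g z * p2 z) analytic_on {0}" "(\<lambda>z. f z * q1 z + g z * q2 z) analytic_on {0}"
    using 1 2 f g by (auto intro!: analytic_intros)
  ultimately show ?thesis unfolding spanned_def by blast
qed

lemma direct_sumI:
  assumes s: "s1 \<in> germs0 T" "s2 \<in> germs0 T" and ind: "\<forall>\<^sub>F z in at 0. V.indep2 (s1 z) (s2 z)"
    and gen: "\<And>t. t \<in> germs0 T \<Longrightarrow> spanned s1 s2 t"
  shows "is_direct_sum0 (germs0 T) (conv_span T s1) (conv_span T s2)"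
  unfolding is_direct_sum0_def
proof (intro conjI equalityI subsetI ballI)
  fix t assume "t \<in> germs0 T"
  then obtain f g where fg: "f analytic_on {0}" "g analytic_on {0}"
     "\<forall>\<^sub>F z in at 0. t z = f z \<odot> s1 z + g z \<odot> s2 z" using gen unfolding spanned_def by blast
  define a where "a = (\<lambda>z. f z \<odot> s1 z)"
  have "a \<in> conv_span T s1" unfolding conv_span_def a_def using fg(1) by auto
  moreover have "\<forall>\<^sub>F z in at 0. (t - a) z = g z \<odot> s2 z"
    using fg(3) by eventually_elim (simp add: a_def)
  then have "t - a \<in> conv_span T s2" unfolding conv_span_def using fg(2) by blast
  ultimately show "t \<in> {a + b |a b. a \<in> conv_span T s1 \<and> b \<in> conv_span T s2}"
    unfolding mem_Collect_eq by (intro exI[of _ a] exI[of _ "t - a"]) simp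
next
  fix t assume "t \<in> {a + b |a b. a \<in> conv_span T s1 \<and> b \<in> conv_span T s2}"
  then obtain a b f g where t: "t = a + b" and f: "f analytic_on {0}" "\<forall>\<^sub>F z in at 0. a z = f z \<odot> s1 z"
    and g: "g analytic_on {0}" "\<forall>\<^sub>F z in at 0. b z = g z \<odot> s2 z" unfolding conv_span_def by blast
  have "\<forall>\<^sub>F z in at 0. f z \<odot> s1 z + g z \<odot> s2 z = t z"
    using f(2) g(2) by eventually_elim (simp add: t)
  then show "t \<in> germs0 T" using germs0_cong[OF germs0_comb[OF s f(1) g(1)]] by blast
next
  fix t assume "t \<in> conv_span T s1 \<inter> conv_span T s2"
  then obtain f g where f: "\<forall>\<^sub>F z in at 0. t z = f z \<odot> s1 z" and g: "\<forall>\<^sub>F z in at 0. t z = g z \<odot> s2 z"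
    unfolding conv_span_def by blast
  show "\<forall>\<^sub>F z in at 0. t z = 0"
    using f g ind
  proof eventually_elim
    case (elim z)
    then have "f z \<odot> s1 z + (- g z) \<odot> s2 z = 0" by simp
    then have "f z = 0" using elim(3) unfolding V.indep2_def by blast
    then show ?case using elim by simp
  qed
qed

text \<open>The two generators are independent near 0 because they generate a holomorphic frame.\<close>

lemma direct_sumE:
  assumes ds: "is_direct_sum0 (germs0 T) (conv_span T s1) (conv_span T s2)"
  shows "s1 \<in> germs0 T" "s2 \<in> germs0 T" "\<forall>\<^sub>F z in at 0. V.indep2 (s1 z) (s2 z)"
    and "t \<in> germs0 T \<Longrightarrow> spanned s1 s2 t"
proof -
  have eq: "germs0 T = {a + b |a b. a \<in> conv_span T s1 \<and> b \<in> conv_span T s2}"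
    using ds unfolding is_direct_sum0_def by blast
  have z: "0 \<in> conv_span T s" for s
    unfolding conv_span_def by (auto intro!: exI[of _ "\<lambda>_. 0"])
  have o: "s \<in> conv_span T s" for s
    unfolding conv_span_def by (auto intro!: exI[of _ "\<lambda>_. 1"])
  show "s1 \<in> germs0 T" unfolding eq mem_Collect_eq
    by (rule exI[of _ s1], rule exI[of _ 0]) (simp add: z o)
  show "s2 \<in> germs0 T" unfolding eq mem_Collect_eq
    by (rule exI[of _ 0], rule exI[of _ s2]) (simp add: z o)
  have gen: "spanned s1 s2 t" if tg: "t \<in> germs0 T" for t
  proof -
    obtain a b f g where t: "t = a + b" and f: "f analytic_on {0}" "\<forall>\<^sub>F z in at 0. a z = f z \<odot> s1 z"
      and g: "g analytic_on {0}" "\<forall>\<^sub>F z in at 0. b z = g z \<odot> s2 z"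
      using tg unfolding eq conv_span_def by blast
    have "\<forall>\<^sub>F z in at 0. t z = f z \<odot> s1 z + g z \<odot> s2 z"
      using f(2) g(2) by eventually_elim (simp add: t)
    then show ?thesis unfolding spanned_def using f(1) g(1) by blast
  qed
  then show "t \<in> germs0 T \<Longrightarrow> spanned s1 s2 t" .
  obtain U a b where fr: "frame2 U a b" "0 \<in> U" by (rule frame_at)
  note fr' = frame2D[OF fr(1)]
  obtain f1 g1 where 1: "\<forall>\<^sub>F z in at 0. a z = f1 z \<odot> s1 z + g1 z \<odot> s2 z"
    using gen[OF germs0_of_section[OF fr'(2,1) fr(2)]] unfolding spanned_def by blast
  obtain f2 g2 where 2: "\<forall>\<^sub>F z in at 0. b z = f2 z \<odot> s1 z + g2 z \<odot> s2 z"
    using gen[OF germs0_of_section[OF fr'(3,1) fr(2)]] unfolding spanned_def by blast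
  have "\<forall>\<^sub>F z in at 0. z \<in> U" using fr'(1) fr(2) by (simp add: eventually_at_in_open')
  then show "\<forall>\<^sub>F z in at 0. V.indep2 (s1 z) (s2 z)"
    using 1 2 by eventually_elim (use V.indep2_generators fr'(4) in blast)
qed

end

context te_elementary
begin

section \<open>The grading of the lattice\<close>

text \<open>The summands have exponents \<open>\<alpha>1 + k\<close> and \<open>\<alpha>2 + k\<close>; this is an elementary section when they
agree or one coefficient vanishes.\<close>

definition homog :: "int \<Rightarrow> complex \<Rightarrow> complex \<Rightarrow> complex \<Rightarrow> 'v" where
  "homog k x y = (\<lambda>z. (z powi k * x) \<odot> \<sigma>1 z + (z powi k * y) \<odot> \<sigma>2 z)"

definition in_lattice :: "int \<Rightarrow> complex \<Rightarrow> complex \<Rightarrow> bool" where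
  "in_lattice k x y \<longleftrightarrow> homog k x y \<in> germs0 T"

definition laurent :: "int set \<Rightarrow> (int \<Rightarrow> complex) \<Rightarrow> (int \<Rightarrow> complex) \<Rightarrow> complex \<Rightarrow> 'v" where
  "laurent K b a = (\<lambda>z. (\<Sum>k\<in>K. b k * z powi k) \<odot> \<sigma>1 z + (\<Sum>k\<in>K. a k * z powi k) \<odot> \<sigma>2 z)"

lemma laurent_single: "laurent {k} b a = homog k (b k) (a k)"
  by (simp add: laurent_def homog_def mult.commute)

lemma laurent_insert:
  assumes "finite K" "k \<notin> K"
  shows "laurent (insert k K) b a z = homog k (b k) (a k) z + laurent K b a z"
  using assms by (simp add: laurent_def homog_def V.vs.scale_left_distrib mult.commute add_ac)

lemma laurent_comb: "d \<odot> laurent K b a z + laurent K b' a' z = laurent K (\<lambda>k. d * b k + b' k) (\<lambda>k. d * a k + a' k) z"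
  by (simp add: laurent_def V.vs.scale_right_distrib V.vs.scale_left_distrib sum.distrib sum_distrib_left
      distrib_right mult.assoc add_ac)

lemma laurent_only:
  assumes K: "finite K" "k0 \<in> K" and 0: "\<And>k. k \<in> K \<Longrightarrow> k \<noteq> k0 \<Longrightarrow> b k = 0 \<and> a k = 0"
  shows "laurent K b a = homog k0 (b k0) (a k0)"
proof -
  have s: "(\<Sum>k\<in>K. h k * z powi k) = h k0 * z powi k0" if "\<And>k. k \<in> K \<Longrightarrow> k \<noteq> k0 \<Longrightarrow> h k = 0" for h and z :: complex
  proof -
    have "(\<Sum>k\<in>K. h k * z powi k) = (\<Sum>k\<in>{k0}. h k * z powi k)"
      using K that by (intro sum.mono_neutral_right) auto
    then show ?thesis by simp
  qed
  show ?thesis unfolding laurent_def homog_def using s[of b] s[of a] 0 by (auto simp: mult.commute)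
qed

lemma laurent_cong: "(\<And>k. k \<in> K \<Longrightarrow> b k = b' k \<and> a k = a' k) \<Longrightarrow> laurent K b a = laurent K b' a'"
  unfolding laurent_def by (intro ext arg_cong2[of _ _ _ _ "(+)"] arg_cong2[of _ _ _ _ smul] sum.cong) auto

lemma powi_deriv: "z \<noteq> 0 \<Longrightarrow> z * (of_int k * z powi (k - 1)) = of_int k * z powi k" for z :: complex
  by (simp add: power_int_diff)

lemma holomorphic_lsum: "(\<lambda>z. \<Sum>k\<in>K. b k * z powi k) holomorphic_on - {0}"
  by (intro holomorphic_intros) auto

lemma theta_laurent:
  assumes z: "z \<noteq> 0"
  shows "theta (laurent K b a) z = laurent K (\<lambda>k. (\<alpha>1 + of_int k) * b k + c * a k) (\<lambda>k. (\<alpha>2 + of_int k) * a k) z"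
proof -
  have d: "z * deriv (\<lambda>z. \<Sum>k\<in>K. h k * z powi k) z = (\<Sum>k\<in>K. of_int k * h k * z powi k)" for h
  proof -
    have "((\<lambda>z. \<Sum>k\<in>K. h k * z powi k) has_field_derivative (\<Sum>k\<in>K. h k * (of_int k * z powi (k - 1)))) (at z)"
      using z by (auto intro!: derivative_eq_intros sum.cong simp: mult_ac)
    then have "z * deriv (\<lambda>z. \<Sum>k\<in>K. h k * z powi k) z = (\<Sum>k\<in>K. h k * (z * (of_int k * z powi (k - 1))))"
      by (simp add: DERIV_imp_deriv sum_distrib_left mult.left_commute)
    then show ?thesis unfolding powi_deriv[OF z] by (simp add: mult_ac)
  qed
  have t1: "theta \<sigma>1 z = \<alpha>1 \<odot> \<sigma>1 z + 0 \<odot> \<sigma>2 z" and t2: "theta \<sigma>2 z = c \<odot> \<sigma>1 z + \<alpha>2 \<odot> \<sigma>2 z"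
    using sigma(4,5)[OF z] by simp_all
  have "theta (laurent K b a) z =
     (z * deriv (\<lambda>z. \<Sum>k\<in>K. b k * z powi k) z + \<alpha>1 * (\<Sum>k\<in>K. b k * z powi k) + c * (\<Sum>k\<in>K. a k * z powi k)) \<odot> \<sigma>1 z
     + (z * deriv (\<lambda>z. \<Sum>k\<in>K. a k * z powi k) z + 0 * (\<Sum>k\<in>K. b k * z powi k) + \<alpha>2 * (\<Sum>k\<in>K. a k * z powi k)) \<odot> \<sigma>2 z"
    unfolding laurent_def
    by (rule theta_comb_in_frame[OF _ _ frame2D(2,3)[OF sigma(1)] holomorphic_lsum holomorphic_lsum _ t1 t2])
       (use z in auto)
  then show ?thesis
    unfolding d laurent_def by (simp add: sum_distrib_left sum.distrib[symmetric] algebra_simps)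
qed

lemma laurent_germ_theta:
  assumes "laurent K b a \<in> germs0 T"
  shows "laurent K (\<lambda>k. (\<alpha>1 + of_int k) * b k + c * a k) (\<lambda>k. (\<alpha>2 + of_int k) * a k) \<in> germs0 T"
  by (rule germs0_cong[OF theta_germ[OF assms]], rule eventually_mono[OF eventually_at_0_nz], rule theta_laurent)

lemma laurent_germ_comb:
  assumes "laurent K b a \<in> germs0 T" "laurent K b' a' \<in> germs0 T"
  shows "laurent K (\<lambda>k. d * b k + b' k) (\<lambda>k. d * a k + a' k) \<in> germs0 T"
  using germs0_comb[OF assms, of "\<lambda>_. d" "\<lambda>_. 1"] laurent_comb[of d K b a _ b' a']
  by (simp add: analytic_on_const)

text \<open>On the generalised eigenspaces a polynomial \<open>p\<close> in \<open>theta\<close> acts through the values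
  of \<open>p\<close> and, because of the nilpotent part \<open>c\<close>, of its derivative.\<close>

lemma laurent_germ_poly:
  assumes "laurent K b a \<in> germs0 T"
  shows "laurent K (\<lambda>k. poly p (\<alpha>1 + of_int k) * b k + c * poly (pderiv p) (\<alpha>1 + of_int k) * a k)
     (\<lambda>k. poly p (\<alpha>2 + of_int k) * a k) \<in> germs0 T"
proof (induction p)
  case 0
  have "laurent K b a = laurent K b a" ..
  show ?case using laurent_germ_comb[OF assms assms, of "-1"] by simp
next
  case (pCons d p)
  have e: "c * (poly p (\<alpha>1 + of_int k)) = c * poly p (\<alpha>2 + of_int k)" for k
    using sigma(6) by (cases "c = 0") auto
  show ?case
    using laurent_germ_comb[OF assms laurent_germ_theta[OF pCons.IH], of d]
  proof (rule back_subst[where P = "\<lambda>s. s \<in> germs0 T"], intro laurent_cong conjI)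
    fix k
    show "d * b k + ((\<alpha>1 + of_int k) * (poly p (\<alpha>1 + of_int k) * b k + c * poly (pderiv p) (\<alpha>1 + of_int k) * a k)
         + c * (poly p (\<alpha>2 + of_int k) * a k))
       = poly (pCons d p) (\<alpha>1 + of_int k) * b k + c * poly (pderiv (pCons d p)) (\<alpha>1 + of_int k) * a k"
      unfolding mult.assoc[symmetric] e[symmetric] by (simp add: pderiv_pCons algebra_simps)
  qed (simp add: algebra_simps)
qed

text \<open>The lattice is stable under \<open>theta\<close>, hence under every polynomial in \<open>theta\<close>, in particular under
the projections to its generalised eigenspaces.\<close>

lemma laurent_homogeneous:
  assumes g: "laurent K b a \<in> germs0 T" and K: "finite K" "k \<in> K"
  shows "\<alpha>1 = \<alpha>2 \<Longrightarrow> in_lattice k (b k) (a k)" and "\<alpha>1 \<noteq> \<alpha>2 \<Longrightarrow> in_lattice k (b k) 0 \<and> in_lattice k 0 (a k)"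
proof -
  define E where "E = (\<lambda>k. \<alpha>1 + of_int k) ` K \<union> (\<lambda>k. \<alpha>2 + of_int k) ` K"
  have cut: "\<exists>p. poly p \<beta> = 1 \<and> poly (pderiv p) \<beta> = 0 \<and> (\<forall>x\<in>E - {\<beta>}. poly p x = 0 \<and> poly (pderiv p) x = 0)" for \<beta>
    using K by (intro hermite_cutoff_polynomial) (auto simp: E_def)
  have E: "\<alpha>1 + of_int j \<in> E" "\<alpha>2 + of_int j \<in> E" if "j \<in> K" for j using that by (auto simp: E_def)
  show "in_lattice k (b k) (a k)" if eq: "\<alpha>1 = \<alpha>2"
  proof -
    obtain p where p: "poly p (\<alpha>1 + of_int k) = 1" "poly (pderiv p) (\<alpha>1 + of_int k) = 0"
      "\<And>x. x \<in> E - {\<alpha>1 + of_int k} \<Longrightarrow> poly p x = 0 \<and> poly (pderiv p) x = 0" using cut by blast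
    have v: "poly p (\<alpha>1 + of_int j) = (if j = k then 1 else 0) \<and> poly (pderiv p) (\<alpha>1 + of_int j) = 0" if "j \<in> K" for j
      using p(1,2) p(3)[of "\<alpha>1 + of_int j"] E[OF that] by auto
    show ?thesis using laurent_germ_poly[OF g, of p] laurent_only[OF K] v eq p(1,2) unfolding in_lattice_def
      by (subst (asm) laurent_only[OF K]) auto
  qed
  show "in_lattice k (b k) 0 \<and> in_lattice k 0 (a k)" if ne: "\<alpha>1 \<noteq> \<alpha>2"
  proof
    have c0: "c = 0" using sigma(6) ne by blast
    have ni: "\<alpha>1 + of_int i \<noteq> \<alpha>2 + of_int j" for i j
    proof
      assume "\<alpha>1 + of_int i = \<alpha>2 + of_int j"
      then have "\<alpha>1 - \<alpha>2 = of_int (j - i)" by (simp add: algebra_simps)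
      then have "\<alpha>1 - \<alpha>2 \<in> \<int>" by (metis Ints_of_int)
      then show False using sigma(7) ne by blast
    qed
    obtain p where p: "poly p (\<alpha>1 + of_int k) = 1"
      "\<And>x. x \<in> E - {\<alpha>1 + of_int k} \<Longrightarrow> poly p x = 0" using cut by blast
    have v: "poly p (\<alpha>1 + of_int j) = (if j = k then 1 else 0)" "poly p (\<alpha>2 + of_int j) = 0" if "j \<in> K" for j
      using p(1) p(2)[of "\<alpha>1 + of_int j"] p(2)[of "\<alpha>2 + of_int j"] E[OF that] ni[of k j] by auto
    show "in_lattice k (b k) 0" using laurent_germ_poly[OF g, of p] v K unfolding in_lattice_def c0
      by (subst (asm) laurent_only[OF K]) auto
    obtain q where q: "poly q (\<alpha>2 + of_int k) = 1"
      "\<And>x. x \<in> E - {\<alpha>2 + of_int k} \<Longrightarrow> poly q x = 0" using cut by blast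
    have v: "poly q (\<alpha>2 + of_int j) = (if j = k then 1 else 0)" "poly q (\<alpha>1 + of_int j) = 0" if "j \<in> K" for j
      using q(1) q(2)[of "\<alpha>2 + of_int j"] q(2)[of "\<alpha>1 + of_int j"] E[OF that] ni[of j k] by auto
    show "in_lattice k 0 (a k)" using laurent_germ_poly[OF g, of q] v K unfolding in_lattice_def c0
      by (subst (asm) laurent_only[OF K]) auto
  qed
qed

lemma in_lattice_comb: "in_lattice k x y \<Longrightarrow> in_lattice k x' y' \<Longrightarrow> in_lattice k (d * x + d' * x') (d * y + d' * y')"
proof -
  assume "in_lattice k x y" "in_lattice k x' y'"
  then have "(\<lambda>z. d \<odot> homog k x y z + d' \<odot> homog k x' y' z) \<in> germs0 T"
    unfolding in_lattice_def by (rule germs0_comb) (auto simp: analytic_on_const)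
  then show ?thesis unfolding in_lattice_def
    by (simp add: homog_def V.vs.scale_right_distrib V.vs.scale_left_distrib distrib_left mult_ac add_ac)
qed

lemma in_lattice_mono: 
  assumes "in_lattice k x y" "k \<le> k'" shows "in_lattice k' x y"
proof -
  have "(\<lambda>z. z ^ nat (k' - k) \<odot> homog k x y z) \<in> germs0 T"
    using assms(1) unfolding in_lattice_def by (rule germs0_scale) (auto intro!: analytic_intros)
  then have "homog k' x y \<in> germs0 T"
  proof (rule germs0_cong)
    show "\<forall>\<^sub>F z in at 0. z ^ nat (k' - k) \<odot> homog k x y z = homog k' x y z"
      using eventually_at_0_nz
    proof eventually_elim
      case (elim z)
      have "z ^ nat (k' - k) * z powi k = z powi k'"
        using elim assms(2) power_int_add[of z "k' - k" k] by (simp add: power_int_def)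
      then show ?case by (simp add: homog_def V.vs.scale_right_distrib mult.assoc[symmetric])
    qed
  qed
  then show ?thesis by (simp add: in_lattice_def)
qed

lemma in_lattice_split: "\<alpha>1 \<noteq> \<alpha>2 \<Longrightarrow> in_lattice k x y \<Longrightarrow> in_lattice k x 0 \<and> in_lattice k 0 y"
  using laurent_homogeneous(2)[of "{k}" "\<lambda>_. x" "\<lambda>_. y" k] by (simp add: laurent_single in_lattice_def)

lemma in_lattice_nilpotent: 
  assumes "in_lattice k x y" shows "in_lattice k (c * y) 0"
proof (cases "c = 0")
  case True
  then show ?thesis using in_lattice_comb[OF assms assms, of 0 0] by simp
next
  case False
  then have eq: "\<alpha>1 = \<alpha>2" by (rule sigma(6))
  have "in_lattice k ((\<alpha>1 + of_int k) * x + c * y) ((\<alpha>2 + of_int k) * y)"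
    using assms laurent_germ_theta[of "{k}" "\<lambda>_. x" "\<lambda>_. y"] by (simp add: laurent_single in_lattice_def)
  then have "in_lattice k (1 * ((\<alpha>1 + of_int k) * x + c * y) + (- (\<alpha>1 + of_int k)) * x)
      (1 * ((\<alpha>2 + of_int k) * y) + (- (\<alpha>1 + of_int k)) * y)" using assms by (rule in_lattice_comb)
  moreover have "1 * ((\<alpha>1 + of_int k) * x + c * y) + (- (\<alpha>1 + of_int k)) * x = c * y"
    "1 * ((\<alpha>2 + of_int k) * y) + (- (\<alpha>1 + of_int k)) * y = 0" by (auto simp: eq algebra_simps)
  ultimately show ?thesis by metis
qed

text \<open>Every germ is a finite sum of homogeneous sections in the lattice plus a remainder divisible by
\<open>z\<^sup>N\<close>: modulo such remainders, which lie in the lattice, the germ is a Laurent polynomial, and this can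
be projected to its homogeneous parts.\<close>

lemma lattice_structure:
  obtains N :: nat where
    "\<And>k x y. k \<ge> int N \<Longrightarrow> in_lattice k x y"
    "\<And>k x y. in_lattice k x y \<Longrightarrow> x \<noteq> 0 \<or> y \<noteq> 0 \<Longrightarrow> - int N \<le> k"
    "\<And>t. t \<in> germs0 T \<Longrightarrow> \<exists>K b a F G. finite K \<and> (\<forall>k\<in>K. in_lattice k (b k) (a k)) \<and>
       F analytic_on {0} \<and> G analytic_on {0} \<and>
       (\<forall>\<^sub>F z in at 0. t z = laurent K b a z + (F z \<odot> homog (int N) 1 0 z + G z \<odot> homog (int N) 0 1 z))"
proof -
  obtain N :: nat where N: "(\<lambda>z. z ^ N \<odot> \<sigma>1 z) \<in> germs0 T" "(\<lambda>z. z ^ N \<odot> \<sigma>2 z) \<in> germs0 T"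
    "\<And>t. t \<in> germs0 T \<Longrightarrow> \<exists>F G. F analytic_on {0} \<and> G analytic_on {0} \<and>
       (\<forall>\<^sub>F z in at 0. z ^ N \<odot> t z = F z \<odot> \<sigma>1 z + G z \<odot> \<sigma>2 z)" by (rule lattice_bounds) blast
  have LN: "in_lattice (int N) 1 0" "in_lattice (int N) 0 1" using N(1,2) by (simp_all add: in_lattice_def homog_def)
  have 1: "in_lattice k x y" if "k \<ge> int N" for k x y
    using in_lattice_mono[OF in_lattice_comb[OF LN, of x y] that] by simp
  have 2: "- int N \<le> k" if in_lattice: "in_lattice k x y" and nz: "x \<noteq> 0 \<or> y \<noteq> 0" for k x y
  proof (rule ccontr)
    assume "\<not> - int N \<le> k"
    define m where "m = nat (- int N - k)"
    have m: "m > 0" "int m = - int N - k" using \<open>\<not> - int N \<le> k\<close> by (auto simp: m_def)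
    obtain F G where FG: "F analytic_on {0}" "G analytic_on {0}"
      "\<forall>\<^sub>F z in at 0. z ^ N \<odot> homog k x y z = F z \<odot> \<sigma>1 z + G z \<odot> \<sigma>2 z"
      using N(3) in_lattice unfolding in_lattice_def by blast
    have ev: "\<forall>\<^sub>F z in at 0. x = z ^ m * F z \<and> y = z ^ m * G z"
      using FG(3) eventually_at_0_nz
    proof eventually_elim
      case (elim z)
      have pw: "z ^ m * (z ^ N * z powi k) = 1"
      proof -
        have "z ^ m * (z ^ N * z powi k) = z powi (int m + (int N + k))"
          using elim(2) by (simp add: power_int_add)
        then show ?thesis using m by simp
      qed
      have "(z ^ N * z powi k * x) \<odot> \<sigma>1 z + (z ^ N * z powi k * y) \<odot> \<sigma>2 z = F z \<odot> \<sigma>1 z + G z \<odot> \<sigma>2 z"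
        using elim(1) by (simp add: homog_def V.vs.scale_right_distrib mult.assoc)
      then have "z ^ N * z powi k * x = F z" "z ^ N * z powi k * y = G z"
        using V.indep2D[OF sigma_indep[OF elim(2)]] by blast+
      then show ?case using pw by (metis mult.assoc mult_1)
    qed
    have "x = 0" by (rule power_times_analytic_eq_const[OF FG(1) m(1)], use ev in eventually_elim) simp
    moreover have "y = 0" by (rule power_times_analytic_eq_const[OF FG(2) m(1)], use ev in eventually_elim) simp
    ultimately show False using nz by simp
  qed
  have 3: "\<exists>K b a F G. finite K \<and> (\<forall>k\<in>K. in_lattice k (b k) (a k)) \<and>
       F analytic_on {0} \<and> G analytic_on {0} \<and>
       (\<forall>\<^sub>F z in at 0. t z = laurent K b a z + (F z \<odot> homog (int N) 1 0 z + G z \<odot> homog (int N) 0 1 z))"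
    if t: "t \<in> germs0 T" for t
  proof -
    obtain F G where FG: "F analytic_on {0}" "G analytic_on {0}"
      "\<forall>\<^sub>F z in at 0. z ^ N \<odot> t z = F z \<odot> \<sigma>1 z + G z \<odot> \<sigma>2 z" using N(3) t by blast
    \<comment> \<open>The coordinates of \<open>t\<close> have a pole of order at most \<open>N\<close>; their Laurent expansions are
      cut off at order \<open>N\<close>, that is, the Taylor expansions of \<open>z\<^sup>N t\<close> at order \<open>2 N\<close>.\<close>
    define K where "K = {- int N..<int N}"
    have ex: "\<exists>h H'. H' analytic_on {0} \<and>
       (\<forall>\<^sub>F z in at 0. H z = z ^ N * ((\<Sum>k\<in>K. h k * z powi k) + H' z * z powi int N))"
      if H: "H analytic_on {0}" for H :: "complex \<Rightarrow> complex"
    proof -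
      obtain r where r: "r > 0" "H holomorphic_on ball 0 r" using H by (auto simp: analytic_on_def)
      obtain q H' where q: "H' holomorphic_on ball 0 r"
        "\<And>z. z \<in> ball 0 r \<Longrightarrow> H z = (\<Sum>k<2*N. q k * z ^ k) + z ^ (2*N) * H' z"
        using taylor_remainder_holomorphic[OF r] by blast
      have "H z = z ^ N * ((\<Sum>k\<in>K. q (nat (k + int N)) * z powi k) + H' z * z powi int N)"
        if z: "z \<noteq> 0" "z \<in> ball 0 r" for z
      proof -
        have "(\<Sum>k\<in>K. q (nat (k + int N)) * z powi k) = (\<Sum>k<2*N. q k * z powi (int k - int N))"
          by (rule sum.reindex_bij_witness[of _ "\<lambda>k. int k - int N" "\<lambda>k. nat (k + int N)"])
             (auto simp: K_def)
        then have "z ^ N * (\<Sum>k\<in>K. q (nat (k + int N)) * z powi k) = (\<Sum>k<2*N. q k * (z ^ N * z powi (int k - int N)))"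
          by (simp add: sum_distrib_left mult_ac)
        also have "\<dots> = (\<Sum>k<2*N. q k * z ^ k)"
          using z by (intro sum.cong refl) (simp add: power_int_diff)
        finally show ?thesis unfolding q(2)[OF z(2)]
          by (simp add: distrib_left mult_2 mult_2_right power_add mult_ac)
      qed
      moreover have "H' analytic_on {0}" using q(1) r(1) by (auto simp: analytic_at intro!: exI[of _ "ball 0 r"])
      moreover have "\<forall>\<^sub>F z in at 0. z \<noteq> 0 \<and> z \<in> ball 0 r"
        using r(1) by (auto simp: eventually_at dist_commute intro!: exI[of _ r])
      ultimately show ?thesis
        by (intro exI[of _ "\<lambda>k. q (nat (k + int N))"] exI[of _ H']) (auto elim!: eventually_mono)
    qed
    obtain b F' where F': "F' analytic_on {0}"
      "\<forall>\<^sub>F z in at 0. F z = z ^ N * ((\<Sum>k\<in>K. b k * z powi k) + F' z * z powi int N)" using ex[OF FG(1)] by blast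
    obtain a G' where G': "G' analytic_on {0}"
      "\<forall>\<^sub>F z in at 0. G z = z ^ N * ((\<Sum>k\<in>K. a k * z powi k) + G' z * z powi int N)" using ex[OF FG(2)] by blast
    define rem where "rem = (\<lambda>z. F' z \<odot> homog (int N) 1 0 z + G' z \<odot> homog (int N) 0 1 z)"
    have eq: "\<forall>\<^sub>F z in at 0. t z = laurent K b a z + rem z"
      using FG(3) F'(2) G'(2) eventually_at_0_nz
    proof eventually_elim
      case (elim z)
      have "z ^ N \<odot> t z = z ^ N \<odot> (laurent K b a z + rem z)"
        unfolding elim(1) elim(2) elim(3) laurent_def rem_def homog_def
        by (simp add: V.vs.scale_right_distrib V.vs.scale_left_distrib distrib_left add_ac)
      then show ?case using elim(4) V.vs.scale_left_imp_eq[of "z ^ N"] by auto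
    qed
    have "rem \<in> germs0 T" unfolding rem_def
      using LN F'(1) G'(1) unfolding in_lattice_def by (intro germs0_comb) auto
    then have "(\<lambda>z. 1 \<odot> t z + (- 1) \<odot> rem z) \<in> germs0 T"
      using t by (intro germs0_comb) (auto simp: analytic_on_const)
    then have lpg: "laurent K b a \<in> germs0 T"
      by (rule germs0_cong) (use eq in eventually_elim, simp)
    have "in_lattice k (b k) (a k)" if "k \<in> K" for k
    proof (cases "\<alpha>1 = \<alpha>2")
      case True
      then show ?thesis using laurent_homogeneous(1)[OF lpg _ that] by (simp add: K_def)
    next
      case False
      then have "in_lattice k (b k) 0" "in_lattice k 0 (a k)" using laurent_homogeneous(2)[OF lpg _ that] by (auto simp: K_def)
      then show ?thesis using in_lattice_comb[of k "b k" 0 0 "a k" 1 1] by simp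
    qed
    then show ?thesis using eq F'(1) G'(1) unfolding rem_def
      by (intro exI[of _ K] exI[of _ b] exI[of _ a] exI[of _ F'] exI[of _ G']) (auto simp: K_def)
  qed
  show ?thesis using that[of N] 1 2 3 by blast
qed

end

lemma exp_2pi_eq_iff:
  "exp (- 2 * of_real pi * \<i> * \<beta>) = exp (- 2 * of_real pi * \<i> * \<alpha>) \<longleftrightarrow> (\<exists>k::int. \<beta> = \<alpha> + of_int k)"
proof
  assume "exp (- 2 * of_real pi * \<i> * \<beta>) = exp (- 2 * of_real pi * \<i> * \<alpha>)"
  then obtain k :: int where
    "- 2 * of_real pi * \<i> * \<beta> = - 2 * of_real pi * \<i> * \<alpha> + of_int (2 * k) * pi * \<i>"
    unfolding exp_eq by blast
  then have "(- 2 * of_real pi * \<i>) * \<beta> = (- 2 * of_real pi * \<i>) * (\<alpha> + of_int (- k))"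
    by (simp add: algebra_simps)
  then have "\<beta> = \<alpha> + of_int (- k)" by (subst (asm) mult_left_cancel) auto
  then show "\<exists>k::int. \<beta> = \<alpha> + of_int k" by blast
next
  assume "\<exists>k::int. \<beta> = \<alpha> + of_int k"
  then obtain k :: int where "\<beta> = \<alpha> + of_int k" by blast
  then have "- 2 * of_real pi * \<i> * \<beta> = - 2 * of_real pi * \<i> * \<alpha> + of_int (2 * (- k)) * pi * \<i>"
    by (simp add: algebra_simps)
  then show "exp (- 2 * of_real pi * \<i> * \<beta>) = exp (- 2 * of_real pi * \<i> * \<alpha>)"
    unfolding exp_eq by blast
qed

lemma Nats_antisym:
  fixes x y :: complex
  assumes "x - y \<in> \<nat>" "y - x \<in> \<nat>" shows "x = y"
proof -
  obtain n m where nm: "x - y = of_nat n" "y - x = of_nat m" using assms by (auto simp: Nats_def)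
  then have "of_nat (n + m) = (0::complex)" by (simp add: nm(1)[symmetric] nm(2)[symmetric])
  then have "n = 0" by (simp only: of_nat_eq_0_iff)
  then show ?thesis using nm by simp
qed

text \<open>Two chains of inequalities in opposite directions close up to a cycle.\<close>

lemma exponent_pairs_eq:
  fixes \<beta>1 \<beta>2 \<gamma>1 \<gamma>2 :: complex
  assumes 1: "(\<gamma>1 - \<beta>1 \<in> \<nat> \<and> \<gamma>2 - \<beta>2 \<in> \<nat>) \<or> (\<gamma>1 - \<beta>2 \<in> \<nat> \<and> \<gamma>2 - \<beta>1 \<in> \<nat>)"
    and 2: "(\<beta>1 - \<gamma>1 \<in> \<nat> \<and> \<beta>2 - \<gamma>2 \<in> \<nat>) \<or> (\<beta>1 - \<gamma>2 \<in> \<nat> \<and> \<beta>2 - \<gamma>1 \<in> \<nat>)"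
  shows "(\<gamma>1 = \<beta>1 \<and> \<gamma>2 = \<beta>2) \<or> (\<gamma>1 = \<beta>2 \<and> \<gamma>2 = \<beta>1)"
proof -
  have tr: "x - u \<in> \<nat>" if "x - y \<in> \<nat>" "y - z \<in> \<nat>" "z - u \<in> \<nat>" for x y z u :: complex
  proof -
    have "(x - y) + ((y - z) + (z - u)) \<in> \<nat>" using that by (intro Nats_add)
    then show ?thesis by simp
  qed
  consider "\<gamma>1 - \<beta>1 \<in> \<nat>" "\<gamma>2 - \<beta>2 \<in> \<nat>" "\<beta>1 - \<gamma>1 \<in> \<nat>" "\<beta>2 - \<gamma>2 \<in> \<nat>"
    | "\<gamma>1 - \<beta>1 \<in> \<nat>" "\<gamma>2 - \<beta>2 \<in> \<nat>" "\<beta>1 - \<gamma>2 \<in> \<nat>" "\<beta>2 - \<gamma>1 \<in> \<nat>"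
    | "\<gamma>1 - \<beta>2 \<in> \<nat>" "\<gamma>2 - \<beta>1 \<in> \<nat>" "\<beta>1 - \<gamma>1 \<in> \<nat>" "\<beta>2 - \<gamma>2 \<in> \<nat>"
    | "\<gamma>1 - \<beta>2 \<in> \<nat>" "\<gamma>2 - \<beta>1 \<in> \<nat>" "\<beta>1 - \<gamma>2 \<in> \<nat>" "\<beta>2 - \<gamma>1 \<in> \<nat>"
    using 1 2 by blast
  then show ?thesis
  proof cases
    case 1 then show ?thesis using Nats_antisym by blast
  next
    case 2
    then have "\<beta>1 - \<gamma>1 \<in> \<nat>" "\<beta>2 - \<gamma>2 \<in> \<nat>" using tr by blast+
    then show ?thesis using 2 Nats_antisym by blast
  next
    case 3
    then have "\<beta>2 - \<gamma>1 \<in> \<nat>" "\<beta>1 - \<gamma>2 \<in> \<nat>" using tr by blast+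
    then show ?thesis using 3 Nats_antisym by blast
  next
    case 4 then show ?thesis using Nats_antisym by blast
  qed
qed

context te_rank2
begin

section \<open>Comparison of exponents\<close>

lemma coefficients_euler:
  assumes s: "s1 \<in> hs (- {0})" "s2 \<in> hs (- {0})" "t \<in> hs (- {0})"
    and th: "\<And>z. z \<noteq> 0 \<Longrightarrow> theta s1 z = \<beta>1 \<odot> s1 z" "\<And>z. z \<noteq> 0 \<Longrightarrow> theta s2 z = \<beta>2 \<odot> s2 z"
      "\<And>z. z \<noteq> 0 \<Longrightarrow> theta t z = \<gamma> \<odot> t z"
    and ind: "\<forall>\<^sub>F z in at 0. V.indep2 (s1 z) (s2 z)"
    and F: "F analytic_on {0}" and G: "G analytic_on {0}"
    and eq: "\<forall>\<^sub>F z in at 0. t z = F z \<odot> s1 z + G z \<odot> s2 z"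
  shows "\<forall>\<^sub>F z in at 0. z * deriv F z = (\<gamma> - \<beta>1) * F z" "\<forall>\<^sub>F z in at 0. z * deriv G z = (\<gamma> - \<beta>2) * G z"
proof -
  obtain V1 where V1: "open V1" "0 \<in> V1" "F holomorphic_on V1" using F unfolding analytic_at by blast
  obtain V2 where V2: "open V2" "0 \<in> V2" "G holomorphic_on V2" using G unfolding analytic_at by blast
  obtain V3 where V3: "open V3" "0 \<in> V3" "\<And>z. z \<in> V3 \<Longrightarrow> z \<noteq> 0 \<Longrightarrow> t z = F z \<odot> s1 z + G z \<odot> s2 z"
    using eq unfolding eventually_at_topological by blast
  obtain V4 where V4: "open V4" "0 \<in> V4" "\<And>z. z \<in> V4 \<Longrightarrow> z \<noteq> 0 \<Longrightarrow> V.indep2 (s1 z) (s2 z)"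
    using ind unfolding eventually_at_topological by blast
  define P where "P = V1 \<inter> V2 \<inter> V3 \<inter> V4 - {0}"
  have P: "open P" "0 \<notin> P" using V1 V2 V3 V4 by (auto simp: P_def)
  have sP: "s1 \<in> hs P" "s2 \<in> hs P" "t \<in> hs P"
    using s by (auto simp: P_def intro: hs_mono)
  have FG: "F holomorphic_on P" "G holomorphic_on P"
    using V1 V2 by (auto simp: P_def intro: holomorphic_on_subset)
  have key: "z * deriv F z = (\<gamma> - \<beta>1) * F z \<and> z * deriv G z = (\<gamma> - \<beta>2) * G z" if z: "z \<in> P" for z
  proof -
    have z0: "z \<noteq> 0" and i: "V.indep2 (s1 z) (s2 z)" using z V4(3)[of z] by (auto simp: P_def)
    have tz: "t z = F z \<odot> s1 z + G z \<odot> s2 z" if "z \<in> P" for z using V3(3)[of z] that by (auto simp: P_def)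
    have t1: "theta s1 z = \<beta>1 \<odot> s1 z + 0 \<odot> s2 z" and t2: "theta s2 z = 0 \<odot> s1 z + \<beta>2 \<odot> s2 z"
      using th[OF z0] by simp_all
    have "(\<gamma> * F z) \<odot> s1 z + (\<gamma> * G z) \<odot> s2 z = theta t z"
      unfolding th(3)[OF z0] tz[OF z] by (simp add: V.vs.scale_right_distrib)
    also have "\<dots> = theta (\<lambda>z. F z \<odot> s1 z + G z \<odot> s2 z) z"
      by (rule theta_cong[OF P sP(3) tz z])
    also have "\<dots> = (z * deriv F z + \<beta>1 * F z + 0 * G z) \<odot> s1 z + (z * deriv G z + 0 * F z + \<beta>2 * G z) \<odot> s2 z"
      by (rule theta_comb_in_frame[OF P sP(1,2) FG z t1 t2])
    finally have e: "(\<gamma> * F z) \<odot> s1 z + (\<gamma> * G z) \<odot> s2 z =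
      (z * deriv F z + \<beta>1 * F z + 0 * G z) \<odot> s1 z + (z * deriv G z + 0 * F z + \<beta>2 * G z) \<odot> s2 z" .
    from V.indep2D[OF i e] show ?thesis by (simp add: algebra_simps)
  qed
  have "open (V1 \<inter> V2 \<inter> V3 \<inter> V4)" "0 \<in> V1 \<inter> V2 \<inter> V3 \<inter> V4" using V1 V2 V3 V4 by auto
  then have "\<forall>\<^sub>F z in at 0. z \<in> V1 \<inter> V2 \<inter> V3 \<inter> V4 - {0}" by (rule eventually_at_in_open)
  then have ev: "\<forall>\<^sub>F z in at 0. z \<in> P" by (simp add: P_def)
  show "\<forall>\<^sub>F z in at 0. z * deriv F z = (\<gamma> - \<beta>1) * F z"
    using ev by (rule eventually_mono) (use key in blast)
  show "\<forall>\<^sub>F z in at 0. z * deriv G z = (\<gamma> - \<beta>2) * G z"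
    using ev by (rule eventually_mono) (use key in blast)
qed

text \<open>The coefficients in \<open>t\<^sub>i = F\<^sub>i s\<^sub>1 + G\<^sub>i s\<^sub>2\<close> solve Euler equations with exponents \<open>\<gamma>\<^sub>i - \<beta>\<^sub>j\<close>, so
every nonzero coefficient forces a natural number.  As the determinant is not zero, the diagonal or
the antidiagonal of the coefficient matrix has no zero entry.\<close>

lemma exponents_compare:
  assumes ds: "is_direct_sum0 (germs0 T) (conv_span T s1) (conv_span T s2)"
    and s: "s1 \<in> hs (- {0})" "s2 \<in> hs (- {0})" and t: "t1 \<in> hs (- {0})" "t2 \<in> hs (- {0})"
    and ths: "\<And>z. z \<noteq> 0 \<Longrightarrow> theta s1 z = \<beta>1 \<odot> s1 z" "\<And>z. z \<noteq> 0 \<Longrightarrow> theta s2 z = \<beta>2 \<odot> s2 z"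
    and tht: "\<And>z. z \<noteq> 0 \<Longrightarrow> theta t1 z = \<gamma>1 \<odot> t1 z" "\<And>z. z \<noteq> 0 \<Longrightarrow> theta t2 z = \<gamma>2 \<odot> t2 z"
    and tg: "t1 \<in> germs0 T" "t2 \<in> germs0 T" and ind: "\<forall>\<^sub>F z in at 0. V.indep2 (t1 z) (t2 z)"
  shows "(\<gamma>1 - \<beta>1 \<in> \<nat> \<and> \<gamma>2 - \<beta>2 \<in> \<nat>) \<or> (\<gamma>1 - \<beta>2 \<in> \<nat> \<and> \<gamma>2 - \<beta>1 \<in> \<nat>)"
proof -
  note inds = direct_sumE(3)[OF ds]
  obtain F1 G1 where 1: "F1 analytic_on {0}" "G1 analytic_on {0}"
     "\<forall>\<^sub>F z in at 0. t1 z = F1 z \<odot> s1 z + G1 z \<odot> s2 z"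
    using direct_sumE(4)[OF ds tg(1)] unfolding spanned_def by blast
  obtain F2 G2 where 2: "F2 analytic_on {0}" "G2 analytic_on {0}"
     "\<forall>\<^sub>F z in at 0. t2 z = F2 z \<odot> s1 z + G2 z \<odot> s2 z"
    using direct_sumE(4)[OF ds tg(2)] unfolding spanned_def by blast
  note e1 = coefficients_euler[OF s t(1) ths tht(1) inds 1]
  note e2 = coefficients_euler[OF s t(2) ths tht(2) inds 2]
  have det: "\<forall>\<^sub>F z in at 0. F1 z * G2 z - F2 z * G1 z \<noteq> 0"
    using 1(3) 2(3) ind by eventually_elim (use V.indep2_det in auto)
  have no: "\<not> (\<forall>\<^sub>F z in at (0::complex). False)" by simp
  have or1: "\<not> (\<forall>\<^sub>F z in at 0. A z = 0) \<or> \<not> (\<forall>\<^sub>F z in at 0. B z = 0)"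
    if "\<And>z. A z = 0 \<Longrightarrow> B z = 0 \<Longrightarrow> F1 z * G2 z - F2 z * G1 z = 0" for A B :: "complex \<Rightarrow> complex"
  proof (rule ccontr)
    assume "\<not> ?thesis"
    then have A: "\<forall>\<^sub>F z in at 0. A z = 0" and B: "\<forall>\<^sub>F z in at 0. B z = 0" by auto
    have "\<forall>\<^sub>F z in at (0::complex). False" using det A B by eventually_elim (use that in blast)
    then show False using no by blast
  qed
  have o: "\<not> (\<forall>\<^sub>F z in at 0. F1 z = 0) \<or> \<not> (\<forall>\<^sub>F z in at 0. F2 z = 0)"
    "\<not> (\<forall>\<^sub>F z in at 0. F1 z = 0) \<or> \<not> (\<forall>\<^sub>F z in at 0. G1 z = 0)"
    "\<not> (\<forall>\<^sub>F z in at 0. G2 z = 0) \<or> \<not> (\<forall>\<^sub>F z in at 0. F2 z = 0)"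
    "\<not> (\<forall>\<^sub>F z in at 0. G2 z = 0) \<or> \<not> (\<forall>\<^sub>F z in at 0. G1 z = 0)"
    by (rule or1, simp)+
  have "(\<not> (\<forall>\<^sub>F z in at 0. F1 z = 0) \<and> \<not> (\<forall>\<^sub>F z in at 0. G2 z = 0)) \<or>
        (\<not> (\<forall>\<^sub>F z in at 0. G1 z = 0) \<and> \<not> (\<forall>\<^sub>F z in at 0. F2 z = 0))" using o by blast
  then show ?thesis
    using euler_eq_analytic_exponent[OF 1(1) e1(1)] euler_eq_analytic_exponent[OF 1(2) e1(2)]
      euler_eq_analytic_exponent[OF 2(1) e2(1)] euler_eq_analytic_exponent[OF 2(2) e2(2)] by blast
qed

section \<open>Extension of a frame over the origin\<close>

text \<open>Both generators extend over 0.  There the matrix expressing a holomorphic frame in the generators is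
inverse to the matrix of the generators in that frame; this persists in the limit, so the values of
the generators at 0 are independent.\<close>

lemma global_frame:
  assumes ds: "is_direct_sum0 (germs0 T) (conv_span T s1) (conv_span T s2)"
    and s: "s1 \<in> hs (- {0})" "s2 \<in> hs (- {0})" and ind: "\<And>z. z \<noteq> 0 \<Longrightarrow> V.indep2 (s1 z) (s2 z)"
  obtains a b where "frame2 UNIV a b" "\<And>z. z \<noteq> 0 \<Longrightarrow> a z = s1 z" "\<And>z. z \<noteq> 0 \<Longrightarrow> b z = s2 z"
proof -
  have ext: "\<exists>a\<in>hs UNIV. \<forall>z. z \<noteq> 0 \<longrightarrow> a z = s z" if sg: "s \<in> germs0 T" and sh: "s \<in> hs (- {0})" for s
  proof -
    obtain U t where U: "open U" "0 \<in> U" "t \<in> hs U" "\<And>z. z \<in> U - {0} \<Longrightarrow> s z = t z"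
      using sg unfolding germs0_def by blast
    define a where "a = (\<lambda>z. if z = 0 then t 0 else s z)"
    have aU: "a \<in> hs U" by (rule hs_cong[OF U(3)]) (use U(4) in \<open>auto simp: a_def\<close>)
    have aP: "a \<in> hs (- {0})" by (rule hs_cong[OF sh]) (auto simp: a_def)
    have "a \<in> hs UNIV"
    proof (rule hs_local[OF open_UNIV])
      fix z :: complex
      show "\<exists>V. open V \<and> z \<in> V \<and> a \<in> hs V"
      proof (cases "z = 0")
        case True then show ?thesis using U aU by blast
      next
        case False then show ?thesis using aP by (intro exI[of _ "- {0}"]) auto
      qed
    qed
    then show ?thesis by (rule bexI[rotated]) (simp add: a_def)
  qed
  obtain a where a: "a \<in> hs UNIV" "\<And>z. z \<noteq> 0 \<Longrightarrow> a z = s1 z" using ext[OF direct_sumE(1)[OF ds] s(1)] by blast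
  obtain b where b: "b \<in> hs UNIV" "\<And>z. z \<noteq> 0 \<Longrightarrow> b z = s2 z" using ext[OF direct_sumE(2)[OF ds] s(2)] by blast
  obtain U e1 e2 where fr: "frame2 U e1 e2" "0 \<in> U" by (rule frame_at)
  note fr' = frame2D[OF fr(1)]
  obtain f1 g1 where 1: "f1 analytic_on {0}" "g1 analytic_on {0}"
    "\<forall>\<^sub>F z in at 0. e1 z = f1 z \<odot> s1 z + g1 z \<odot> s2 z"
    using direct_sumE(4)[OF ds germs0_of_section[OF fr'(2,1) fr(2)]] unfolding spanned_def by blast
  obtain f2 g2 where 2: "f2 analytic_on {0}" "g2 analytic_on {0}"
    "\<forall>\<^sub>F z in at 0. e2 z = f2 z \<odot> s1 z + g2 z \<odot> s2 z"
    using direct_sumE(4)[OF ds germs0_of_section[OF fr'(3,1) fr(2)]] unfolding spanned_def by blast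
  have aU: "a \<in> hs U" "b \<in> hs U" using hs_mono[OF a(1)] hs_mono[OF b(1)] by auto
  obtain p1 q1 where p1: "p1 holomorphic_on U" "q1 holomorphic_on U"
    "\<And>z. z \<in> U \<Longrightarrow> a z = p1 z \<odot> e1 z + q1 z \<odot> e2 z" using frame2_coords[OF fr(1) aU(1)] by metis
  obtain p2 q2 where p2: "p2 holomorphic_on U" "q2 holomorphic_on U"
    "\<And>z. z \<in> U \<Longrightarrow> b z = p2 z \<odot> e1 z + q2 z \<odot> e2 z" using frame2_coords[OF fr(1) aU(2)] by metis
  \<comment> \<open>The product of the determinants of the two mutually inverse matrices.\<close>
  define D where "D = (\<lambda>z. (p1 z * q2 z - p2 z * q1 z) * (f1 z * g2 z - f2 z * g1 z))"
  have "\<forall>\<^sub>F z in at 0. z \<in> U - {0}" using fr'(1) fr(2) by (rule eventually_at_in_open)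
  then have D1: "\<forall>\<^sub>F z in at 0. D z = 1"
    using 1(3) 2(3)
  proof eventually_elim
    case (elim z)
    then have z: "z \<in> U" "z \<noteq> 0" by auto
    have e1: "1 \<odot> e1 z + 0 \<odot> e2 z = (f1 z * p1 z + g1 z * p2 z) \<odot> e1 z + (f1 z * q1 z + g1 z * q2 z) \<odot> e2 z"
    proof -
      have "1 \<odot> e1 z + 0 \<odot> e2 z = f1 z \<odot> a z + g1 z \<odot> b z"
        using elim(2) a(2)[OF z(2)] b(2)[OF z(2)] by simp
      then show ?thesis unfolding p1(3)[OF z(1)] p2(3)[OF z(1)] V.comb_comb .
    qed
    have e2: "0 \<odot> e1 z + 1 \<odot> e2 z = (f2 z * p1 z + g2 z * p2 z) \<odot> e1 z + (f2 z * q1 z + g2 z * q2 z) \<odot> e2 z"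
    proof -
      have "0 \<odot> e1 z + 1 \<odot> e2 z = f2 z \<odot> a z + g2 z \<odot> b z"
        using elim(3) a(2)[OF z(2)] b(2)[OF z(2)] by simp
      then show ?thesis unfolding p1(3)[OF z(1)] p2(3)[OF z(1)] V.comb_comb .
    qed
    note i1 = V.indep2D[OF fr'(4)[OF z(1)] e1] and i2 = V.indep2D[OF fr'(4)[OF z(1)] e2]
    have "D z = (f1 z * p1 z + g1 z * p2 z) * (f2 z * q1 z + g2 z * q2 z)
        - (f1 z * q1 z + g1 z * q2 z) * (f2 z * p1 z + g2 z * p2 z)"
      by (simp add: D_def algebra_simps)
    then show ?case unfolding i1[symmetric] i2[symmetric] by simp
  qed
  have cont: "isCont h 0" if "h holomorphic_on U" for h
    using that fr'(1) fr(2) by (intro continuous_on_interior[of U] holomorphic_on_imp_continuous_on)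
      (auto simp: interior_open)
  have "isCont D 0" unfolding D_def
    by (intro continuous_intros cont p1 p2 analytic_at_imp_isCont 1 2)
  then have "(D \<longlongrightarrow> D 0) (at 0)" by (simp add: isCont_def)
  moreover have "(D \<longlongrightarrow> 1) (at 0)" using D1 by (rule tendsto_eventually)
  ultimately have "D 0 = 1" using tendsto_unique trivial_limit_at by blast
  then have "p1 0 * q2 0 - p2 0 * q1 0 \<noteq> 0" by (auto simp: D_def)
  then have "V.indep2 (a 0) (b 0)"
    unfolding p1(3)[OF fr(2)] p2(3)[OF fr(2)] using V.indep2_det_iff[OF fr'(4)[OF fr(2)]] by blast
  then have "V.indep2 (a z) (b z)" for z using a(2) b(2) ind by (cases "z = 0") auto
  then show ?thesis using that[of a b] a b by (auto simp: frame2_def)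
qed

end

section \<open>Isomorphisms\<close>

text \<open>The isomorphism identifies the two global frames.  A section is holomorphic iff its coordinates are,
and the Leibniz rule determines the connection from its matrix.\<close>

lemma te_isomorphic_of_frames:
  fixes T :: "('v::ab_group_add) te" and T' :: "('w::ab_group_add) te"
  assumes X: "te_rank2 T" and Y: "te_rank2 T'"
    and fr: "te_rank2.frame2 T UNIV a b" and fr': "te_rank2.frame2 T' UNIV a' b'"
    and th: "\<And>z. z \<noteq> 0 \<Longrightarrow> te_rank2.theta T a z = scl T (p1 z) (a z) + scl T (q1 z) (b z)"
      "\<And>z. z \<noteq> 0 \<Longrightarrow> te_rank2.theta T b z = scl T (p2 z) (a z) + scl T (q2 z) (b z)"
    and th': "\<And>z. z \<noteq> 0 \<Longrightarrow> te_rank2.theta T' a' z = scl T' (p1 z) (a' z) + scl T' (q1 z) (b' z)"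
      "\<And>z. z \<noteq> 0 \<Longrightarrow> te_rank2.theta T' b' z = scl T' (p2 z) (a' z) + scl T' (q2 z) (b' z)"
  shows "te_isomorphic T T'"
proof -
  interpret X: te_rank2 T by (rule X)
  interpret Y: te_rank2 T' by (rule Y)
  note fX = X.frame2D[OF fr] and fY = Y.frame2D[OF fr']
  define \<phi> where "\<phi> z x = (let cd = (SOME cd. x = scl T (fst cd) (a z) + scl T (snd cd) (b z))
     in scl T' (fst cd) (a' z) + scl T' (snd cd) (b' z))" for z x
  have phi: "\<phi> z (scl T c (a z) + scl T d (b z)) = scl T' c (a' z) + scl T' d (b' z)" for z c d
  proof -
    define cd where "cd = (SOME cd. scl T c (a z) + scl T d (b z) = scl T (fst cd) (a z) + scl T (snd cd) (b z))"
    have e: "scl T c (a z) + scl T d (b z) = scl T (fst cd) (a z) + scl T (snd cd) (b z)"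
      unfolding cd_def by (rule someI[of _ "(c, d)"]) simp
    have "c = fst cd" "d = snd cd" by (rule X.V.indep2D[OF fX(4)[OF UNIV_I] e])+
    then show ?thesis unfolding \<phi>_def cd_def[symmetric] Let_def by simp
  qed
  have coX: "\<exists>c d. x = scl T c (a z) + scl T d (b z)" if "x \<in> fib T z" for x z
    using X.fib_basis[OF X.hs_fib[OF fX(2)] X.hs_fib[OF fX(3)] that fX(4)] by blast
  have coY: "\<exists>c d. x = scl T' c (a' z) + scl T' d (b' z)" if "x \<in> fib T' z" for x z
    using Y.fib_basis[OF Y.hs_fib[OF fY(2)] Y.hs_fib[OF fY(3)] that fY(4)] by blast
  have inX: "scl T c (a z) + scl T d (b z) \<in> fib T z" for c d z
    using X.fib_comb[OF X.hs_fib[OF fX(2)] X.hs_fib[OF fX(3)]] by blast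
  have inY: "scl T' c (a' z) + scl T' d (b' z) \<in> fib T' z" for c d z
    using Y.fib_comb[OF Y.hs_fib[OF fY(2)] Y.hs_fib[OF fY(3)]] by blast
  have bij: "bij_betw (\<phi> z) (fib T z) (fib T' z)" for z
    unfolding bij_betw_def
  proof (intro conjI inj_onI equalityI subsetI)
    fix x y assume xy: "x \<in> fib T z" "y \<in> fib T z" "\<phi> z x = \<phi> z y"
    obtain c d c' d' where cd: "x = scl T c (a z) + scl T d (b z)" "y = scl T c' (a z) + scl T d' (b z)"
      using coX xy by metis
    then have e: "scl T' c (a' z) + scl T' d (b' z) = scl T' c' (a' z) + scl T' d' (b' z)"
      using xy(3) by (simp add: phi)
    show "x = y" unfolding cd Y.V.indep2D[OF fY(4)[OF UNIV_I] e] ..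
  next
    fix y assume "y \<in> \<phi> z ` fib T z"
    then show "y \<in> fib T' z" using coX phi inY by (metis imageE)
  next
    fix y assume "y \<in> fib T' z"
    then show "y \<in> \<phi> z ` fib T z" using coY phi inX by (metis imageI)
  qed
  have add: "\<phi> z (x + y) = \<phi> z x + \<phi> z y" if xy: "x \<in> fib T z" "y \<in> fib T z" for x y z
  proof -
    obtain c d c' d' where cd: "x = scl T c (a z) + scl T d (b z)" "y = scl T c' (a z) + scl T d' (b z)"
      using coX xy by metis
    have "x + y = scl T (c + c') (a z) + scl T (d + d') (b z)"
      unfolding cd by (simp add: X.V.vs.scale_left_distrib add_ac)
    then show ?thesis unfolding cd by (simp add: phi Y.V.vs.scale_left_distrib add_ac)
  qed
  have scale: "\<phi> z (scl T k x) = scl T' k (\<phi> z x)" if x: "x \<in> fib T z" for k x z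
  proof -
    obtain c d where cd: "x = scl T c (a z) + scl T d (b z)" using coX x by metis
    have "scl T k x = scl T (k * c) (a z) + scl T (k * d) (b z)"
      unfolding cd by (simp add: X.V.vs.scale_right_distrib)
    then show ?thesis unfolding cd by (simp add: phi Y.V.vs.scale_right_distrib)
  qed
  have sec: "s \<in> hsections T U \<longleftrightarrow> (\<lambda>z. \<phi> z (s z)) \<in> hsections T' U"
    if U: "open U" and sf: "\<And>z. z \<in> U \<Longrightarrow> s z \<in> fib T z" for U s
  proof
    assume s: "s \<in> hsections T U"
    have f1: "X.frame2 U a b" by (rule X.frame2_mono[OF fr _ U]) auto
    obtain f g where fg: "f holomorphic_on U" "g holomorphic_on U"
      "\<And>z. z \<in> U \<Longrightarrow> s z = scl T (f z) (a z) + scl T (g z) (b z)" using X.frame2_coords[OF f1 s] by metis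
    have "(\<lambda>z. scl T' (f z) (a' z) + scl T' (g z) (b' z)) \<in> hsections T' U"
      by (rule Y.hs_comb[OF Y.hs_mono[OF fY(2)] Y.hs_mono[OF fY(3)] fg(1,2)]) auto
    then show "(\<lambda>z. \<phi> z (s z)) \<in> hsections T' U"
      by (rule Y.hs_cong) (simp add: fg(3) phi)
  next
    assume s: "(\<lambda>z. \<phi> z (s z)) \<in> hsections T' U"
    have f1: "Y.frame2 U a' b'" by (rule Y.frame2_mono[OF fr' _ U]) auto
    obtain f g where fg: "f holomorphic_on U" "g holomorphic_on U"
      "\<And>z. z \<in> U \<Longrightarrow> \<phi> z (s z) = scl T' (f z) (a' z) + scl T' (g z) (b' z)"
      using Y.frame2_coords[OF f1 s] by metis
    have "(\<lambda>z. scl T (f z) (a z) + scl T (g z) (b z)) \<in> hsections T U"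
      by (rule X.hs_comb[OF X.hs_mono[OF fX(2)] X.hs_mono[OF fX(3)] fg(1,2)]) auto
    then show "s \<in> hsections T U"
    proof (rule X.hs_cong)
      fix z assume z: "z \<in> U"
      obtain c d where cd: "s z = scl T c (a z) + scl T d (b z)" using coX sf[OF z] by metis
      then have e: "scl T' c (a' z) + scl T' d (b' z) = scl T' (f z) (a' z) + scl T' (g z) (b' z)"
        using fg(3)[OF z] by (simp add: phi)
      show "scl T (f z) (a z) + scl T (g z) (b z) = s z"
        unfolding cd Y.V.indep2D[OF fY(4)[OF UNIV_I] e] ..
    qed
  qed
  have con: "nabla T' (\<lambda>x. \<phi> x (s x)) z = \<phi> z (nabla T s z)"
    if U: "open U" "0 \<notin> U" and s: "s \<in> hsections T U" and z: "z \<in> U" for U s z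
  proof -
    have z0: "z \<noteq> 0" using U z by auto
    have f1: "X.frame2 U a b" by (rule X.frame2_mono[OF fr _ U(1)]) auto
    obtain f g where fg: "f holomorphic_on U" "g holomorphic_on U"
      "\<And>z. z \<in> U \<Longrightarrow> s z = scl T (f z) (a z) + scl T (g z) (b z)" using X.frame2_coords[OF f1 s] by metis
    have aU: "a \<in> hsections T U" "b \<in> hsections T U" "a' \<in> hsections T' U" "b' \<in> hsections T' U"
      by (rule X.hs_mono[OF fX(2)] X.hs_mono[OF fX(3)] Y.hs_mono[OF fY(2)] Y.hs_mono[OF fY(3)], rule subset_UNIV)+
    have sU: "(\<lambda>z. \<phi> z (s z)) \<in> hsections T' U"
      using sec[OF U(1)] X.hs_fib[OF s] s by blast
    let ?F = "z * deriv f z + p1 z * f z + p2 z * g z"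
    let ?G = "z * deriv g z + q1 z * f z + q2 z * g z"
    have "X.theta s z = scl T ?F (a z) + scl T ?G (b z)"
      using X.theta_cong[OF U s fg(3) z] X.theta_comb_in_frame[OF U aU(1,2) fg(1,2) z th(1)[OF z0] th(2)[OF z0]] by simp
    moreover have "Y.theta (\<lambda>x. \<phi> x (s x)) z = scl T' ?F (a' z) + scl T' ?G (b' z)"
    proof -
      have "Y.theta (\<lambda>x. \<phi> x (s x)) z = Y.theta (\<lambda>z. scl T' (f z) (a' z) + scl T' (g z) (b' z)) z"
        by (rule Y.theta_cong[OF U sU _ z]) (simp add: fg(3) phi)
      then show ?thesis
        using Y.theta_comb_in_frame[OF U aU(3,4) fg(1,2) z th'(1)[OF z0] th'(2)[OF z0]] by simp
    qed
    ultimately have "Y.theta (\<lambda>x. \<phi> x (s x)) z = \<phi> z (X.theta s z)" by (simp add: phi)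
    also have "\<dots> = scl T' z (\<phi> z (nabla T s z))"
      unfolding X.theta_def by (rule scale) (rule X.hs_fib[OF X.nabla_hs[OF U s] z])
    finally show ?thesis unfolding Y.theta_def using z0 Y.V.vs.scale_left_imp_eq[OF z0] by blast
  qed
  show ?thesis unfolding te_isomorphic_def
  proof (intro exI[of _ \<phi>] conjI allI impI ballI)
    show "bij_betw (\<phi> z) (fib T z) (fib T' z)" for z by (rule bij)
    show "\<phi> z (x + y) = \<phi> z x + \<phi> z y" if "x \<in> fib T z" "y \<in> fib T z" for z x y
      using that by (rule add)
    show "\<phi> z (scl T k x) = scl T' k (\<phi> z x)" if "x \<in> fib T z" for z k x
      using that by (rule scale)
    show "s \<in> hsections T U \<longleftrightarrow> (\<lambda>z. \<phi> z (s z)) \<in> hsections T' U"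
      if "open U \<and> (\<forall>z\<in>U. s z \<in> fib T z)" for U s
      using that by (intro sec) auto
    show "nabla T' (\<lambda>x. \<phi> x (s x)) z = \<phi> z (nabla T s z)"
      if "open U \<and> 0 \<notin> U" "s \<in> hsections T U" "z \<in> U" for U s z
      using that by (intro con) auto
  qed
qed

context te_rank2
begin

lemma theta_zero:
  assumes "z \<noteq> 0" shows "theta 0 z = 0"
proof -
  have "open (- {0::complex})" by auto
  from theta_comb[OF this _ zero_hs zero_hs, of "\<lambda>_. 0" "\<lambda>_. 0" z]
  show ?thesis using assms by (simp add: zero_fun_def)
qed

lemma euler_shift_theta: "z \<noteq> 0 \<Longrightarrow> euler_shift T \<beta> s z = theta s z - \<beta> \<odot> s z"
  by (simp add: euler_shift_def theta_def)

lemma euler_shift_at_0: "euler_shift T \<beta> s 0 = 0"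
  by (simp add: euler_shift_def)

lemma euler_shift_eqI:
  assumes "\<And>z. z \<noteq> 0 \<Longrightarrow> theta s z = \<beta> \<odot> s z + t z" "t 0 = 0"
  shows "euler_shift T \<beta> s = t"
proof
  fix z show "euler_shift T \<beta> s z = t z"
    using assms by (cases "z = 0") (auto simp: euler_shift_theta euler_shift_at_0)
qed

lemma euler_shift_zero: "euler_shift T \<beta> 0 = 0"
  by (rule euler_shift_eqI) (auto simp: theta_zero)

lemma eigen_in_elementary_ker:
  assumes "s \<in> hs (- {0})" "s 0 = 0" "\<And>z. z \<noteq> 0 \<Longrightarrow> theta s z = \<beta> \<odot> s z"
  shows "s \<in> elementary_ker T \<beta>"
proof -
  have "euler_shift T \<beta> s = 0" by (rule euler_shift_eqI) (auto simp: assms)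
  then show ?thesis using assms euler_shift_zero
    by (simp add: elementary_ker_def elementary_def numeral_2_eq_2)
qed

lemma elementaryD:
  assumes "s \<in> elementary T \<beta>"
  shows "s \<in> hs (- {0})" "s 0 = 0" "euler_shift T \<beta> (euler_shift T \<beta> s) = 0"
  using assms by (auto simp: elementary_def numeral_2_eq_2)

end

context te_elementary
begin

section \<open>Homogeneous sections\<close>

lemma homog_0 [simp]: "homog k x y 0 = 0"
  using sigma(2,3) by (simp add: homog_def)

lemma homog_hs: "homog k x y \<in> hs (- {0})"
  unfolding homog_def by (rule hs_comb[OF frame2D(2,3)[OF sigma(1)]]) (auto intro!: holomorphic_intros)

lemma theta_homog:
  assumes "z \<noteq> 0"
  shows "theta (homog k x y) z = homog k ((\<alpha>1 + of_int k) * x + c * y) ((\<alpha>2 + of_int k) * y) z"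
  using theta_laurent[OF assms, of "{k}" "\<lambda>_. x" "\<lambda>_. y"] unfolding laurent_single .

lemma homog_comb: "homog k (d * x + d' * x') (d * y + d' * y') z = d \<odot> homog k x y z + d' \<odot> homog k x' y' z"
  by (simp add: homog_def V.vs.scale_right_distrib V.vs.scale_left_distrib distrib_left mult_ac add_ac)

lemma homog_scale: "homog k (d * x) (d * y) z = d \<odot> homog k x y z"
  using homog_comb[of k d x 0 0 y 0 z] by simp

lemma homog_shift: "z \<noteq> 0 \<Longrightarrow> homog (k + int n) x y z = z ^ n \<odot> homog k x y z"
  by (simp add: homog_def V.vs.scale_right_distrib power_int_add mult_ac)

lemma homog_indep: "z \<noteq> 0 \<Longrightarrow> x1 * y2 - x2 * y1 \<noteq> 0 \<Longrightarrow> V.indep2 (homog k1 x1 y1 z) (homog k2 x2 y2 z)"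
proof -
  assume z: "z \<noteq> 0" and d: "x1 * y2 - x2 * y1 \<noteq> 0"
  have "(z powi k1 * x1) * (z powi k2 * y2) - (z powi k2 * x2) * (z powi k1 * y1)
      = z powi k1 * z powi k2 * (x1 * y2 - x2 * y1)" by (simp add: algebra_simps)
  also have "\<dots> \<noteq> 0" using z d by simp
  finally show ?thesis unfolding homog_def V.indep2_det_iff[OF sigma_indep[OF z]] .
qed

lemma homog_nonzero: "x \<noteq> 0 \<or> y \<noteq> 0 \<Longrightarrow> homog k x y \<noteq> 0"
proof
  assume xy: "x \<noteq> 0 \<or> y \<noteq> 0" and "homog k x y = 0"
  then have "homog k x y 1 = 0" by simp
  then have "x \<odot> \<sigma>1 1 + y \<odot> \<sigma>2 1 = 0" by (simp add: homog_def)
  then show False using sigma_indep[of 1] xy by (auto simp: V.indep2_def)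
qed

section \<open>Existence of adapted generators\<close>

text \<open>The condition \<open>low\<close> says that each homogeneous element of the lattice, written in the basis
\<open>(x1, y1), (x2, y2)\<close>, only involves \<open>z\<^sup>k\<close> times a generator whose own degree is at most \<open>k\<close>.  Then
the graded pieces lie in the span of the generators, and so does every germ.\<close>

lemma direct_sum_criterion:
  assumes det: "x1 * y2 - x2 * y1 \<noteq> 0" and L1: "in_lattice k1 x1 y1" and L2: "in_lattice k2 x2 y2"
    and low: "\<And>k \<xi> \<eta>. in_lattice k (\<xi> * x1 + \<eta> * x2) (\<xi> * y1 + \<eta> * y2) \<Longrightarrow>
       (\<xi> \<noteq> 0 \<longrightarrow> k1 \<le> k) \<and> (\<eta> \<noteq> 0 \<longrightarrow> k2 \<le> k)"
  shows "is_direct_sum0 (germs0 T) (conv_span T (homog k1 x1 y1)) (conv_span T (homog k2 x2 y2))"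
proof (rule direct_sumI)
  show "homog k1 x1 y1 \<in> germs0 T" "homog k2 x2 y2 \<in> germs0 T" using L1 L2 by (simp_all add: in_lattice_def)
  show "\<forall>\<^sub>F z in at 0. V.indep2 (homog k1 x1 y1 z) (homog k2 x2 y2 z)"
    using eventually_at_0_nz by (rule eventually_mono) (rule homog_indep[OF _ det])
  have sp0: "spanned (homog k1 x1 y1) (homog k2 x2 y2) (\<lambda>_. 0)"
    unfolding spanned_def by (intro exI[of _ "\<lambda>_. 0"]) auto
  have sp: "spanned (homog k1 x1 y1) (homog k2 x2 y2) (homog k x y)" if Lk: "in_lattice k x y" for k x y
  proof -
    define \<xi> \<eta> where "\<xi> = (x * y2 - x2 * y) / (x1 * y2 - x2 * y1)" and "\<eta> = (x1 * y - x * y1) / (x1 * y2 - x2 * y1)"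
    have xy: "x = \<xi> * x1 + \<eta> * x2" "y = \<xi> * y1 + \<eta> * y2"
      using det by (auto simp: \<xi>_def \<eta>_def divide_simps) (auto simp: algebra_simps)
    have kk: "\<xi> \<noteq> 0 \<Longrightarrow> k1 \<le> k" "\<eta> \<noteq> 0 \<Longrightarrow> k2 \<le> k" using low[of k \<xi> \<eta>] Lk xy by auto
    have mono: "a \<odot> homog k x' y' z = (a * z ^ nat (k - j)) \<odot> homog j x' y' z" if "a \<noteq> 0 \<Longrightarrow> j \<le> k" "z \<noteq> 0" for a j x' y' z
    proof (cases "a = 0")
      case False
      then have "k = j + int (nat (k - j))" using that by simp
      then show ?thesis using homog_shift[OF that(2), of j "nat (k - j)" x' y'] by simp
    qed simp
    have "\<forall>\<^sub>F z in at 0. homog k x y z =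
       (\<xi> * z ^ nat (k - k1)) \<odot> homog k1 x1 y1 z + (\<eta> * z ^ nat (k - k2)) \<odot> homog k2 x2 y2 z"
      using eventually_at_0_nz
    proof eventually_elim
      case (elim z)
      show ?case unfolding xy homog_comb using mono[of \<xi> k1 z] mono[of \<eta> k2 z] kk elim by simp
    qed
    moreover have "(\<lambda>z. \<xi> * z ^ nat (k - k1)) analytic_on {0}" "(\<lambda>z. \<eta> * z ^ nat (k - k2)) analytic_on {0}"
      by (auto intro!: analytic_intros)
    ultimately show ?thesis unfolding spanned_def by blast
  qed
  have splp: "spanned (homog k1 x1 y1) (homog k2 x2 y2) (laurent K b a)" if "finite K" "\<forall>k\<in>K. in_lattice k (b k) (a k)" for K b a
    using that
  proof (induction K)
    case empty
    then show ?case using sp0 by (simp add: laurent_def)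
  next
    case (insert k K)
    show ?case
    proof (rule spanned_comb[of _ _ "homog k (b k) (a k)" "laurent K b a" "\<lambda>_. 1" "\<lambda>_. 1"])
      show "\<forall>\<^sub>F z in at 0. laurent (insert k K) b a z = 1 \<odot> homog k (b k) (a k) z + 1 \<odot> laurent K b a z"
        using laurent_insert[OF insert.hyps] by simp
    qed (use insert sp in \<open>auto simp: analytic_on_const\<close>)
  qed
  fix t assume t: "t \<in> germs0 T"
  obtain N :: nat where N: "\<And>k x y. k \<ge> int N \<Longrightarrow> in_lattice k x y"
    "\<And>t. t \<in> germs0 T \<Longrightarrow> \<exists>K b a F G. finite K \<and> (\<forall>k\<in>K. in_lattice k (b k) (a k)) \<and>
       F analytic_on {0} \<and> G analytic_on {0} \<and>
       (\<forall>\<^sub>F z in at 0. t z = laurent K b a z + (F z \<odot> homog (int N) 1 0 z + G z \<odot> homog (int N) 0 1 z))"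
    by (rule lattice_structure) blast
  obtain K b a F G where K: "finite K" "\<forall>k\<in>K. in_lattice k (b k) (a k)"
    and FG: "F analytic_on {0}" "G analytic_on {0}"
    and eq: "\<forall>\<^sub>F z in at 0. t z = laurent K b a z + (F z \<odot> homog (int N) 1 0 z + G z \<odot> homog (int N) 0 1 z)"
    using N(2)[OF t] by blast
  have rem: "spanned (homog k1 x1 y1) (homog k2 x2 y2) (\<lambda>z. F z \<odot> homog (int N) 1 0 z + G z \<odot> homog (int N) 0 1 z)"
    by (rule spanned_comb[OF sp[OF N(1), of "int N" 1 0] sp[OF N(1), of "int N" 0 1] FG]) auto
  show "spanned (homog k1 x1 y1) (homog k2 x2 y2) t"
    by (rule spanned_comb[OF splp[OF K] rem, of "\<lambda>_. 1" "\<lambda>_. 1"]) (use eq in \<open>auto simp: analytic_on_const\<close>)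
qed

text \<open>Degrees of nonzero homogeneous elements of the lattice are bounded below, and every
direction occurs in high degree.\<close>

lemma in_lattice_least:
  assumes nz: "x \<noteq> 0 \<or> y \<noteq> 0" and P: "\<And>k. P k \<Longrightarrow> \<exists>x y. (x \<noteq> 0 \<or> y \<noteq> 0) \<and> in_lattice k x y"
    and LP: "\<And>k. in_lattice k x y \<Longrightarrow> P k"
  obtains k where "P k" "\<And>j. P j \<Longrightarrow> k \<le> j"
proof -
  obtain N :: nat where N: "\<And>k x y. k \<ge> int N \<Longrightarrow> in_lattice k x y"
    "\<And>k x y. in_lattice k x y \<Longrightarrow> x \<noteq> 0 \<or> y \<noteq> 0 \<Longrightarrow> - int N \<le> k" using lattice_structure by metis
  have "P (int N)" by (rule LP[OF N(1)]) simp
  moreover have "- int N \<le> k" if "P k" for k using P[OF that] N(2) by blast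
  ultimately show ?thesis using int_least[of P "int N" "- int N"] that by metis
qed

lemma in_lattice_least_single:
  assumes nz: "x \<noteq> 0 \<or> y \<noteq> 0"
  obtains k where "in_lattice k x y" "\<And>j. in_lattice j x y \<Longrightarrow> k \<le> j"
proof (rule in_lattice_least[OF nz, of "\<lambda>k. in_lattice k x y"])
  show "\<exists>x y. (x \<noteq> 0 \<or> y \<noteq> 0) \<and> in_lattice k x y" if "in_lattice k x y" for k using that nz by blast
qed blast+

text \<open>If the exponents differ, the lattice splits along the two coordinate axes and the generator on each
axis is the element of least degree.  If they agree, the vectors \<open>v\<close> with \<open>z\<^sup>k v\<close> in the lattice form
an increasing filtration of a plane; the two degrees are where it becomes nonzero and where it becomes
everything.\<close>

lemma adapted_generators_semisimple:
  assumes c0: "c = 0"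
  obtains k1 k2 x1 y1 x2 y2 where
    "is_direct_sum0 (germs0 T) (conv_span T (homog k1 x1 y1)) (conv_span T (homog k2 x2 y2))"
    "x1 * y2 - x2 * y1 \<noteq> 0"
    "\<And>z. z \<noteq> 0 \<Longrightarrow> theta (homog k1 x1 y1) z = (\<alpha>1 + of_int k1) \<odot> homog k1 x1 y1 z"
    "\<And>z. z \<noteq> 0 \<Longrightarrow> theta (homog k2 x2 y2) z = (\<alpha>2 + of_int k2) \<odot> homog k2 x2 y2 z"
proof (cases "\<alpha>1 = \<alpha>2")
  case False
  obtain k1 where k1: "in_lattice k1 1 0" "\<And>j. in_lattice j 1 0 \<Longrightarrow> k1 \<le> j"
    by (rule in_lattice_least_single[of 1 0]) auto
  obtain k2 where k2: "in_lattice k2 0 1" "\<And>j. in_lattice j 0 1 \<Longrightarrow> k2 \<le> j"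
    by (rule in_lattice_least_single[of 0 1]) auto
  show ?thesis
  proof (rule that[of k1 1 0 k2 0 1])
    show "is_direct_sum0 (germs0 T) (conv_span T (homog k1 1 0)) (conv_span T (homog k2 0 1))"
    proof (rule direct_sum_criterion[OF _ k1(1) k2(1)])
      fix k \<xi> \<eta> assume "in_lattice k (\<xi> * 1 + \<eta> * 0) (\<xi> * 0 + \<eta> * 1)"
      then have "in_lattice k \<xi> 0" "in_lattice k 0 \<eta>" using in_lattice_split[OF False, of k \<xi> \<eta>] by auto
      then have "in_lattice k 1 0" if "\<xi> \<noteq> 0" using in_lattice_comb[of k \<xi> 0 \<xi> 0 "1 / \<xi>" 0] that by simp
      moreover have "in_lattice k 0 1" if "\<eta> \<noteq> 0" using \<open>in_lattice k 0 \<eta>\<close> in_lattice_comb[of k 0 \<eta> 0 \<eta> "1 / \<eta>" 0] that by simp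
      ultimately show "(\<xi> \<noteq> 0 \<longrightarrow> k1 \<le> k) \<and> (\<eta> \<noteq> 0 \<longrightarrow> k2 \<le> k)" using k1 k2 by blast
    qed simp
    show "theta (homog k1 1 0) z = (\<alpha>1 + of_int k1) \<odot> homog k1 1 0 z" if "z \<noteq> 0" for z
      using theta_homog[OF that, of k1 1 0] homog_scale[of k1 "\<alpha>1 + of_int k1" 1 0 z] by simp
    show "theta (homog k2 0 1) z = (\<alpha>2 + of_int k2) \<odot> homog k2 0 1 z" if "z \<noteq> 0" for z
      using theta_homog[OF that, of k2 0 1] homog_scale[of k2 "\<alpha>2 + of_int k2" 0 1 z] c0 by simp
  qed simp
next
  case True
  obtain k2 where k2: "\<exists>x y. (x \<noteq> 0 \<or> y \<noteq> 0) \<and> in_lattice k2 x y"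
    "\<And>j. \<exists>x y. (x \<noteq> 0 \<or> y \<noteq> 0) \<and> in_lattice j x y \<Longrightarrow> k2 \<le> j"
  proof (rule in_lattice_least[of 1 0 "\<lambda>k. \<exists>x y. (x \<noteq> 0 \<or> y \<noteq> 0) \<and> in_lattice k x y"])
    show "\<exists>x y. (x \<noteq> 0 \<or> y \<noteq> 0) \<and> in_lattice k x y" if "in_lattice k 1 0" for k
      using that by (intro exI[of _ 1] exI[of _ 0]) simp
  qed (simp, blast, blast)
  then obtain x2 y2 where 2: "x2 \<noteq> 0 \<or> y2 \<noteq> 0" "in_lattice k2 x2 y2" by blast
  obtain u v where uv: "u * y2 - x2 * v \<noteq> 0"
  proof (cases "y2 = 0")
    case True
    then show ?thesis using that[of 0 1] 2 by simp
  next
    case False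
    then show ?thesis using that[of 1 0] by simp
  qed
  obtain k1 where k1: "\<exists>x y. x * y2 - x2 * y \<noteq> 0 \<and> in_lattice k1 x y"
    "\<And>j. \<exists>x y. x * y2 - x2 * y \<noteq> 0 \<and> in_lattice j x y \<Longrightarrow> k1 \<le> j"
  proof (rule in_lattice_least[of u v "\<lambda>k. \<exists>x y. x * y2 - x2 * y \<noteq> 0 \<and> in_lattice k x y"])
    show "u \<noteq> 0 \<or> v \<noteq> 0" using uv by auto
    show "\<exists>x y. (x \<noteq> 0 \<or> y \<noteq> 0) \<and> in_lattice k x y" if ex: "\<exists>x y. x * y2 - x2 * y \<noteq> 0 \<and> in_lattice k x y" for k
    proof -
      obtain x y where xy: "x * y2 - x2 * y \<noteq> 0" "in_lattice k x y" using ex by blast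
      then have "x \<noteq> 0 \<or> y \<noteq> 0" by auto
      then show ?thesis using xy(2) by blast
    qed
    show "\<exists>x y. x * y2 - x2 * y \<noteq> 0 \<and> in_lattice k x y" if "in_lattice k u v" for k using that uv by blast
  qed blast
  then obtain x1 y1 where 1: "x1 * y2 - x2 * y1 \<noteq> 0" "in_lattice k1 x1 y1" by blast
  show ?thesis
  proof (rule that[of k1 x1 y1 k2 x2 y2])
    show "is_direct_sum0 (germs0 T) (conv_span T (homog k1 x1 y1)) (conv_span T (homog k2 x2 y2))"
    proof (rule direct_sum_criterion[OF 1(1) 1(2) 2(2)])
      fix k \<xi> \<eta> assume Lk: "in_lattice k (\<xi> * x1 + \<eta> * x2) (\<xi> * y1 + \<eta> * y2)"
      have e: "(\<xi> * x1 + \<eta> * x2) * y2 - x2 * (\<xi> * y1 + \<eta> * y2) = \<xi> * (x1 * y2 - x2 * y1)"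
        "x1 * (\<xi> * y1 + \<eta> * y2) - (\<xi> * x1 + \<eta> * x2) * y1 = \<eta> * (x1 * y2 - x2 * y1)"
        by (simp_all add: algebra_simps)
      have "k1 \<le> k" if "\<xi> \<noteq> 0" using k1(2)[of k] Lk e(1) 1(1) that by (metis mult_eq_0_iff)
      moreover have "k2 \<le> k" if "\<eta> \<noteq> 0"
      proof (rule k2(2))
        have "x1 * (\<xi> * y1 + \<eta> * y2) - (\<xi> * x1 + \<eta> * x2) * y1 \<noteq> 0" unfolding e using that 1(1) by simp
        then have "\<xi> * x1 + \<eta> * x2 \<noteq> 0 \<or> \<xi> * y1 + \<eta> * y2 \<noteq> 0" by auto
        then show "\<exists>x y. (x \<noteq> 0 \<or> y \<noteq> 0) \<and> in_lattice k x y" using Lk by blast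
      qed
      ultimately show "(\<xi> \<noteq> 0 \<longrightarrow> k1 \<le> k) \<and> (\<eta> \<noteq> 0 \<longrightarrow> k2 \<le> k)" by blast
    qed
    show "theta (homog k1 x1 y1) z = (\<alpha>1 + of_int k1) \<odot> homog k1 x1 y1 z" if "z \<noteq> 0" for z
      using theta_homog[OF that, of k1 x1 y1] homog_scale[of k1 "\<alpha>1 + of_int k1" x1 y1 z] c0 True by simp
    show "theta (homog k2 x2 y2) z = (\<alpha>2 + of_int k2) \<odot> homog k2 x2 y2 z" if "z \<noteq> 0" for z
      using theta_homog[OF that, of k2 x2 y2] homog_scale[of k2 "\<alpha>2 + of_int k2" x2 y2 z] c0 True by simp
  qed (rule 1(1))
qed

text \<open>The filtration of the plane is now stable under the nilpotent part of \<open>theta\<close>, so its first nonzero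
step contains the kernel, the line of \<open>\<sigma>\<^sub>1\<close>.  From degree \<open>k1\<close> on it is the whole plane; therefore
every element outside the kernel can serve as first generator.\<close>

lemma adapted_generators_nilpotent:
  assumes c0: "c \<noteq> 0"
  obtains k1 k2 where "k2 \<le> k1"
    "\<And>x y. y \<noteq> 0 \<Longrightarrow> is_direct_sum0 (germs0 T) (conv_span T (homog k1 x y)) (conv_span T (homog k2 (c * y) 0))"
proof -
  obtain k2 where k2: "in_lattice k2 1 0" "\<And>j. in_lattice j 1 0 \<Longrightarrow> k2 \<le> j"
    by (rule in_lattice_least_single[of 1 0]) auto
  have nil: "in_lattice k 1 0" if "in_lattice k x y" "y \<noteq> 0" for k x y
    using in_lattice_comb[OF in_lattice_nilpotent[OF that(1)] in_lattice_nilpotent[OF that(1)], of "1 / (c * y)" 0] that(2) c0 by simp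
  obtain k1 where k1: "\<exists>x. in_lattice k1 x 1" "\<And>j. \<exists>x. in_lattice j x 1 \<Longrightarrow> k1 \<le> j"
  proof (rule in_lattice_least[of 0 1 "\<lambda>k. \<exists>x. in_lattice k x 1"])
    show "\<exists>x y. (x \<noteq> 0 \<or> y \<noteq> 0) \<and> in_lattice k x y" if "\<exists>x. in_lattice k x 1" for k
      using that by (metis zero_neq_one)
  qed auto
  have L10: "in_lattice k1 1 0" using k1(1) nil by (metis zero_neq_one)
  have all: "in_lattice k1 x y" for x y
  proof -
    obtain x0 where x0: "in_lattice k1 x0 1" using k1(1) by blast
    show ?thesis using in_lattice_comb[OF x0 L10, of y "x - y * x0"] by simp
  qed
  show ?thesis
  proof (rule that)
    show "k2 \<le> k1" using k2(2) L10 by blast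
    fix x y :: complex assume y: "y \<noteq> 0"
    show "is_direct_sum0 (germs0 T) (conv_span T (homog k1 x y)) (conv_span T (homog k2 (c * y) 0))"
    proof (rule direct_sum_criterion[OF _ all])
      show "x * 0 - c * y * y \<noteq> 0" using c0 y by simp
      show "in_lattice k2 (c * y) 0" using in_lattice_comb[OF k2(1) k2(1), of "c * y" 0] by simp
      fix k \<xi> \<eta> assume "in_lattice k (\<xi> * x + \<eta> * (c * y)) (\<xi> * y + \<eta> * 0)"
      then have Lk: "in_lattice k (\<xi> * x + \<eta> * (c * y)) (\<xi> * y)" by simp
      have 1: "k1 \<le> k" if "\<xi> \<noteq> 0"
      proof (rule k1(2))
        show "\<exists>x. in_lattice k x 1" using in_lattice_comb[OF Lk Lk, of "1 / (\<xi> * y)" 0] that y by auto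
      qed
      moreover have "k2 \<le> k" if \<eta>: "\<eta> \<noteq> 0"
      proof (cases "\<xi> = 0")
        case True
        then have "in_lattice k 1 0" using in_lattice_comb[OF Lk Lk, of "1 / (\<eta> * (c * y))" 0] \<eta> y c0 by simp
        then show ?thesis by (rule k2(2))
      next
        case False
        then show ?thesis using 1 \<open>k2 \<le> k1\<close> by simp
      qed
      ultimately show "(\<xi> \<noteq> 0 \<longrightarrow> k1 \<le> k) \<and> (\<eta> \<noteq> 0 \<longrightarrow> k2 \<le> k)" by blast
    qed
  qed
qed

section \<open>Elementary sections in coordinates\<close>

text \<open>The coordinates of an elementary section solve second-order Euler equations on the punctured plane,
hence already first-order ones.\<close>

lemma elementary_coords:
  assumes s: "s \<in> elementary T \<beta>"
  obtains f g where "f holomorphic_on - {0}" "g holomorphic_on - {0}"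
    "\<And>z. z \<noteq> 0 \<Longrightarrow> s z = f z \<odot> \<sigma>1 z + g z \<odot> \<sigma>2 z"
    "\<And>z. z \<noteq> 0 \<Longrightarrow> z * deriv f z = (\<beta> - \<alpha>1) * f z" "\<And>z. z \<noteq> 0 \<Longrightarrow> z * deriv g z = (\<beta> - \<alpha>2) * g z"
proof -
  note s' = elementaryD[OF s]
  note fr = frame2D[OF sigma(1)]
  have P: "open (- {0::complex})" "(0::complex) \<notin> - {0}" by auto
  obtain f g where fg: "f holomorphic_on - {0}" "g holomorphic_on - {0}"
    "\<And>z. z \<in> - {0} \<Longrightarrow> s z = f z \<odot> \<sigma>1 z + g z \<odot> \<sigma>2 z" using frame2_coords[OF sigma(1) s'(1)] by metis
  have sh: "euler_shift T \<beta> t z = (z * deriv f z - (\<beta> - \<alpha>1) * f z + c * g z) \<odot> \<sigma>1 z + (z * deriv g z - (\<beta> - \<alpha>2) * g z) \<odot> \<sigma>2 z"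
    if f: "f holomorphic_on - {0}" "g holomorphic_on - {0}" and t: "\<And>z. z \<in> - {0} \<Longrightarrow> t z = f z \<odot> \<sigma>1 z + g z \<odot> \<sigma>2 z"
      and z: "z \<noteq> 0" for t f g z
  proof -
    have z': "z \<in> - {0}" using z by simp
    have th: "t \<in> hs (- {0})" by (rule hs_cong[OF hs_comb[OF fr(2,3) f]]) (simp add: t)
    have t1: "theta \<sigma>1 z = \<alpha>1 \<odot> \<sigma>1 z + 0 \<odot> \<sigma>2 z" and t2: "theta \<sigma>2 z = c \<odot> \<sigma>1 z + \<alpha>2 \<odot> \<sigma>2 z"
      using sigma(4,5)[OF z] by simp_all
    have "theta t z = theta (\<lambda>z. f z \<odot> \<sigma>1 z + g z \<odot> \<sigma>2 z) z" by (rule theta_cong[OF P th t z'])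
    also have "\<dots> = (z * deriv f z + \<alpha>1 * f z + c * g z) \<odot> \<sigma>1 z + (z * deriv g z + 0 * f z + \<alpha>2 * g z) \<odot> \<sigma>2 z"
      by (rule theta_comb_in_frame[OF P fr(2,3) f z' t1 t2])
    finally have "euler_shift T \<beta> t z = ((z * deriv f z + \<alpha>1 * f z + c * g z) \<odot> \<sigma>1 z + (z * deriv g z + 0 * f z + \<alpha>2 * g z) \<odot> \<sigma>2 z)
       - \<beta> \<odot> (f z \<odot> \<sigma>1 z + g z \<odot> \<sigma>2 z)" using euler_shift_theta[OF z] t[OF z'] by simp
    also have "\<dots> = (z * deriv f z + \<alpha>1 * f z + c * g z - \<beta> * f z) \<odot> \<sigma>1 z + (z * deriv g z + 0 * f z + \<alpha>2 * g z - \<beta> * g z) \<odot> \<sigma>2 z"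
      by (simp add: V.vs.scale_right_distrib V.vs.scale_left_diff_distrib)
    also have "z * deriv f z + \<alpha>1 * f z + c * g z - \<beta> * f z = z * deriv f z - (\<beta> - \<alpha>1) * f z + c * g z"
      by (simp add: algebra_simps)
    also have "z * deriv g z + 0 * f z + \<alpha>2 * g z - \<beta> * g z = z * deriv g z - (\<beta> - \<alpha>2) * g z"
      by (simp add: algebra_simps)
    finally show ?thesis .
  qed
  define f1 g1 where "f1 = (\<lambda>z. z * deriv f z - (\<beta> - \<alpha>1) * f z + c * g z)" and "g1 = (\<lambda>z. z * deriv g z - (\<beta> - \<alpha>2) * g z)"
  have fg1: "f1 holomorphic_on - {0}" "g1 holomorphic_on - {0}"
    unfolding f1_def g1_def using fg by (auto intro!: holomorphic_intros)
  have e1: "euler_shift T \<beta> s z = f1 z \<odot> \<sigma>1 z + g1 z \<odot> \<sigma>2 z" if "z \<in> - {0}" for z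
    using sh[OF fg, of z] that by (simp add: f1_def g1_def)
  have e2: "z * deriv f1 z - (\<beta> - \<alpha>1) * f1 z + c * g1 z = 0" "z * deriv g1 z - (\<beta> - \<alpha>2) * g1 z = 0" if z: "z \<noteq> 0" for z
  proof -
    have "(z * deriv f1 z - (\<beta> - \<alpha>1) * f1 z + c * g1 z) \<odot> \<sigma>1 z + (z * deriv g1 z - (\<beta> - \<alpha>2) * g1 z) \<odot> \<sigma>2 z = 0"
      using sh[OF fg1 e1 z] s'(3) by simp
    then show "z * deriv f1 z - (\<beta> - \<alpha>1) * f1 z + c * g1 z = 0" "z * deriv g1 z - (\<beta> - \<alpha>2) * g1 z = 0"
      using sigma_indep[OF z] unfolding V.indep2_def by blast+
  qed
  have G: "z * deriv g z = (\<beta> - \<alpha>2) * g z" if z: "z \<noteq> 0" for z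
    using euler_square_eq[OF fg(2), of "\<beta> - \<alpha>2" z] e2(2) z by (simp add: g1_def)
  then have g10: "g1 z = 0" if "z \<noteq> 0" for z using that by (simp add: g1_def)
  have df1: "z * deriv f1 z = (\<beta> - \<alpha>1) * f1 z" if "z \<noteq> 0" for z using e2(1)[OF that] g10[OF that] by simp
  define h where "h = (\<lambda>z. z * deriv f z - (\<beta> - \<alpha>1) * f z)"
  have hh: "h holomorphic_on - {0}" unfolding h_def using fg by (auto intro!: holomorphic_intros)
  \<comment> \<open>The term with \<open>c\<close> couples only equal exponents, and there \<open>c g\<close> solves the same Euler
    equation as \<open>f1\<close>.\<close>
  have dh: "z * deriv h z = (\<beta> - \<alpha>1) * h z" if z: "z \<noteq> 0" for z
  proof -
    have gd: "g field_differentiable at z" "h field_differentiable at z"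
      using holomorphic_on_imp_differentiable_at[OF fg(2) P(1)] holomorphic_on_imp_differentiable_at[OF hh P(1)] z by auto
    have "f1 = (\<lambda>z. h z + c * g z)" by (simp add: f1_def h_def)
    then have "deriv f1 z = deriv h z + c * deriv g z"
      using gd by (simp add: deriv_add deriv_cmult field_differentiable_mult)
    then have "z * deriv f1 z = z * deriv h z + c * (z * deriv g z)" by (simp add: algebra_simps)
    then have "(\<beta> - \<alpha>1) * (h z + c * g z) = z * deriv h z + c * ((\<beta> - \<alpha>2) * g z)"
      using df1[OF z] G[OF z] by (simp add: f1_def h_def)
    then have "(\<beta> - \<alpha>1) * h z + (\<beta> - \<alpha>1) * (c * g z) = z * deriv h z + (\<beta> - \<alpha>2) * (c * g z)"
      by (simp add: distrib_left mult.left_commute)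
    moreover have "(\<beta> - \<alpha>1) * (c * g z) = (\<beta> - \<alpha>2) * (c * g z)" using sigma(6) by (cases "c = 0") auto
    ultimately show ?thesis by simp
  qed
  have "z * deriv f z = (\<beta> - \<alpha>1) * f z" if "z \<noteq> 0" for z
    using euler_square_eq[OF fg(1), of "\<beta> - \<alpha>1" z] dh that by (simp add: h_def)
  then show ?thesis using that[of f g] fg G by simp
qed

lemma elementary_eigen:
  assumes c0: "c = 0" and s: "s \<in> elementary T \<beta>" and z: "z \<noteq> 0"
  shows "theta s z = \<beta> \<odot> s z"
proof -
  note fr = frame2D[OF sigma(1)]
  have P: "open (- {0::complex})" "(0::complex) \<notin> - {0}" by auto
  have z': "z \<in> - {0}" using z by simp
  obtain f g where fg: "f holomorphic_on - {0}" "g holomorphic_on - {0}"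
    "\<And>z. z \<noteq> 0 \<Longrightarrow> s z = f z \<odot> \<sigma>1 z + g z \<odot> \<sigma>2 z"
    "\<And>z. z \<noteq> 0 \<Longrightarrow> z * deriv f z = (\<beta> - \<alpha>1) * f z" "\<And>z. z \<noteq> 0 \<Longrightarrow> z * deriv g z = (\<beta> - \<alpha>2) * g z"
    using elementary_coords[OF s] by metis
  have t1: "theta \<sigma>1 z = \<alpha>1 \<odot> \<sigma>1 z + 0 \<odot> \<sigma>2 z" and t2: "theta \<sigma>2 z = 0 \<odot> \<sigma>1 z + \<alpha>2 \<odot> \<sigma>2 z"
    using sigma(4,5)[OF z] c0 by simp_all
  have "theta s z = theta (\<lambda>z. f z \<odot> \<sigma>1 z + g z \<odot> \<sigma>2 z) z"
    by (rule theta_cong[OF P elementaryD(1)[OF s] _ z']) (simp add: fg(3))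
  also have "\<dots> = (z * deriv f z + \<alpha>1 * f z + 0 * g z) \<odot> \<sigma>1 z + (z * deriv g z + 0 * f z + \<alpha>2 * g z) \<odot> \<sigma>2 z"
    by (rule theta_comb_in_frame[OF P fr(2,3) fg(1,2) z' t1 t2])
  also have "z * deriv f z + \<alpha>1 * f z + 0 * g z = \<beta> * f z" unfolding fg(4)[OF z] by (simp add: algebra_simps)
  also have "z * deriv g z + 0 * f z + \<alpha>2 * g z = \<beta> * g z" unfolding fg(5)[OF z] by (simp add: algebra_simps)
  finally show ?thesis unfolding fg(3)[OF z] by (simp add: V.vs.scale_right_distrib)
qed

lemma euler_shift_homog:
  assumes eq: "\<alpha>1 = \<alpha>2"
  shows "euler_shift T (\<alpha>1 + of_int k) (homog k x y) = homog k (c * y) 0"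
proof (rule euler_shift_eqI)
  fix z :: complex assume "z \<noteq> 0"
  then show "theta (homog k x y) z = (\<alpha>1 + of_int k) \<odot> homog k x y z + homog k (c * y) 0 z"
    using theta_homog[of z k x y] homog_comb[of k "\<alpha>1 + of_int k" x 1 "c * y" y 0 z] eq by simp
qed simp

lemma elementary_iff_homog:
  assumes eq: "\<alpha>1 = \<alpha>2"
  shows "s \<in> elementary T (\<alpha>1 + of_int k) \<longleftrightarrow> (\<exists>x y. s = homog k x y)"
proof
  assume s: "s \<in> elementary T (\<alpha>1 + of_int k)"
  obtain f g where fg: "f holomorphic_on - {0}" "g holomorphic_on - {0}"
    "\<And>z. z \<noteq> 0 \<Longrightarrow> s z = f z \<odot> \<sigma>1 z + g z \<odot> \<sigma>2 z"
    "\<And>z. z \<noteq> 0 \<Longrightarrow> z * deriv f z = of_int k * f z" "\<And>z. z \<noteq> 0 \<Longrightarrow> z * deriv g z = of_int k * g z"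
    using elementary_coords[OF s] eq by (metis add_diff_cancel_left')
  have pw: "h z = z powi k * h 1" if "h holomorphic_on - {0}" "\<And>z. z \<noteq> 0 \<Longrightarrow> z * deriv h z = of_int k * h z" "z \<noteq> 0" for h z
    using euler_eq_exp[OF that(1,2), of "Ln z"] exp_power_int[of "Ln z" k] that(3) by simp
  have "s = homog k (f 1) (g 1)"
  proof
    fix z show "s z = homog k (f 1) (g 1) z"
    proof (cases "z = 0")
      case True then show ?thesis using elementaryD(2)[OF s] by simp
    next
      case False
      then show ?thesis unfolding fg(3)[OF False] homog_def
        using pw[OF fg(1,4) False] pw[OF fg(2,5) False] by simp
    qed
  qed
  then show "\<exists>x y. s = homog k x y" by blast
next
  assume "\<exists>x y. s = homog k x y"
  then obtain x y where s: "s = homog k x y" by blast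
  have "homog k 0 0 = 0" by (rule ext) (simp add: homog_def)
  then show "s \<in> elementary T (\<alpha>1 + of_int k)"
    unfolding s elementary_def by (simp add: numeral_2_eq_2 euler_shift_homog[OF eq] homog_hs)
qed

end

context te_elementary
begin

section \<open>The semisimple case\<close>

text \<open>The determinant of the coordinates solves an Euler equation, so it vanishes
nowhere or everywhere.\<close>

lemma elementary_indep_everywhere:
  assumes s: "s1 \<in> elementary T \<beta>1" "s2 \<in> elementary T \<beta>2"
    and ind: "\<forall>\<^sub>F z in at 0. V.indep2 (s1 z) (s2 z)" and z: "z \<noteq> 0"
  shows "V.indep2 (s1 z) (s2 z)"
proof -
  obtain f1 g1 where 1: "f1 holomorphic_on - {0}" "g1 holomorphic_on - {0}"
    "\<And>z. z \<noteq> 0 \<Longrightarrow> s1 z = f1 z \<odot> \<sigma>1 z + g1 z \<odot> \<sigma>2 z"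
    "\<And>z. z \<noteq> 0 \<Longrightarrow> z * deriv f1 z = (\<beta>1 - \<alpha>1) * f1 z" "\<And>z. z \<noteq> 0 \<Longrightarrow> z * deriv g1 z = (\<beta>1 - \<alpha>2) * g1 z"
    using elementary_coords[OF s(1)] by metis
  obtain f2 g2 where 2: "f2 holomorphic_on - {0}" "g2 holomorphic_on - {0}"
    "\<And>z. z \<noteq> 0 \<Longrightarrow> s2 z = f2 z \<odot> \<sigma>1 z + g2 z \<odot> \<sigma>2 z"
    "\<And>z. z \<noteq> 0 \<Longrightarrow> z * deriv f2 z = (\<beta>2 - \<alpha>1) * f2 z" "\<And>z. z \<noteq> 0 \<Longrightarrow> z * deriv g2 z = (\<beta>2 - \<alpha>2) * g2 z"
    using elementary_coords[OF s(2)] by metis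
  define D where "D = (\<lambda>z. f1 z * g2 z - f2 z * g1 z)"
  have det: "V.indep2 (s1 z) (s2 z) \<longleftrightarrow> D z \<noteq> 0" if "z \<noteq> 0" for z
    unfolding 1(3)[OF that] 2(3)[OF that] D_def by (rule V.indep2_det_iff[OF sigma_indep[OF that]])
  define \<kappa> where "\<kappa> = \<beta>1 + \<beta>2 - \<alpha>1 - \<alpha>2"
  have Dh: "D holomorphic_on - {0}" unfolding D_def using 1 2 by (auto intro!: holomorphic_intros)
  have dD: "z * deriv D z = \<kappa> * D z" if z: "z \<noteq> 0" for z
  proof -
    have d: "(h has_field_derivative deriv h z) (at z)" if "h holomorphic_on - {0}" for h
      by (rule holomorphic_derivI[OF that]) (use z in auto)
    have "(D has_field_derivative (f1 z * deriv g2 z + deriv f1 z * g2 z - (f2 z * deriv g1 z + deriv f2 z * g1 z))) (at z)"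
      unfolding D_def by (intro DERIV_diff DERIV_mult' d 1 2)
    then have "z * deriv D z = f1 z * (z * deriv g2 z) + (z * deriv f1 z) * g2 z - (f2 z * (z * deriv g1 z) + (z * deriv f2 z) * g1 z)"
      by (simp add: DERIV_imp_deriv algebra_simps)
    then show ?thesis unfolding 1(4)[OF z] 1(5)[OF z] 2(4)[OF z] 2(5)[OF z]
      by (simp add: D_def \<kappa>_def algebra_simps)
  qed
  note De = euler_eq_exp[OF Dh dD]
  have "\<forall>\<^sub>F z in at 0. z \<noteq> 0 \<and> D z \<noteq> 0"
    using ind eventually_at_0_nz by eventually_elim (simp add: det)
  then obtain z1 where z1: "z1 \<noteq> 0" "D z1 \<noteq> 0"
    using eventually_happens[of _ "at (0::complex)"] trivial_limit_at by blast
  then have "D 1 \<noteq> 0" using De[of "Ln z1"] by auto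
  then have "D z \<noteq> 0" using De[of "Ln z"] z by simp
  then show ?thesis using det[OF z] by blast
qed

lemma semisimple_global_frame:
  assumes c0: "c = 0" and s: "s1 \<in> elementary T \<beta>1" "s2 \<in> elementary T \<beta>2"
    and ds: "is_direct_sum0 (germs0 T) (conv_span T s1) (conv_span T s2)"
  obtains a b where "frame2 UNIV a b" "\<And>z. z \<noteq> 0 \<Longrightarrow> theta a z = \<beta>1 \<odot> a z"
    "\<And>z. z \<noteq> 0 \<Longrightarrow> theta b z = \<beta>2 \<odot> b z"
proof -
  obtain a b where ab: "frame2 UNIV a b" "\<And>z. z \<noteq> 0 \<Longrightarrow> a z = s1 z" "\<And>z. z \<noteq> 0 \<Longrightarrow> b z = s2 z"
    using global_frame[OF ds elementaryD(1)[OF s(1)] elementaryD(1)[OF s(2)]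
      elementary_indep_everywhere[OF s direct_sumE(3)[OF ds]]] by metis
  have P: "open (- {0::complex})" "(0::complex) \<notin> - {0}" by auto
  have "theta a z = \<beta>1 \<odot> a z" if "z \<noteq> 0" for z
    using theta_cong[OF P elementaryD(1)[OF s(1)], of a z] ab(2) elementary_eigen[OF c0 s(1) that] that by simp
  moreover have "theta b z = \<beta>2 \<odot> b z" if "z \<noteq> 0" for z
    using theta_cong[OF P elementaryD(1)[OF s(2)], of b z] ab(3) elementary_eigen[OF c0 s(2) that] that by simp
  ultimately show ?thesis using ab(1) that by blast
qed

lemma semisimple_exponents_exist:
  assumes c0: "c = 0" and l: "exp (- 2 * of_real pi * \<i> * \<alpha>1) = l1" "exp (- 2 * of_real pi * \<i> * \<alpha>2) = l2"
  obtains \<beta>1 \<beta>2 where "leading_exponents_ss T l1 l2 \<beta>1 \<beta>2"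
proof -
  obtain k1 k2 x1 y1 x2 y2 where
    ds: "is_direct_sum0 (germs0 T) (conv_span T (homog k1 x1 y1)) (conv_span T (homog k2 x2 y2))"
    and det: "x1 * y2 - x2 * y1 \<noteq> 0"
    and th: "\<And>z. z \<noteq> 0 \<Longrightarrow> theta (homog k1 x1 y1) z = (\<alpha>1 + of_int k1) \<odot> homog k1 x1 y1 z"
    "\<And>z. z \<noteq> 0 \<Longrightarrow> theta (homog k2 x2 y2) z = (\<alpha>2 + of_int k2) \<odot> homog k2 x2 y2 z"
    using adapted_generators_semisimple[OF c0] by metis
  have "x1 \<noteq> 0 \<or> y1 \<noteq> 0" "x2 \<noteq> 0 \<or> y2 \<noteq> 0" using det by auto
  note nz = this[THEN homog_nonzero]
  have "homog k1 x1 y1 \<in> elementary T (\<alpha>1 + of_int k1) - {0}" "homog k2 x2 y2 \<in> elementary T (\<alpha>2 + of_int k2) - {0}"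
    using eigen_in_elementary_ker[OF homog_hs homog_0 th(1)] eigen_in_elementary_ker[OF homog_hs homog_0 th(2)]
      nz by (simp_all add: elementary_ker_def)
  moreover have "exp (- 2 * of_real pi * \<i> * (\<alpha>1 + of_int k1)) = l1" "exp (- 2 * of_real pi * \<i> * (\<alpha>2 + of_int k2)) = l2"
    unfolding l[symmetric] exp_2pi_eq_iff by blast+
  ultimately show ?thesis using that[of "\<alpha>1 + of_int k1" "\<alpha>2 + of_int k2"] ds
    unfolding leading_exponents_ss_def by blast
qed

lemma semisimple_exponents_unique:
  assumes c0: "c = 0" and \<beta>: "leading_exponents_ss T l1 l2 \<beta>1 \<beta>2" and \<gamma>: "leading_exponents_ss T l1 l2 \<gamma>1 \<gamma>2"
  shows "(\<gamma>1 = \<beta>1 \<and> \<gamma>2 = \<beta>2) \<or> (l1 = l2 \<and> \<gamma>1 = \<beta>2 \<and> \<gamma>2 = \<beta>1)"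
proof -
  obtain s1 s2 where s: "s1 \<in> elementary T \<beta>1" "s2 \<in> elementary T \<beta>2"
    and ds: "is_direct_sum0 (germs0 T) (conv_span T s1) (conv_span T s2)"
    using \<beta> unfolding leading_exponents_ss_def by blast
  obtain t1 t2 where t: "t1 \<in> elementary T \<gamma>1" "t2 \<in> elementary T \<gamma>2"
    and dt: "is_direct_sum0 (germs0 T) (conv_span T t1) (conv_span T t2)"
    using \<gamma> unfolding leading_exponents_ss_def by blast
  note es = elementary_eigen[OF c0 s(1)] elementary_eigen[OF c0 s(2)]
  note et = elementary_eigen[OF c0 t(1)] elementary_eigen[OF c0 t(2)]
  note hs_s = elementaryD(1)[OF s(1)] elementaryD(1)[OF s(2)]
  note hs_t = elementaryD(1)[OF t(1)] elementaryD(1)[OF t(2)]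
  have "(\<gamma>1 = \<beta>1 \<and> \<gamma>2 = \<beta>2) \<or> (\<gamma>1 = \<beta>2 \<and> \<gamma>2 = \<beta>1)"
  proof (rule exponent_pairs_eq)
    show "\<gamma>1 - \<beta>1 \<in> \<nat> \<and> \<gamma>2 - \<beta>2 \<in> \<nat> \<or> \<gamma>1 - \<beta>2 \<in> \<nat> \<and> \<gamma>2 - \<beta>1 \<in> \<nat>"
      by (rule exponents_compare[OF ds hs_s hs_t es et direct_sumE(1,2,3)[OF dt]])
    show "\<beta>1 - \<gamma>1 \<in> \<nat> \<and> \<beta>2 - \<gamma>2 \<in> \<nat> \<or> \<beta>1 - \<gamma>2 \<in> \<nat> \<and> \<beta>2 - \<gamma>1 \<in> \<nat>"
      by (rule exponents_compare[OF dt hs_t hs_s et es direct_sumE(1,2,3)[OF ds]])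
  qed
  then show ?thesis using \<beta> \<gamma> unfolding leading_exponents_ss_def by metis
qed

section \<open>The case of a nontrivial Jordan block\<close>

lemma homog_eq_iff: "homog k x y = homog k x' y' \<longleftrightarrow> x = x' \<and> y = y'"
proof
  assume "homog k x y = homog k x' y'"
  then have "homog k x y 1 = homog k x' y' 1" by simp
  then have "x \<odot> \<sigma>1 1 + y \<odot> \<sigma>2 1 = x' \<odot> \<sigma>1 1 + y' \<odot> \<sigma>2 1" by (simp add: homog_def)
  then show "x = x' \<and> y = y'" using V.indep2D[OF sigma_indep] by (metis zero_neq_one)
qed simp

lemma homog_zero_iff: "homog k x y = 0 \<longleftrightarrow> x = 0 \<and> y = 0"
proof -
  have "homog k 0 0 = 0" by (rule ext) (simp add: homog_def)
  then show ?thesis using homog_eq_iff[of k x y 0 0] by simp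
qed

lemma homog_shift_fun: "homog (k + int n) x y = (\<lambda>z. z ^ n \<odot> homog k x y z)"
proof
  fix z show "homog (k + int n) x y z = z ^ n \<odot> homog k x y z"
    using homog_shift[of z k n x y] by (cases "z = 0") auto
qed

lemma homog_in_ker_iff:
  assumes "c \<noteq> 0"
  shows "homog k x y \<in> elementary_ker T (\<alpha>1 + of_int k) \<longleftrightarrow> y = 0"
proof -
  have eq: "\<alpha>1 = \<alpha>2" using sigma(6) assms .
  show ?thesis using elementary_iff_homog[OF eq, of "homog k x y" k] assms
    by (auto simp: elementary_ker_def euler_shift_homog[OF eq] homog_zero_iff)
qed

text \<open>All first generators \<open>s\<^sub>1\<close> are handled at once: they are the sections
\<open>z\<^sup>k\<^sup>1 (x \<sigma>\<^sub>1 + y \<sigma>\<^sub>2)\<close> with \<open>y \<noteq> 0\<close>, and \<open>s\<^sub>2\<close> is \<open>z\<^sup>k\<^sup>2 c y \<sigma>\<^sub>1\<close>.\<close>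

lemma nilpotent_exponents_exist:
  assumes c0: "c \<noteq> 0" and l: "exp (- 2 * of_real pi * \<i> * \<alpha>1) = l"
  obtains \<beta>1 \<beta>2 where "leading_exponents_nss T l \<beta>1 \<beta>2"
proof -
  have eq: "\<alpha>1 = \<alpha>2" using sigma(6) c0 .
  obtain k1 k2 where k: "k2 \<le> k1" and ds: "\<And>x y. y \<noteq> 0 \<Longrightarrow>
     is_direct_sum0 (germs0 T) (conv_span T (homog k1 x y)) (conv_span T (homog k2 (c * y) 0))"
    using adapted_generators_nilpotent[OF c0] by metis
  define n where "n = nat (k1 - k2)"
  have n: "k1 = k2 + int n" using k by (simp add: n_def)
  have "leading_exponents_nss T l (\<alpha>1 + of_int k1) (\<alpha>1 + of_int k2)"
    unfolding leading_exponents_nss_def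
  proof (intro conjI exI[of _ n] ballI)
    show "exp (- 2 * of_real pi * \<i> * (\<alpha>1 + of_int k1)) = l" "exp (- 2 * of_real pi * \<i> * (\<alpha>1 + of_int k2)) = l"
      unfolding l[symmetric] exp_2pi_eq_iff by blast+
    show "\<alpha>1 + of_int k1 - (\<alpha>1 + of_int k2) = of_nat n" using n by simp
    fix s1 assume s1: "s1 \<in> elementary T (\<alpha>1 + of_int k1) - elementary_ker T (\<alpha>1 + of_int k1)"
    then obtain x y where xy: "s1 = homog k1 x y" using elementary_iff_homog[OF eq] by blast
    then have y: "y \<noteq> 0" using s1 homog_in_ker_iff[OF c0] by blast
    have es: "euler_shift T (\<alpha>1 + of_int k1) s1 = (\<lambda>z. z ^ n \<odot> homog k2 (c * y) 0 z)"
      unfolding xy euler_shift_homog[OF eq] using homog_shift_fun[of k2 n "c * y" 0] n by simp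
    have uniq: "s2 = homog k2 (c * y) 0"
      if s2: "s2 \<in> elementary T (\<alpha>1 + of_int k2)" and e: "euler_shift T (\<alpha>1 + of_int k1) s1 = (\<lambda>z. z ^ n \<odot> s2 z)" for s2
    proof -
      obtain u v where uv: "s2 = homog k2 u v" using s2 elementary_iff_homog[OF eq] by blast
      have "homog (k2 + int n) u v = homog (k2 + int n) (c * y) 0"
        using e es unfolding uv homog_shift_fun by simp
      then show ?thesis unfolding uv homog_eq_iff .
    qed
    have el: "homog k2 (c * y) 0 \<in> elementary T (\<alpha>1 + of_int k2)" using elementary_iff_homog[OF eq] by blast
    show "\<exists>!s2. s2 \<in> elementary T (\<alpha>1 + of_int k2) \<and> euler_shift T (\<alpha>1 + of_int k1) s1 = (\<lambda>z. z ^ n \<odot> s2 z)"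
      using el es uniq by blast
    have ker: "elementary_ker T (\<alpha>1 + of_int k2) = F.vs.span {homog k2 (c * y) 0}"
    proof -
      have "elementary_ker T (\<alpha>1 + of_int k2) = {homog k2 u 0 |u. True}"
      proof (intro equalityI subsetI)
        fix s assume s: "s \<in> elementary_ker T (\<alpha>1 + of_int k2)"
        then have "s \<in> elementary T (\<alpha>1 + of_int k2)" by (simp add: elementary_ker_def)
        then obtain u v where "s = homog k2 u v" using elementary_iff_homog[OF eq] by blast
        then show "s \<in> {homog k2 u 0 |u. True}" using s homog_in_ker_iff[OF c0] by auto
      next
        fix s assume "s \<in> {homog k2 u 0 |u. True}"
        then show "s \<in> elementary_ker T (\<alpha>1 + of_int k2)" using homog_in_ker_iff[OF c0] by auto
      qed
      also have "\<dots> = range (\<lambda>r. fscl T r (homog k2 (c * y) 0))"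
      proof -
        have *: "fscl T r (homog k2 (c * y) 0) = homog k2 (r * (c * y)) 0" for r
          by (rule ext) (simp add: fscl_def homog_scale[of k2 r "c * y" 0, simplified])
        have "homog k2 u 0 = homog k2 ((u / (c * y)) * (c * y)) 0" for u using c0 y by simp
        then have "homog k2 u 0 = fscl T (u / (c * y)) (homog k2 (c * y) 0)" for u using * by metis
        then have r: "homog k2 u 0 \<in> range (\<lambda>r. fscl T r (homog k2 (c * y) 0))" for u by (rule range_eqI)
        show ?thesis
        proof (intro equalityI subsetI)
          show "s \<in> range (\<lambda>r. fscl T r (homog k2 (c * y) 0))" if "s \<in> {homog k2 u 0 |u. True}" for s
            using that r by (elim CollectE exE conjE) metis
          show "s \<in> {homog k2 u 0 |u. True}" if "s \<in> range (\<lambda>r. fscl T r (homog k2 (c * y) 0))" for s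
            using that unfolding * by blast
        qed
      qed
      also have "\<dots> = F.vs.span {homog k2 (c * y) 0}" by (simp add: F.vs.span_singleton)
      finally show ?thesis .
    qed
    show "euler_shift T (\<alpha>1 + of_int k1) s1 = (\<lambda>z. z ^ n \<odot> s2 z) \<longrightarrow>
           elementary_ker T (\<alpha>1 + of_int k2) = F.vs.span {s2} \<and>
           is_direct_sum0 (germs0 T) (conv_span T s1) (conv_span T s2)"
      if "s2 \<in> elementary T (\<alpha>1 + of_int k2)" for s2
      using uniq[OF that] ker ds[OF y, of x] xy by blast
  qed
  then show ?thesis by (rule that)
qed

text \<open>Specialising the defining property to \<open>s\<^sub>1 = z\<^sup>p \<sigma>\<^sub>2\<close>.\<close>

lemma nilpotent_exponents_data:
  assumes c0: "c \<noteq> 0" and l: "exp (- 2 * of_real pi * \<i> * \<alpha>1) = l" and \<beta>: "leading_exponents_nss T l \<beta>1 \<beta>2"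
  obtains p q n where "\<beta>1 = \<alpha>1 + of_int p" "\<beta>2 = \<alpha>1 + of_int q" "p = q + int n"
    "is_direct_sum0 (germs0 T) (conv_span T (homog p 0 1)) (conv_span T (homog q c 0))"
proof -
  have eq: "\<alpha>1 = \<alpha>2" using sigma(6) c0 .
  have "exp (- 2 * of_real pi * \<i> * \<beta>1) = exp (- 2 * of_real pi * \<i> * \<alpha>1)" "exp (- 2 * of_real pi * \<i> * \<beta>2) = exp (- 2 * of_real pi * \<i> * \<alpha>1)"
    using \<beta> l unfolding leading_exponents_nss_def by simp_all
  then obtain p q :: int where pq: "\<beta>1 = \<alpha>1 + of_int p" "\<beta>2 = \<alpha>1 + of_int q" unfolding exp_2pi_eq_iff by blast
  obtain n where n: "\<beta>1 - \<beta>2 = of_nat n"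
    and P: "\<And>s1. s1 \<in> elementary T \<beta>1 - elementary_ker T \<beta>1 \<Longrightarrow>
        (\<exists>!s2. s2 \<in> elementary T \<beta>2 \<and> euler_shift T \<beta>1 s1 = (\<lambda>z. z ^ n \<odot> s2 z)) \<and>
        (\<forall>s2\<in>elementary T \<beta>2. euler_shift T \<beta>1 s1 = (\<lambda>z. z ^ n \<odot> s2 z) \<longrightarrow>
           elementary_ker T \<beta>2 = F.vs.span {s2} \<and>
           is_direct_sum0 (germs0 T) (conv_span T s1) (conv_span T s2))"
    using \<beta> unfolding leading_exponents_nss_def by blast
  have "of_int p = (of_int (q + int n) :: complex)" using n pq by (simp add: diff_eq_eq add.commute)
  then have pn: "p = q + int n" by (simp only: of_int_eq_iff)
  have "homog p 0 1 \<in> elementary T \<beta>1 - elementary_ker T \<beta>1"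
    using elementary_iff_homog[OF eq] homog_in_ker_iff[OF c0] unfolding pq by auto
  moreover have "homog q c 0 \<in> elementary T \<beta>2" using elementary_iff_homog[OF eq] unfolding pq by blast
  moreover have "euler_shift T \<beta>1 (homog p 0 1) = (\<lambda>z. z ^ n \<odot> homog q c 0 z)"
    unfolding pq euler_shift_homog[OF eq] using homog_shift_fun[of q n c 0] pn by simp
  ultimately have "is_direct_sum0 (germs0 T) (conv_span T (homog p 0 1)) (conv_span T (homog q c 0))"
    using P by blast
  then show ?thesis using that pq pn by blast
qed

text \<open>The degrees are minimal: an element of smaller degree would have a coefficient with a
pole.\<close>

lemma direct_sum_order:
  assumes c0: "c \<noteq> 0"
    and ds: "is_direct_sum0 (germs0 T) (conv_span T (homog p 0 1)) (conv_span T (homog q c 0))"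
  shows "homog p' 0 1 \<in> germs0 T \<Longrightarrow> p \<le> p'" "homog q' c 0 \<in> germs0 T \<Longrightarrow> q \<le> q'"
proof -
  have le: "k \<le> k'" if H: "H analytic_on {0}" and e: "\<forall>\<^sub>F z in at 0. z \<noteq> 0 \<and> z powi k' = H z * z powi k"
    for H :: "complex \<Rightarrow> complex" and k k'
  proof (rule ccontr)
    assume "\<not> k \<le> k'"
    define m where "m = nat (k - k')"
    have m: "m > 0" "k = k' + int m" using \<open>\<not> k \<le> k'\<close> by (auto simp: m_def)
    have "\<forall>\<^sub>F z in at 0. 1 = z ^ m * H z"
      using e
    proof eventually_elim
      case (elim z)
      then have nz: "z powi k' \<noteq> 0" and e: "z powi k' = H z * z powi k" by auto
      have "z powi k = z powi k' * z ^ m" unfolding m(2) using elim by (subst power_int_add) auto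
      then have "z powi k' * 1 = z powi k' * (z ^ m * H z)" using e by (metis mult.right_neutral mult.assoc mult.commute)
      then show ?case using nz unfolding mult_cancel_left by blast
    qed
    then have "(1::complex) = 0" by (rule power_times_analytic_eq_const[OF H m(1)])
    then show False by simp
  qed
  have sp: "\<exists>f g. f analytic_on {0} \<and> g analytic_on {0} \<and>
      (\<forall>\<^sub>F z in at 0. z \<noteq> 0 \<and> z powi k * x = g z * (z powi q * c) \<and> z powi k * y = f z * z powi p)"
    if g: "homog k x y \<in> germs0 T" for k x y
  proof -
    obtain f g where fg: "f analytic_on {0}" "g analytic_on {0}"
      "\<forall>\<^sub>F z in at 0. homog k x y z = f z \<odot> homog p 0 1 z + g z \<odot> homog q c 0 z"
      using direct_sumE(4)[OF ds g] unfolding spanned_def by blast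
    have "\<forall>\<^sub>F z in at 0. z \<noteq> 0 \<and> z powi k * x = g z * (z powi q * c) \<and> z powi k * y = f z * z powi p"
      using fg(3) eventually_at_0_nz
    proof eventually_elim
      case (elim z)
      have "(z powi k * x) \<odot> \<sigma>1 z + (z powi k * y) \<odot> \<sigma>2 z = (g z * (z powi q * c)) \<odot> \<sigma>1 z + (f z * z powi p) \<odot> \<sigma>2 z"
        using elim(1) by (simp add: homog_def add.commute)
      then show ?case using elim(2) V.indep2D[OF sigma_indep[OF elim(2)]] by blast
    qed
    then show ?thesis using fg by blast
  qed
  show "p \<le> p'" if h: "homog p' 0 1 \<in> germs0 T"
  proof -
    obtain f g where fg: "f analytic_on {0}"
      "\<forall>\<^sub>F z in at 0. z \<noteq> 0 \<and> z powi p' * 0 = g z * (z powi q * c) \<and> z powi p' * 1 = f z * z powi p"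
      using sp[OF h] by blast
    show ?thesis by (rule le[OF fg(1)], rule eventually_mono[OF fg(2)]) simp
  qed
  show "q \<le> q'" if h: "homog q' c 0 \<in> germs0 T"
  proof -
    obtain f g where fg: "g analytic_on {0}"
      "\<forall>\<^sub>F z in at 0. z \<noteq> 0 \<and> z powi q' * c = g z * (z powi q * c) \<and> z powi q' * 0 = f z * z powi p"
      using sp[OF h] by blast
    show ?thesis by (rule le[OF fg(1)], rule eventually_mono[OF fg(2)]) (use c0 in simp)
  qed
qed

lemma nilpotent_exponents_unique:
  assumes c0: "c \<noteq> 0" and l: "exp (- 2 * of_real pi * \<i> * \<alpha>1) = l"
    and \<beta>: "leading_exponents_nss T l \<beta>1 \<beta>2" and \<gamma>: "leading_exponents_nss T l \<gamma>1 \<gamma>2"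
  shows "\<gamma>1 = \<beta>1 \<and> \<gamma>2 = \<beta>2"
proof -
  obtain p q n where 1: "\<beta>1 = \<alpha>1 + of_int p" "\<beta>2 = \<alpha>1 + of_int q"
    "is_direct_sum0 (germs0 T) (conv_span T (homog p 0 1)) (conv_span T (homog q c 0))"
    using nilpotent_exponents_data[OF c0 l \<beta>] by metis
  obtain p' q' n' where 2: "\<gamma>1 = \<alpha>1 + of_int p'" "\<gamma>2 = \<alpha>1 + of_int q'"
    "is_direct_sum0 (germs0 T) (conv_span T (homog p' 0 1)) (conv_span T (homog q' c 0))"
    using nilpotent_exponents_data[OF c0 l \<gamma>] by metis
  have "p \<le> p'" "q \<le> q'" "p' \<le> p" "q' \<le> q"
    using direct_sum_order[OF c0 1(3)] direct_sum_order[OF c0 2(3)] direct_sumE(1,2)[OF 1(3)] direct_sumE(1,2)[OF 2(3)]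
    by blast+
  then show ?thesis using 1 2 by simp
qed

lemma nilpotent_global_frame:
  assumes c0: "c \<noteq> 0" and l: "exp (- 2 * of_real pi * \<i> * \<alpha>1) = l" and \<beta>: "leading_exponents_nss T l \<beta>1 \<beta>2"
  obtains a b n where "\<beta>1 - \<beta>2 = of_nat n" "frame2 UNIV a b"
    "\<And>z. z \<noteq> 0 \<Longrightarrow> theta a z = \<beta>1 \<odot> a z + z ^ n \<odot> b z" "\<And>z. z \<noteq> 0 \<Longrightarrow> theta b z = \<beta>2 \<odot> b z"
proof -
  have eq: "\<alpha>1 = \<alpha>2" using sigma(6) c0 .
  obtain p q n where pq: "\<beta>1 = \<alpha>1 + of_int p" "\<beta>2 = \<alpha>1 + of_int q" "p = q + int n"
    and ds: "is_direct_sum0 (germs0 T) (conv_span T (homog p 0 1)) (conv_span T (homog q c 0))"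
    using nilpotent_exponents_data[OF c0 l \<beta>] by metis
  obtain a b where ab: "frame2 UNIV a b" "\<And>z. z \<noteq> 0 \<Longrightarrow> a z = homog p 0 1 z" "\<And>z. z \<noteq> 0 \<Longrightarrow> b z = homog q c 0 z"
    by (rule global_frame[OF ds homog_hs homog_hs homog_indep]) (use c0 in auto)
  have P: "open (- {0::complex})" "(0::complex) \<notin> - {0}" by auto
  have "theta a z = \<beta>1 \<odot> a z + z ^ n \<odot> b z" if z: "z \<noteq> 0" for z
  proof -
    have "theta a z = theta (homog p 0 1) z"
      by (rule sym, rule theta_cong[OF P homog_hs]) (use ab(2) z in auto)
    also have "\<dots> = homog p (\<beta>1 * 0 + 1 * c) (\<beta>1 * 1 + 1 * 0) z"
      unfolding theta_homog[OF z] using eq by (simp add: pq)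
    also have "\<dots> = \<beta>1 \<odot> homog p 0 1 z + homog p c 0 z" unfolding homog_comb by simp
    also have "homog p c 0 z = z ^ n \<odot> homog q c 0 z" unfolding pq(3) by (rule homog_shift[OF z])
    finally show ?thesis using ab z by simp
  qed
  moreover have "theta b z = \<beta>2 \<odot> b z" if z: "z \<noteq> 0" for z
  proof -
    have "theta b z = theta (homog q c 0) z"
      by (rule sym, rule theta_cong[OF P homog_hs]) (use ab(3) z in auto)
    also have "\<dots> = homog q (\<beta>2 * c) (\<beta>2 * 0) z" unfolding theta_homog[OF z] by (simp add: pq)
    also have "\<dots> = \<beta>2 \<odot> homog q c 0 z" by (rule homog_scale)
    finally show ?thesis using ab z by simp
  qed
  moreover have "\<beta>1 - \<beta>2 = of_nat n" by (simp add: pq)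
  ultimately show ?thesis using ab(1) that by blast
qed

end

section \<open>The classification\<close>

lemma te_elementary_exists:
  fixes T :: "('v::ab_group_add) te"
  assumes "TE_structure T" "rk T = 2" "logarithmic T"
    and "eigenvalues_are (fscl T) (flat_mv T) Mmon {#l1, l2#}"
  obtains \<sigma>1 \<sigma>2 \<alpha>1 \<alpha>2 c where "te_elementary T \<sigma>1 \<sigma>2 \<alpha>1 \<alpha>2 c" "c = 0 \<longleftrightarrow> Nmon_zero T"
    "exp (- 2 * of_real pi * \<i> * \<alpha>1) = l1" "exp (- 2 * of_real pi * \<i> * \<alpha>2) = l2"
    "\<not> Nmon_zero T \<Longrightarrow> l1 = l2"
proof -
  interpret X: te_rank2 T by unfold_locales (fact assms)+
  obtain \<sigma>1 \<sigma>2 \<alpha>1 \<alpha>2 c where 1: "X.elem_frame \<sigma>1 \<sigma>2 \<alpha>1 \<alpha>2 c" "c = 0 \<longleftrightarrow> Nmon_zero T"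
    "exp (- 2 * of_real pi * \<i> * \<alpha>1) = l1" "exp (- 2 * of_real pi * \<i> * \<alpha>2) = l2"
    "\<not> Nmon_zero T \<Longrightarrow> l1 = l2"
    using X.elementary_frame_exists[OF assms(4)] by metis
  have "te_elementary T \<sigma>1 \<sigma>2 \<alpha>1 \<alpha>2 c" by unfold_locales (fact assms(3) 1(1))+
  then show ?thesis using that 1 by blast
qed

lemma semisimple_normal_form:
  fixes T :: "('v::ab_group_add) te"
  assumes T: "TE_structure T" "rk T = 2" "logarithmic T"
    "eigenvalues_are (fscl T) (flat_mv T) Mmon {#l1, l2#}" "Nmon_zero T"
    and \<beta>: "leading_exponents_ss T l1 l2 \<beta>1 \<beta>2"
  obtains a b where "te_rank2 T" "te_rank2.frame2 T UNIV a b"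
    "\<And>z. z \<noteq> 0 \<Longrightarrow> te_rank2.theta T a z = scl T \<beta>1 (a z)"
    "\<And>z. z \<noteq> 0 \<Longrightarrow> te_rank2.theta T b z = scl T \<beta>2 (b z)"
proof -
  obtain \<sigma>1 \<sigma>2 \<alpha>1 \<alpha>2 c where te: "te_elementary T \<sigma>1 \<sigma>2 \<alpha>1 \<alpha>2 c" "c = 0 \<longleftrightarrow> Nmon_zero T"
    by (rule te_elementary_exists[OF T(1-4)])
  interpret X: te_elementary T \<sigma>1 \<sigma>2 \<alpha>1 \<alpha>2 c by (rule te(1))
  obtain s1 s2 where s: "s1 \<in> elementary T \<beta>1" "s2 \<in> elementary T \<beta>2"
    and ds: "is_direct_sum0 (germs0 T) (conv_span T s1) (conv_span T s2)"
    using \<beta> unfolding leading_exponents_ss_def by blast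
  have c0: "c = 0" using te(2) T(5) by blast
  show ?thesis
    by (rule X.semisimple_global_frame[OF c0 s ds]) (rule that[OF X.te_rank2_axioms])
qed

lemma nilpotent_normal_form:
  fixes T :: "('v::ab_group_add) te"
  assumes T: "TE_structure T" "rk T = 2" "logarithmic T"
    "eigenvalues_are (fscl T) (flat_mv T) Mmon {#l, l#}" "\<not> Nmon_zero T"
    and \<beta>: "leading_exponents_nss T l \<beta>1 \<beta>2"
  obtains a b n where "te_rank2 T" "\<beta>1 - \<beta>2 = of_nat n" "te_rank2.frame2 T UNIV a b"
    "\<And>z. z \<noteq> 0 \<Longrightarrow> te_rank2.theta T a z = scl T \<beta>1 (a z) + scl T (z ^ n) (b z)"
    "\<And>z. z \<noteq> 0 \<Longrightarrow> te_rank2.theta T b z = scl T \<beta>2 (b z)"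
proof -
  obtain \<sigma>1 \<sigma>2 \<alpha>1 \<alpha>2 c where te: "te_elementary T \<sigma>1 \<sigma>2 \<alpha>1 \<alpha>2 c" "c = 0 \<longleftrightarrow> Nmon_zero T"
    and l: "exp (- 2 * of_real pi * \<i> * \<alpha>1) = l"
    by (rule te_elementary_exists[OF T(1-4)])
  interpret X: te_elementary T \<sigma>1 \<sigma>2 \<alpha>1 \<alpha>2 c by (rule te(1))
  have c0: "c \<noteq> 0" using te(2) T(5) by blast
  show ?thesis
    by (rule X.nilpotent_global_frame[OF c0 l \<beta>]) (rule that[OF X.te_rank2_axioms])
qed

lemma semisimple_isomorphic:
  fixes T :: "('v::ab_group_add) te" and T' :: "('w::ab_group_add) te"
  assumes T: "TE_structure T" "rk T = 2" "logarithmic T"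
    "eigenvalues_are (fscl T) (flat_mv T) Mmon {#l1, l2#}" "Nmon_zero T"
    "leading_exponents_ss T l1 l2 \<alpha>1 \<alpha>2"
    and T': "TE_structure T'" "rk T' = 2" "logarithmic T'"
    "eigenvalues_are (fscl T') (flat_mv T') Mmon {#\<mu>1, \<mu>2#}" "Nmon_zero T'"
    "leading_exponents_ss T' \<mu>1 \<mu>2 \<beta>1 \<beta>2"
    and eq: "{\<beta>1, \<beta>2} = {\<alpha>1, \<alpha>2}"
  shows "te_isomorphic T T'"
proof -
  obtain a b where X: "te_rank2 T" and fr: "te_rank2.frame2 T UNIV a b"
    and th: "\<And>z. z \<noteq> 0 \<Longrightarrow> te_rank2.theta T a z = scl T \<alpha>1 (a z)"
      "\<And>z. z \<noteq> 0 \<Longrightarrow> te_rank2.theta T b z = scl T \<alpha>2 (b z)"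
    using semisimple_normal_form[OF T] by metis
  obtain a' b' where Y: "te_rank2 T'" and fr': "te_rank2.frame2 T' UNIV a' b'"
    and th': "\<And>z. z \<noteq> 0 \<Longrightarrow> te_rank2.theta T' a' z = scl T' \<beta>1 (a' z)"
      "\<And>z. z \<noteq> 0 \<Longrightarrow> te_rank2.theta T' b' z = scl T' \<beta>2 (b' z)"
    using semisimple_normal_form[OF T'] by metis
  interpret X: te_rank2 T by (rule X)
  interpret Y: te_rank2 T' by (rule Y)
  have iso: "te_isomorphic T T'"
    if "Y.frame2 UNIV u v" "\<And>z. z \<noteq> 0 \<Longrightarrow> Y.theta u z = scl T' \<alpha>1 (u z)" "\<And>z. z \<noteq> 0 \<Longrightarrow> Y.theta v z = scl T' \<alpha>2 (v z)"
    for u v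
    using te_isomorphic_of_frames[OF X Y fr that(1), of "\<lambda>_. \<alpha>1" "\<lambda>_. 0" "\<lambda>_. 0" "\<lambda>_. \<alpha>2"] that(2,3) th by simp
  consider "\<beta>1 = \<alpha>1" "\<beta>2 = \<alpha>2" | "\<beta>1 = \<alpha>2" "\<beta>2 = \<alpha>1" using eq unfolding doubleton_eq_iff by blast
  then show ?thesis
  proof cases
    case 1
    show ?thesis by (rule iso[OF fr']) (use th' 1 in auto)
  next
    case 2
    have "Y.frame2 UNIV b' a'" using fr' Y.V.indep2_commute unfolding Y.frame2_def by blast
    then show ?thesis by (rule iso) (use th' 2 in auto)
  qed
qed

lemma nilpotent_isomorphic:
  fixes T :: "('v::ab_group_add) te" and T' :: "('w::ab_group_add) te"
  assumes T: "TE_structure T" "rk T = 2" "logarithmic T"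
    "eigenvalues_are (fscl T) (flat_mv T) Mmon {#l, l#}" "\<not> Nmon_zero T"
    "leading_exponents_nss T l \<alpha>1 \<alpha>2"
    and T': "TE_structure T'" "rk T' = 2" "logarithmic T'"
    "eigenvalues_are (fscl T') (flat_mv T') Mmon {#\<mu>, \<mu>#}" "\<not> Nmon_zero T'"
    "leading_exponents_nss T' \<mu> \<beta>1 \<beta>2"
    and eq: "{\<beta>1, \<beta>2} = {\<alpha>1, \<alpha>2}"
  shows "te_isomorphic T T'"
proof -
  obtain a b n where X: "te_rank2 T" and n: "\<alpha>1 - \<alpha>2 = of_nat n" and fr: "te_rank2.frame2 T UNIV a b"
    and th: "\<And>z. z \<noteq> 0 \<Longrightarrow> te_rank2.theta T a z = scl T \<alpha>1 (a z) + scl T (z ^ n) (b z)"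
      "\<And>z. z \<noteq> 0 \<Longrightarrow> te_rank2.theta T b z = scl T \<alpha>2 (b z)"
    using nilpotent_normal_form[OF T] by metis
  obtain a' b' n' where Y: "te_rank2 T'" and n': "\<beta>1 - \<beta>2 = of_nat n'" and fr': "te_rank2.frame2 T' UNIV a' b'"
    and th': "\<And>z. z \<noteq> 0 \<Longrightarrow> te_rank2.theta T' a' z = scl T' \<beta>1 (a' z) + scl T' (z ^ n') (b' z)"
      "\<And>z. z \<noteq> 0 \<Longrightarrow> te_rank2.theta T' b' z = scl T' \<beta>2 (b' z)"
    using nilpotent_normal_form[OF T'] by metis
  interpret X: te_rank2 T by (rule X)
  interpret Y: te_rank2 T' by (rule Y)
  have \<beta>: "\<beta>1 = \<alpha>1" "\<beta>2 = \<alpha>2"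
  proof -
    consider "\<beta>1 = \<alpha>1" "\<beta>2 = \<alpha>2" | "\<beta>1 = \<alpha>2" "\<beta>2 = \<alpha>1" using eq unfolding doubleton_eq_iff by blast
    then have "\<beta>1 = \<alpha>1 \<and> \<beta>2 = \<alpha>2"
    proof cases
      case 2
      then have "\<alpha>2 - \<alpha>1 \<in> \<nat>" "\<alpha>1 - \<alpha>2 \<in> \<nat>" using n n' by simp_all
      then show ?thesis using 2 Nats_antisym by blast
    qed simp
    then show "\<beta>1 = \<alpha>1" "\<beta>2 = \<alpha>2" by auto
  qed
  then have "n' = n" using n n' by simp
  then show ?thesis
    using te_isomorphic_of_frames[OF X Y fr fr', of "\<lambda>_. \<alpha>1" "\<lambda>z. z ^ n" "\<lambda>_. 0" "\<lambda>_. \<alpha>2"] th th' \<beta> by simp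
qed

theorem theorem4p20:
  fixes T :: "('v::ab_group_add) te" and l1 l2 :: complex
  assumes "TE_structure T" and "rk T = 2" and "logarithmic T"
    and "eigenvalues_are (fscl T) (flat_mv T) Mmon {#l1, l2#}"
  shows
    "(Nmon_zero T \<longrightarrow>
       (\<exists>\<alpha>1 \<alpha>2. leading_exponents_ss T l1 l2 \<alpha>1 \<alpha>2 \<and>
          (\<forall>\<beta>1 \<beta>2. leading_exponents_ss T l1 l2 \<beta>1 \<beta>2 \<longrightarrow>
             (\<beta>1 = \<alpha>1 \<and> \<beta>2 = \<alpha>2) \<or> (l1 = l2 \<and> \<beta>1 = \<alpha>2 \<and> \<beta>2 = \<alpha>1)) \<and>
          (\<forall>(T' :: ('w::ab_group_add) te) \<mu>1 \<mu>2 \<beta>1 \<beta>2.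
             TE_structure T' \<and> rk T' = 2 \<and> logarithmic T' \<and>
             eigenvalues_are (fscl T') (flat_mv T') Mmon {#\<mu>1, \<mu>2#} \<and>
             Nmon_zero T' \<and> leading_exponents_ss T' \<mu>1 \<mu>2 \<beta>1 \<beta>2 \<and>
             {\<beta>1, \<beta>2} = {\<alpha>1, \<alpha>2} \<longrightarrow> te_isomorphic T T')))
     \<and>
     (\<not> Nmon_zero T \<longrightarrow>
       l1 = l2 \<and>
       (\<exists>\<alpha>1 \<alpha>2. leading_exponents_nss T l1 \<alpha>1 \<alpha>2 \<and>
          (\<forall>\<beta>1 \<beta>2. leading_exponents_nss T l1 \<beta>1 \<beta>2 \<longrightarrow> \<beta>1 = \<alpha>1 \<and> \<beta>2 = \<alpha>2) \<and>
          (\<forall>(T' :: ('w::ab_group_add) te) \<mu> \<beta>1 \<beta>2.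
             TE_structure T' \<and> rk T' = 2 \<and> logarithmic T' \<and>
             eigenvalues_are (fscl T') (flat_mv T') Mmon {#\<mu>, \<mu>#} \<and>
             \<not> Nmon_zero T' \<and> leading_exponents_nss T' \<mu> \<beta>1 \<beta>2 \<and>
             {\<beta>1, \<beta>2} = {\<alpha>1, \<alpha>2} \<longrightarrow> te_isomorphic T T')))"
proof -
  obtain \<sigma>1 \<sigma>2 a1 a2 c where te: "te_elementary T \<sigma>1 \<sigma>2 a1 a2 c" and c: "c = 0 \<longleftrightarrow> Nmon_zero T"
    and l: "exp (- 2 * of_real pi * \<i> * a1) = l1" "exp (- 2 * of_real pi * \<i> * a2) = l2"
    and leq: "\<not> Nmon_zero T \<Longrightarrow> l1 = l2"
    using te_elementary_exists[OF assms] by metis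
  interpret X: te_elementary T \<sigma>1 \<sigma>2 a1 a2 c by (rule te)
  show ?thesis
  proof (intro conjI impI)
    assume N: "Nmon_zero T"
    then have c0: "c = 0" using c by blast
    obtain \<alpha>1 \<alpha>2 where \<alpha>: "leading_exponents_ss T l1 l2 \<alpha>1 \<alpha>2"
      by (rule X.semisimple_exponents_exist[OF c0 l])
    show "\<exists>\<alpha>1 \<alpha>2. leading_exponents_ss T l1 l2 \<alpha>1 \<alpha>2 \<and>
          (\<forall>\<beta>1 \<beta>2. leading_exponents_ss T l1 l2 \<beta>1 \<beta>2 \<longrightarrow>
             (\<beta>1 = \<alpha>1 \<and> \<beta>2 = \<alpha>2) \<or> (l1 = l2 \<and> \<beta>1 = \<alpha>2 \<and> \<beta>2 = \<alpha>1)) \<and>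
          (\<forall>(T' :: ('w::ab_group_add) te) \<mu>1 \<mu>2 \<beta>1 \<beta>2.
             TE_structure T' \<and> rk T' = 2 \<and> logarithmic T' \<and>
             eigenvalues_are (fscl T') (flat_mv T') Mmon {#\<mu>1, \<mu>2#} \<and>
             Nmon_zero T' \<and> leading_exponents_ss T' \<mu>1 \<mu>2 \<beta>1 \<beta>2 \<and>
             {\<beta>1, \<beta>2} = {\<alpha>1, \<alpha>2} \<longrightarrow> te_isomorphic T T')"
    proof (rule exI[of _ \<alpha>1], rule exI[of _ \<alpha>2], intro conjI allI impI)
      show "leading_exponents_ss T l1 l2 \<alpha>1 \<alpha>2" by (rule \<alpha>)
      show "(\<beta>1 = \<alpha>1 \<and> \<beta>2 = \<alpha>2) \<or> (l1 = l2 \<and> \<beta>1 = \<alpha>2 \<and> \<beta>2 = \<alpha>1)"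
        if "leading_exponents_ss T l1 l2 \<beta>1 \<beta>2" for \<beta>1 \<beta>2
        by (rule X.semisimple_exponents_unique[OF c0 \<alpha> that])
      show "te_isomorphic T T'"
        if "TE_structure T' \<and> rk T' = 2 \<and> logarithmic T' \<and>
             eigenvalues_are (fscl T') (flat_mv T') Mmon {#\<mu>1, \<mu>2#} \<and>
             Nmon_zero T' \<and> leading_exponents_ss T' \<mu>1 \<mu>2 \<beta>1 \<beta>2 \<and> {\<beta>1, \<beta>2} = {\<alpha>1, \<alpha>2}"
        for T' :: "'w te" and \<mu>1 \<mu>2 \<beta>1 \<beta>2
        using that by (elim conjE) (rule semisimple_isomorphic[OF assms N \<alpha>])
    qed
  next
    assume N: "\<not> Nmon_zero T"
    then have c0: "c \<noteq> 0" using c by blast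
    show "l1 = l2" by (rule leq[OF N])
    then have ev: "eigenvalues_are (fscl T) (flat_mv T) Mmon {#l1, l1#}" using assms(4) by simp
    obtain \<alpha>1 \<alpha>2 where \<alpha>: "leading_exponents_nss T l1 \<alpha>1 \<alpha>2"
      by (rule X.nilpotent_exponents_exist[OF c0 l(1)])
    show "\<exists>\<alpha>1 \<alpha>2. leading_exponents_nss T l1 \<alpha>1 \<alpha>2 \<and>
          (\<forall>\<beta>1 \<beta>2. leading_exponents_nss T l1 \<beta>1 \<beta>2 \<longrightarrow> \<beta>1 = \<alpha>1 \<and> \<beta>2 = \<alpha>2) \<and>
          (\<forall>(T' :: ('w::ab_group_add) te) \<mu> \<beta>1 \<beta>2.
             TE_structure T' \<and> rk T' = 2 \<and> logarithmic T' \<and>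
             eigenvalues_are (fscl T') (flat_mv T') Mmon {#\<mu>, \<mu>#} \<and>
             \<not> Nmon_zero T' \<and> leading_exponents_nss T' \<mu> \<beta>1 \<beta>2 \<and>
             {\<beta>1, \<beta>2} = {\<alpha>1, \<alpha>2} \<longrightarrow> te_isomorphic T T')"
    proof (rule exI[of _ \<alpha>1], rule exI[of _ \<alpha>2], intro conjI allI impI)
      show "leading_exponents_nss T l1 \<alpha>1 \<alpha>2" by (rule \<alpha>)
      show "\<beta>1 = \<alpha>1" "\<beta>2 = \<alpha>2" if "leading_exponents_nss T l1 \<beta>1 \<beta>2" for \<beta>1 \<beta>2
        using X.nilpotent_exponents_unique[OF c0 l(1) \<alpha> that] by blast+
      show "te_isomorphic T T'"
        if "TE_structure T' \<and> rk T' = 2 \<and> logarithmic T' \<and>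
             eigenvalues_are (fscl T') (flat_mv T') Mmon {#\<mu>, \<mu>#} \<and>
             \<not> Nmon_zero T' \<and> leading_exponents_nss T' \<mu> \<beta>1 \<beta>2 \<and> {\<beta>1, \<beta>2} = {\<alpha>1, \<alpha>2}"
        for T' :: "'w te" and \<mu> \<beta>1 \<beta>2
        using that by (elim conjE) (rule nilpotent_isomorphic[OF assms(1-3) ev N \<alpha>])
    qed
  qed
qed

end
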